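(* Let $\mathcal{G}$ be a simple undirected graph, let $c>1$ be an integer and let $\mathfrak{n}_{\mathcal{G},c}^{\mathbb{C}}$ be the associated $c$-step nilpotent complex Lie algebra. Every real form of $\mathfrak{n}_{\mathcal{G},c}^{\mathbb{C}}$ is $\mathbb{R}$-isomorphic to $\mathfrak{n}_{\varphi,c}^{\mathbb{R}}$ for some involution $\varphi\in\mathrm{Aut}(\overline{\mathcal{G}})$. If $\varphi,\phi\in\mathrm{Aut}(\overline{\mathcal{G}})$ are involutions, then the real forms $\mathfrak{n}_{\varphi,c}^{\mathbb{R}}$ and $\mathfrak{n}_{\phi,c}^{\mathbb{R}}$ are $\mathbb{R}$-isomorphic if and only if $\varphi$ and $\phi$ are conjugate in $\mathrm{Aut}(\overline{\mathcal{G}})$.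
   Context: A simple undirected graph is a pair $\mathcal{G}=(S,E)$ with $S$ a finite set and $E$ a set of two-element subsets of $S$. For a field $K\subset\mathbb{C}$, let $\mathfrak{f}^K(S)$ be the free Lie algebra on $S$ over $K$, let $I_{\mathcal{G}}$ be its ideal generated by $\{[\alpha,\beta]\mid \alpha,\beta\in S,\ \{\alpha,\beta\}\notin E\}$, and put $\mathfrak{g}_{\mathcal{G}}^K=\mathfrak{f}^K(S)/I_{\mathcal{G}}$. With the lower central series $\gamma_1(\mathfrak{g})=\mathfrak{g}$, $\gamma_{i+1}(\mathfrak{g})=[\mathfrak{g},\gamma_i(\mathfrak{g})]$, define for $c>1$: $\mathfrak{n}_{\mathcal{G},c}^K=\mathfrak{g}_{\mathcal{G}}^K/\gamma_{c+1}(\mathfrak{g}_{\mathcal{G}}^K)$. A real form of a complex Lie algebra $\mathfrak{n}^{\mathbb{C}}$ is a real Lie algebra $\mathfrak{m}$ with $\mathfrak{m}\otimes_{\mathbb{R}}\mathbb{C}\cong\mathfrak{n}^{\mathbb{C}}$ as complex Lie algebras. An involution of a group is an element $g$ with $g^2=1$; in particular the neutral element is an involution. Quotient graph: for $\alpha\in S$ let $\Omega'(\alpha)=\{\beta\in S\mid\{\alpha,\beta\}\in E\}$ and $\Omega(\alpha)=\Omega'(\alpha)\cup\{\alpha\}$. Write $\alpha\prec\beta$ if $\Omega'(\alpha)\subset\Omega(\beta)$ and $\alpha\sim\beta$ if $\alpha\prec\beta$ and $\beta\prec\alpha$. This is an equivalence relation; its classes are the coherent components and $\Lambda=S/\!\sim$.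 Set $\overline{\mathcal{G}}=(\Lambda,\overline{E},\Phi)$ with $\overline{E}=\{\{\lambda,\mu\}\mid\exists\alpha\in\lambda,\beta\in\mu:\{\alpha,\beta\}\in E\}$ (loops $\lambda=\mu$ allowed) and $\Phi(\lambda)=|\lambda|$. $\mathrm{Aut}(\overline{\mathcal{G}})$ is the group of permutations $\varphi$ of $\Lambda$ with $e\in\overline{E}\Leftrightarrow\varphi(e)\in\overline{E}$ and $\Phi\circ\varphi=\Phi$. The morphism $i$: fix once and for all an ordering $\lambda=\{\alpha_{\lambda,1},\dots,\alpha_{\lambda,|\lambda|}\}$ of the vertices in each coherent component. $i:\mathrm{Aut}(\overline{\mathcal{G}})\to\mathrm{Aut}(\mathfrak{n}_{\mathcal{G},c}^{\mathbb{C}})$ is the group morphism sending $\varphi$ to the unique Lie algebra automorphism with $i(\varphi)(\alpha_{\lambda,j})=\alpha_{\varphi(\lambda),j}$ for all $\lambda\in\Lambda$ and $1\le j\le|\lambda|$. The real forms: let $\tau\in\mathrm{Gal}(\mathbb{C}/\mathbb{R})$ be complex conjugation, acting on $\mathfrak{n}_{\mathcal{G},c}^{\mathbb{C}}=\mathfrak{n}_{\mathcal{G},c}^{\mathbb{R}}\otimes_{\mathbb{R}}\mathbb{C}$ by ${}^\tau(v\otimes z)=v\otimes\tau(z)$. For an involution $\varphi\in\mathrm{Aut}(\overline{\mathcal{G}})$ put $$\mathfrak{n}_{\varphi,c}^{\mathbb{R}}=\{v\in\mathfrak{n}_{\mathcal{G},c}^{\mathbb{C}}\mid i(\varphi)({}^\tau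 v)=v\},$$ a real Lie algebra (and a real form of $\mathfrak{n}_{\mathcal{G},c}^{\mathbb{C}}$) under the restricted operations. *)

theory Defs
  imports
    "HOL-Algebra.QuotRing"
    "HOL-Algebra.Algebraic_Closure_Type"
    "HOL-Library.Poly_Mapping"
    "HOL-Library.FuncSet"
    "HOL-Combinatorics.Permutations"
    Complex_Main
begin

section \<open>Nonassociative algebras and Lie algebras\<close>

text \<open>A (nonassociative) algebra over the field given by the type \<open>'k\<close> is a record of type
  \<open>('k, 'a) module\<close>. As in the locale \<^locale>\<open>algebra\<close> its product is the field \<open>mult\<close>; for
  a Lie algebra this is the bracket, i.e. \<open>x \<otimes> y\<close> stands for \<open>[x, y]\<close>. The field
  \<open>one\<close> has no meaning here and never enters a definition.\<close>

locale lie_algebra = module ring_of_type_algebra L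
  for L :: "('k::field, 'a) module" (structure) +
  assumes bracket_closed:
      "\<lbrakk>x \<in> carrier L; y \<in> carrier L\<rbrakk> \<Longrightarrow> x \<otimes> y \<in> carrier L"
    and bracket_l_distr:
      "\<lbrakk>x \<in> carrier L; y \<in> carrier L; z \<in> carrier L\<rbrakk> \<Longrightarrow> (x \<oplus> y) \<otimes> z = x \<otimes> z \<oplus> y \<otimes> z"
    and bracket_r_distr:
      "\<lbrakk>x \<in> carrier L; y \<in> carrier L; z \<in> carrier L\<rbrakk> \<Longrightarrow> z \<otimes> (x \<oplus> y) = z \<otimes> x \<oplus> z \<otimes> y"
    and bracket_smult_l:
      "\<lbrakk>x \<in> carrier L; y \<in> carrier L\<rbrakk> \<Longrightarrow> (a \<odot> x) \<otimes> y = a \<odot> (x \<otimes> y)"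
    and bracket_smult_r:
      "\<lbrakk>x \<in> carrier L; y \<in> carrier L\<rbrakk> \<Longrightarrow> x \<otimes> (a \<odot> y) = a \<odot> (x \<otimes> y)"
    and bracket_self:
      "x \<in> carrier L \<Longrightarrow> x \<otimes> x = \<zero>"
    and jacobi:
      "\<lbrakk>x \<in> carrier L; y \<in> carrier L; z \<in> carrier L\<rbrakk> \<Longrightarrow>
        x \<otimes> (y \<otimes> z) \<oplus> y \<otimes> (z \<otimes> x) \<oplus> z \<otimes> (x \<otimes> y) = \<zero>"

definition alg_hom :: "('k, 'a) module \<Rightarrow> ('k, 'b) module \<Rightarrow> ('a \<Rightarrow> 'b) set" where
  "alg_hom L M = {f \<in> carrier L \<rightarrow> carrier M.
     (\<forall>x\<in>carrier L. \<forall>y\<in>carrier L. f (x \<oplus>\<^bsub>L\<^esub> y) = f x \<oplus>\<^bsub>M\<^esub> f y) \<and>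
     (\<forall>a. \<forall>x\<in>carrier L. f (a \<odot>\<^bsub>L\<^esub> x) = a \<odot>\<^bsub>M\<^esub> f x) \<and>
     (\<forall>x\<in>carrier L. \<forall>y\<in>carrier L. f (x \<otimes>\<^bsub>L\<^esub> y) = f x \<otimes>\<^bsub>M\<^esub> f y)}"

definition alg_iso :: "('k, 'a) module \<Rightarrow> ('k, 'b) module \<Rightarrow> ('a \<Rightarrow> 'b) set" where
  "alg_iso L M = {f \<in> alg_hom L M. bij_betw f (carrier L) (carrier M)}"

definition alg_isomorphic :: "('k, 'a) module \<Rightarrow> ('k, 'b) module \<Rightarrow> bool" where
  "alg_isomorphic L M \<longleftrightarrow> alg_iso L M \<noteq> {}"

definition alg_ideal :: "('k::field, 'a) module \<Rightarrow> 'a set \<Rightarrow> bool" where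
  "alg_ideal L I \<longleftrightarrow> submodule I ring_of_type_algebra L \<and>
     (\<forall>x\<in>carrier L. \<forall>y\<in>I. x \<otimes>\<^bsub>L\<^esub> y \<in> I \<and> y \<otimes>\<^bsub>L\<^esub> x \<in> I)"

definition ideal_gen :: "('k::field, 'a) module \<Rightarrow> 'a set \<Rightarrow> 'a set" where
  "ideal_gen L A = alg_ideal L hull A"

definition lin_span :: "('k::field, 'a) module \<Rightarrow> 'a set \<Rightarrow> 'a set" where
  "lin_span L A = (\<lambda>U. submodule U ring_of_type_algebra L) hull A"

text \<open>\<^const>\<open>FactRing\<close> with the induced scalar multiplication added; the elements are the
  cosets \<open>I +> x\<close>.\<close>

definition quot_alg :: "('k, 'a) module \<Rightarrow> 'a set \<Rightarrow> ('k, 'a set) module" where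
  "quot_alg L I =
     \<lparr>carrier = carrier (L Quot I), monoid.mult = monoid.mult (L Quot I),
      one = monoid.one (L Quot I), ring.zero = ring.zero (L Quot I),
      ring.add = ring.add (L Quot I),
      module.smult = (\<lambda>a A. \<Union>x\<in>A. I +>\<^bsub>L\<^esub> (a \<odot>\<^bsub>L\<^esub> x))\<rparr>"

text \<open>The lower central series is indexed from 1; the value at 0 is only a convention.\<close>

fun lower_central :: "('k::field, 'a) module \<Rightarrow> nat \<Rightarrow> 'a set" where
  "lower_central L 0 = carrier L"
| "lower_central L (Suc 0) = carrier L"
| "lower_central L (Suc (Suc i)) =
     lin_span L {x \<otimes>\<^bsub>L\<^esub> y | x y. x \<in> carrier L \<and> y \<in> lower_central L (Suc i)}"


section \<open>The free Lie algebra on a set\<close>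

text \<open>The free Lie algebra on \<open>S\<close> is the free nonassociative algebra on \<open>S\<close> (finitely
  supported functions on the free magma) modulo the ideal generated by all \<open>[x, x]\<close> and all
  Jacobi expressions.\<close>

datatype (magma_atoms: 's) magma = Gen 's | Br "'s magma" "'s magma"

definition magma_mult ::
  "('s magma \<Rightarrow>\<^sub>0 'k::field) \<Rightarrow> ('s magma \<Rightarrow>\<^sub>0 'k) \<Rightarrow> ('s magma \<Rightarrow>\<^sub>0 'k)" where
  "magma_mult p q =
     (\<Sum>s\<in>Poly_Mapping.keys p. \<Sum>t\<in>Poly_Mapping.keys q.
        Poly_Mapping.single (Br s t) (Poly_Mapping.lookup p s * Poly_Mapping.lookup q t))"

definition magma_alg :: "'s set \<Rightarrow> ('k::field, 's magma \<Rightarrow>\<^sub>0 'k) module" where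
  "magma_alg S =
     \<lparr>carrier = {p. \<forall>t\<in>Poly_Mapping.keys p. magma_atoms t \<subseteq> S},
      monoid.mult = magma_mult, one = undefined, ring.zero = 0, ring.add = (+),
      module.smult = (\<lambda>a. Poly_Mapping.map ((*) a))\<rparr>"

definition lie_relators :: "('k, 'a) module \<Rightarrow> 'a set" where
  "lie_relators A =
     {x \<otimes>\<^bsub>A\<^esub> x | x. x \<in> carrier A} \<union>
     {x \<otimes>\<^bsub>A\<^esub> (y \<otimes>\<^bsub>A\<^esub> z) \<oplus>\<^bsub>A\<^esub> y \<otimes>\<^bsub>A\<^esub> (z \<otimes>\<^bsub>A\<^esub> x) \<oplus>\<^bsub>A\<^esub> z \<otimes>\<^bsub>A\<^esub> (x \<otimes>\<^bsub>A\<^esub> y) | x y z.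
        x \<in> carrier A \<and> y \<in> carrier A \<and> z \<in> carrier A}"

definition free_lie_ideal :: "'s set \<Rightarrow> ('s magma \<Rightarrow>\<^sub>0 'k::field) set" where
  "free_lie_ideal S = ideal_gen (magma_alg S) (lie_relators (magma_alg S))"

definition free_lie :: "'s set \<Rightarrow> ('k::field, ('s magma \<Rightarrow>\<^sub>0 'k) set) module" where
  "free_lie S = quot_alg (magma_alg S) (free_lie_ideal S)"

definition free_gen :: "'s set \<Rightarrow> 's \<Rightarrow> ('s magma \<Rightarrow>\<^sub>0 'k::field) set" where
  "free_gen S \<alpha> =
     free_lie_ideal S +>\<^bsub>(magma_alg S :: ('k, _) module)\<^esub> Poly_Mapping.single (Gen \<alpha>) 1"


section \<open>Lie algebras associated with graphs\<close>

definition simple_graph :: "'s set \<Rightarrow> 's set set \<Rightarrow> bool" where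
  "simple_graph S E \<longleftrightarrow> finite S \<and> (\<forall>e\<in>E. e \<subseteq> S \<and> card e = 2)"

definition graph_ideal :: "'s set \<Rightarrow> 's set set \<Rightarrow> ('s magma \<Rightarrow>\<^sub>0 'k::field) set set" where
  "graph_ideal S E =
     ideal_gen (free_lie S :: ('k, _) module)
       {free_gen S \<alpha> \<otimes>\<^bsub>(free_lie S :: ('k, _) module)\<^esub> free_gen S \<beta> | \<alpha> \<beta>.
          \<alpha> \<in> S \<and> \<beta> \<in> S \<and> {\<alpha>, \<beta>} \<notin> E}"

definition graph_lie ::
  "'s set \<Rightarrow> 's set set \<Rightarrow> ('k::field, ('s magma \<Rightarrow>\<^sub>0 'k) set set) module" where
  "graph_lie S E = quot_alg (free_lie S) (graph_ideal S E)"

definition nil_lie ::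
  "'s set \<Rightarrow> 's set set \<Rightarrow> nat \<Rightarrow> ('k::field, ('s magma \<Rightarrow>\<^sub>0 'k) set set set) module" where
  "nil_lie S E c = quot_alg (graph_lie S E) (lower_central (graph_lie S E) (c + 1))"

definition vertex ::
  "'s set \<Rightarrow> 's set set \<Rightarrow> nat \<Rightarrow> 's \<Rightarrow> ('s magma \<Rightarrow>\<^sub>0 'k::field) set set set" where
  "vertex S E c \<alpha> =
     lower_central (graph_lie S E :: ('k, _) module) (c + 1)
       +>\<^bsub>(graph_lie S E :: ('k, _) module)\<^esub>
         (graph_ideal S E +>\<^bsub>(free_lie S :: ('k, _) module)\<^esub> free_gen S \<alpha>)"


section \<open>Complexification and real forms\<close>

definition restrict_real :: "(complex, 'a) module \<Rightarrow> (real, 'a) module" where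
  "restrict_real L =
     \<lparr>carrier = carrier L, monoid.mult = monoid.mult L, one = monoid.one L,
      ring.zero = ring.zero L, ring.add = ring.add L,
      module.smult = (\<lambda>r. module.smult L (complex_of_real r))\<rparr>"

text \<open>The complex algebra obtained from a real one by extension of scalars: since \<open>1, \<i>\<close> is
  a real basis of the complex numbers, every element of the tensor product with them is
  uniquely of the form \<open>v \<otimes> 1 + w \<otimes> \<i>\<close>, and it is represented by the pair \<open>(v, w)\<close>.\<close>

definition complexification :: "(real, 'a) module \<Rightarrow> (complex, 'a \<times> 'a) module" where
  "complexification L =
     \<lparr>carrier = carrier L \<times> carrier L,
      monoid.mult = (\<lambda>(v, w) (v', w').
        (v \<otimes>\<^bsub>L\<^esub> v' \<ominus>\<^bsub>L\<^esub> w \<otimes>\<^bsub>L\<^esub> w', v \<otimes>\<^bsub>L\<^esub> w' \<oplus>\<^bsub>L\<^esub> w \<otimes>\<^bsub>L\<^esub> v')),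
      one = undefined,
      ring.zero = (\<zero>\<^bsub>L\<^esub>, \<zero>\<^bsub>L\<^esub>),
      ring.add = (\<lambda>(v, w) (v', w'). (v \<oplus>\<^bsub>L\<^esub> v', w \<oplus>\<^bsub>L\<^esub> w')),
      module.smult = (\<lambda>z (v, w).
        (Re z \<odot>\<^bsub>L\<^esub> v \<ominus>\<^bsub>L\<^esub> Im z \<odot>\<^bsub>L\<^esub> w, Re z \<odot>\<^bsub>L\<^esub> w \<oplus>\<^bsub>L\<^esub> Im z \<odot>\<^bsub>L\<^esub> v))\<rparr>"

text \<open>\<open>v \<otimes> z \<mapsto> v \<otimes> cnj z\<close> on the complexification.\<close>

definition complexification_conj :: "(real, 'a) module \<Rightarrow> 'a \<times> 'a \<Rightarrow> 'a \<times> 'a" where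
  "complexification_conj L = (\<lambda>(v, w). (v, \<ominus>\<^bsub>L\<^esub> w))"

definition real_form :: "(real, 'a) module \<Rightarrow> (complex, 'b) module \<Rightarrow> bool" where
  "real_form M N \<longleftrightarrow> lie_algebra M \<and> alg_isomorphic (complexification M) N"

text \<open>The canonical identification of the complexification of the real algebra \<^const>\<open>nil_lie\<close>
  with the complex one, the isomorphism sending \<open>\<alpha> \<otimes> 1\<close> to \<open>\<alpha>\<close> for every vertex.\<close>

definition nil_lie_base_change ::
  "'s set \<Rightarrow> 's set set \<Rightarrow> nat \<Rightarrow>
   ('s magma \<Rightarrow>\<^sub>0 real) set set set \<times> ('s magma \<Rightarrow>\<^sub>0 real) set set set \<Rightarrow>
   ('s magma \<Rightarrow>\<^sub>0 complex) set set set" where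
  "nil_lie_base_change S E c =
     (THE f. f \<in> alg_iso (complexification (nil_lie S E c)) (nil_lie S E c) \<and>
        f \<in> extensional (carrier (complexification (nil_lie S E c))) \<and>
        (\<forall>\<alpha>\<in>S. f (vertex S E c \<alpha>, \<zero>\<^bsub>nil_lie S E c\<^esub>) = vertex S E c \<alpha>))"

definition nil_lie_conj ::
  "'s set \<Rightarrow> 's set set \<Rightarrow> nat \<Rightarrow>
   ('s magma \<Rightarrow>\<^sub>0 complex) set set set \<Rightarrow> ('s magma \<Rightarrow>\<^sub>0 complex) set set set" where
  "nil_lie_conj S E c v =
     nil_lie_base_change S E c (complexification_conj (nil_lie S E c)
       (inv_into (carrier (complexification (nil_lie S E c))) (nil_lie_base_change S E c) v))"


section \<open>The quotient graph\<close>

definition open_nbhd :: "'s set \<Rightarrow> 's set set \<Rightarrow> 's \<Rightarrow> 's set" where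
  "open_nbhd S E \<alpha> = {\<beta> \<in> S. {\<alpha>, \<beta>} \<in> E}"

definition closed_nbhd :: "'s set \<Rightarrow> 's set set \<Rightarrow> 's \<Rightarrow> 's set" where
  "closed_nbhd S E \<alpha> = insert \<alpha> (open_nbhd S E \<alpha>)"

definition coherent_rel :: "'s set \<Rightarrow> 's set set \<Rightarrow> ('s \<times> 's) set" where
  "coherent_rel S E = {(\<alpha>, \<beta>). \<alpha> \<in> S \<and> \<beta> \<in> S \<and>
     open_nbhd S E \<alpha> \<subseteq> closed_nbhd S E \<beta> \<and> open_nbhd S E \<beta> \<subseteq> closed_nbhd S E \<alpha>}"

definition coherent_components :: "'s set \<Rightarrow> 's set set \<Rightarrow> 's set set" where
  "coherent_components S E = S // coherent_rel S E"

text \<open>An edge \<open>{\<kappa>, \<mu>}\<close> with \<open>\<kappa> = \<mu>\<close>, i.e. a loop, is the singleton \<open>{\<kappa>}\<close>.\<close>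

definition quotient_edges :: "'s set \<Rightarrow> 's set set \<Rightarrow> 's set set set" where
  "quotient_edges S E = {{\<kappa>, \<mu>} | \<kappa> \<mu>.
     \<kappa> \<in> coherent_components S E \<and> \<mu> \<in> coherent_components S E \<and>
     (\<exists>\<alpha>\<in>\<kappa>. \<exists>\<beta>\<in>\<mu>. {\<alpha>, \<beta>} \<in> E)}"

definition aut_quotient :: "'s set \<Rightarrow> 's set set \<Rightarrow> ('s set \<Rightarrow> 's set) monoid" where
  "aut_quotient S E =
     \<lparr>carrier = {\<phi>. \<phi> permutes coherent_components S E \<and>
        (\<forall>e. e \<subseteq> coherent_components S E \<longrightarrow>
           (e \<in> quotient_edges S E \<longleftrightarrow> \<phi> ` e \<in> quotient_edges S E)) \<and>
        (\<forall>\<kappa>\<in>coherent_components S E. card (\<phi> \<kappa>) = card \<kappa>)},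
      monoid.mult = (\<circ>), one = id\<rparr>"

text \<open>The neutral element counts as an involution.\<close>

definition involution :: "('a, 'b) monoid_scheme \<Rightarrow> 'a \<Rightarrow> bool" where
  "involution G g \<longleftrightarrow> g \<in> carrier G \<and> g \<otimes>\<^bsub>G\<^esub> g = \<one>\<^bsub>G\<^esub>"

definition conjugate_in :: "('a, 'b) monoid_scheme \<Rightarrow> 'a \<Rightarrow> 'a \<Rightarrow> bool" where
  "conjugate_in G g h \<longleftrightarrow> (\<exists>x\<in>carrier G. h = x \<otimes>\<^bsub>G\<^esub> g \<otimes>\<^bsub>G\<^esub> inv\<^bsub>G\<^esub> x)"


section \<open>The real forms attached to involutions\<close>

text \<open>\<open>enum \<kappa> j\<close> is the vertex \<open>\<alpha>\<^bsub>\<kappa>,j\<^esub>\<close> of the fixed ordering of \<open>\<kappa>\<close>.\<close>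

definition component_ordering ::
  "'s set \<Rightarrow> 's set set \<Rightarrow> ('s set \<Rightarrow> nat \<Rightarrow> 's) \<Rightarrow> bool" where
  "component_ordering S E enum \<longleftrightarrow>
     (\<forall>\<kappa>\<in>coherent_components S E. bij_betw (enum \<kappa>) {1..card \<kappa>} \<kappa>)"

definition aut_lift ::
  "'s set \<Rightarrow> 's set set \<Rightarrow> nat \<Rightarrow> ('s set \<Rightarrow> nat \<Rightarrow> 's) \<Rightarrow> ('s set \<Rightarrow> 's set) \<Rightarrow>
   ('s magma \<Rightarrow>\<^sub>0 complex) set set set \<Rightarrow> ('s magma \<Rightarrow>\<^sub>0 complex) set set set" where
  "aut_lift S E c enum \<phi> =
     (THE f. f \<in> alg_iso (nil_lie S E c) (nil_lie S E c) \<and>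
        f \<in> extensional (carrier (nil_lie S E c)) \<and>
        (\<forall>\<kappa>\<in>coherent_components S E. \<forall>j\<in>{1..card \<kappa>}.
           f (vertex S E c (enum \<kappa> j)) = vertex S E c (enum (\<phi> \<kappa>) j)))"

definition twisted_form ::
  "'s set \<Rightarrow> 's set set \<Rightarrow> nat \<Rightarrow> ('s set \<Rightarrow> nat \<Rightarrow> 's) \<Rightarrow> ('s set \<Rightarrow> 's set) \<Rightarrow>
   (real, ('s magma \<Rightarrow>\<^sub>0 complex) set set set) module" where
  "twisted_form S E c enum \<phi> =
     (restrict_real (nil_lie S E c))
       \<lparr>carrier := {v \<in> carrier (nil_lie S E c).
          aut_lift S E c enum \<phi> (nil_lie_conj S E c v) = v}\<rparr>"

end

theory Submission
  imports Defs
begin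

text \<open>A real form of \<open>\<nn>\<close> is the fixed point algebra of a conjugate linear involution \<open>\<sigma>\<close>, so both
  claims are about conjugacy classes of such involutions. On \<open>V = \<nn> / [\<nn>, \<nn>]\<close>, with the vertices as
  basis, let \<open>V\<^sub>\<lambda>\<close> be the span of the vertices dominated by the component \<open>\<lambda>\<close>. The \<open>V\<^sub>\<lambda>\<close> are the
  submodules generated by a single vertex for the algebra of infinitesimal automorphisms, which is
  spanned by matrix units and normalised by every semilinear automorphism. So such an automorphism
  permutes the \<open>V\<^sub>\<lambda>\<close>, which gives a homomorphism to the automorphisms of the quotient graph split by
  the vertex permutations; isomorphic twisted forms therefore have conjugate involutions.

  Conversely let \<open>\<sigma>\<close> induce \<open>\<phi>\<close> and let \<open>\<tau>\<close> be the standard involution attached to \<open>\<phi>\<close>. For generic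
  \<open>z\<close> the map \<open>z + cnj z \<sigma> \<tau>\<close> intertwines \<open>\<tau>\<close> with \<open>\<sigma>\<close> and is invertible on \<open>V\<close>. To lift it to \<open>\<nn>\<close>,
  average the degree derivation over \<open>\<sigma>\<close>: its eigenspace of eigenvalue 1 is a \<open>\<sigma>\<close>-stable complement
  of \<open>[\<nn>, \<nn>]\<close> on which the defining relations hold exactly.\<close>

section \<open>Nonassociative algebras\<close>

text \<open>No basis or dimension of the whole algebra is used. The concrete maps out of
  \<open>nil_lie\<close> come from \<open>nil_lie_universal\<close> and are compared on vertices;
  antilinear maps, derivations and base change become ordinary homomorphisms once the target algebra
  is altered. Such arguments never show that a bracket is nonzero. This is the task of the explicit
  model \<open>two_step\<close>, into which the algebra maps thanks to c > 1: through it a vanishing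
  bracket becomes a condition on coordinates in V. The main obstacle is the way back from V. A
  linear map of V lifts only if the images of nonadjacent vertices can be chosen with bracket zero,
  but coordinates control that bracket only modulo triple brackets. Two facts meet here: a map
  sending each vertex into the span of the vertices it dominates respects nonadjacency on V
  (\<open>nonedge_dominated\<close>), and brackets of degree one vectors have degree two, so they
  cannot hide in the third term. The map z + cnj z \<sigma> \<tau> is of that kind because \<sigma>
  and \<tau> induce the same \<phi>, so \<sigma> \<tau> stabilises every subspace of the
  family.\<close>

locale nonassoc_algebra = abelian_group L
  for L :: "('k::field, 'a) module" (structure) +
  assumes smult_closed [simp, intro]: "x \<in> carrier L \<Longrightarrow> a \<odot> x \<in> carrier L"
    and smult_l_distr: "x \<in> carrier L \<Longrightarrow> (a + b) \<odot> x = a \<odot> x \<oplus> b \<odot> x"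
    and smult_r_distr:
      "\<lbrakk>x \<in> carrier L; y \<in> carrier L\<rbrakk> \<Longrightarrow> a \<odot> (x \<oplus> y) = a \<odot> x \<oplus> a \<odot> y"
    and smult_assoc: "x \<in> carrier L \<Longrightarrow> a \<odot> (b \<odot> x) = (a * b) \<odot> x"
    and smult_one [simp]: "x \<in> carrier L \<Longrightarrow> 1 \<odot> x = x"
    and mult_closed [simp, intro]:
      "\<lbrakk>x \<in> carrier L; y \<in> carrier L\<rbrakk> \<Longrightarrow> x \<otimes> y \<in> carrier L"
    and mult_l_distr:
      "\<lbrakk>x \<in> carrier L; y \<in> carrier L; z \<in> carrier L\<rbrakk> \<Longrightarrow> (x \<oplus> y) \<otimes> z = x \<otimes> z \<oplus> y \<otimes> z"
    and mult_r_distr: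
      "\<lbrakk>x \<in> carrier L; y \<in> carrier L; z \<in> carrier L\<rbrakk> \<Longrightarrow> z \<otimes> (x \<oplus> y) = z \<otimes> x \<oplus> z \<otimes> y"
    and mult_smult_l:
      "\<lbrakk>x \<in> carrier L; y \<in> carrier L\<rbrakk> \<Longrightarrow> (a \<odot> x) \<otimes> y = a \<odot> (x \<otimes> y)"
    and mult_smult_r:
      "\<lbrakk>x \<in> carrier L; y \<in> carrier L\<rbrakk> \<Longrightarrow> x \<otimes> (a \<odot> y) = a \<odot> (x \<otimes> y)"

text \<open>Kept apart from the linear axioms because the free nonassociative algebra, where the
  construction starts, does not satisfy these identities in general.\<close>

locale lie = nonassoc_algebra +
  assumes mult_self: "x \<in> carrier L \<Longrightarrow> x \<otimes> x = \<zero>"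
    and jacobi:
      "\<lbrakk>x \<in> carrier L; y \<in> carrier L; z \<in> carrier L\<rbrakk> \<Longrightarrow>
        x \<otimes> (y \<otimes> z) \<oplus> y \<otimes> (z \<otimes> x) \<oplus> z \<otimes> (x \<otimes> y) = \<zero>"

lemma ring_of_type_algebra_simps [simp]:
  "carrier (ring_of_type_algebra :: 'k::field ring) = UNIV"
  "a \<otimes>\<^bsub>(ring_of_type_algebra :: 'k ring)\<^esub> b = a * b"
  "a \<oplus>\<^bsub>(ring_of_type_algebra :: 'k ring)\<^esub> b = a + b"
  "\<one>\<^bsub>(ring_of_type_algebra :: 'k ring)\<^esub> = 1"
  "\<zero>\<^bsub>(ring_of_type_algebra :: 'k ring)\<^esub> = 0"
  by (auto simp: ring_of_type_algebra_def)

lemma lie_algebra_iff: "lie_algebra L \<longleftrightarrow> lie L"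
proof
  assume "lie_algebra L"
  then interpret lie_algebra L .
  show "lie L"
    using bracket_closed bracket_l_distr bracket_r_distr bracket_smult_l bracket_smult_r
      bracket_self jacobi smult_closed smult_l_distr smult_r_distr smult_assoc1 smult_one
    by unfold_locales auto
next
  assume "lie L"
  then interpret lie L .
  have "module ring_of_type_algebra L"
    by (rule moduleI) (auto simp: smult_l_distr smult_r_distr smult_assoc
        intro: cring_from_type_algebra abelian_group_axioms)
  then show "lie_algebra L"
    by (auto simp: lie_algebra_def lie_algebra_axioms_def mult_l_distr mult_r_distr
        mult_smult_l mult_smult_r mult_self jacobi)
qed

section \<open>Linear subspaces, spans and generated ideals\<close>

definition subspace_of :: "('k::field, 'a) module \<Rightarrow> 'a set \<Rightarrow> bool" where
  "subspace_of L U \<longleftrightarrow> U \<subseteq> carrier L \<and> \<zero>\<^bsub>L\<^esub> \<in> U \<and>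
     (\<forall>x\<in>U. \<forall>y\<in>U. x \<oplus>\<^bsub>L\<^esub> y \<in> U) \<and> (\<forall>a. \<forall>x\<in>U. a \<odot>\<^bsub>L\<^esub> x \<in> U)"

lemma subspace_ofI:
  assumes "U \<subseteq> carrier L" "\<zero>\<^bsub>L\<^esub> \<in> U" "\<And>x y. x \<in> U \<Longrightarrow> y \<in> U \<Longrightarrow> x \<oplus>\<^bsub>L\<^esub> y \<in> U"
    "\<And>a x. x \<in> U \<Longrightarrow> a \<odot>\<^bsub>L\<^esub> x \<in> U"
  shows "subspace_of L U"
  using assms by (auto simp: subspace_of_def)

lemma subspace_ofD:
  assumes "subspace_of L U"
  shows "\<And>x. x \<in> U \<Longrightarrow> x \<in> carrier L" "\<zero>\<^bsub>L\<^esub> \<in> U"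
    "\<And>x y. x \<in> U \<Longrightarrow> y \<in> U \<Longrightarrow> x \<oplus>\<^bsub>L\<^esub> y \<in> U"
    "\<And>a x. x \<in> U \<Longrightarrow> a \<odot>\<^bsub>L\<^esub> x \<in> U"
  using assms by (auto simp: subspace_of_def)

context nonassoc_algebra
begin

lemma smult_0 [simp]: assumes "x \<in> carrier L" shows "0 \<odot> x = \<zero>"
proof -
  have "0 \<odot> x \<oplus> 0 \<odot> x = 0 \<odot> x \<oplus> \<zero>"
    using assms smult_l_distr[of x 0 0] by simp
  then show ?thesis using assms by (metis add.l_cancel smult_closed zero_closed)
qed

lemma smult_diff: "x \<in> carrier L \<Longrightarrow> (a - b) \<odot> x = a \<odot> x \<oplus> (- b) \<odot> x"
  using smult_l_distr[of x a "- b"] by simp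

lemma smult_zero [simp]: "a \<odot> \<zero> = \<zero>"
proof -
  have "a \<odot> \<zero> \<oplus> a \<odot> \<zero> = a \<odot> \<zero> \<oplus> \<zero>"
    using smult_r_distr[of \<zero> \<zero> a] by simp
  then show ?thesis by (metis add.l_cancel smult_closed zero_closed)
qed

lemma smult_neg1: assumes "x \<in> carrier L" shows "(- 1) \<odot> x = \<ominus> x"
proof -
  have "(- 1) \<odot> x \<oplus> x = \<zero>"
    using assms smult_l_distr[of x "- 1" 1] by simp
  then show ?thesis using assms by (metis minus_equality smult_closed)
qed

lemma minus_smult: "x \<in> carrier L \<Longrightarrow> \<ominus> x = (- 1) \<odot> x"
  by (simp add: smult_neg1)

lemma minus_conv: "x \<in> carrier L \<Longrightarrow> y \<in> carrier L \<Longrightarrow> x \<ominus> y = x \<oplus> (- 1) \<odot> y"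
  by (simp add: minus_eq smult_neg1)

lemma mult_zero [simp]:
  assumes "x \<in> carrier L" shows "x \<otimes> \<zero> = \<zero>" "\<zero> \<otimes> x = \<zero>"
  using mult_smult_r[of x \<zero> 0] mult_smult_l[of \<zero> x 0] assms by simp_all

lemma eq_iff_diff:
  assumes "x \<in> carrier L" "y \<in> carrier L" shows "x = y \<longleftrightarrow> x \<ominus> y = \<zero>"
proof
  assume "x \<ominus> y = \<zero>"
  then have "\<ominus> (\<ominus> y) = x" using assms by (intro minus_equality) (simp_all add: minus_eq)
  then show "x = y" using assms by simp
qed (use assms in \<open>simp add: minus_eq r_neg\<close>)

lemma smult_eq_zero:
  assumes "x \<in> carrier L" "a \<odot> x = \<zero>" "a \<noteq> 0" shows "x = \<zero>"
proof -
  have "inverse a \<odot> (a \<odot> x) = x" using assms(1,3) by (simp add: smult_assoc)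
  then show ?thesis using assms(2) by simp
qed

text \<open>Closure under negation, part of the notion of submodule, is multiplication by -1 and so
  is covered by closure under scalars.\<close>

lemma submodule_iff: "submodule U ring_of_type_algebra L \<longleftrightarrow> subspace_of L U"
proof -
  interpret m: module ring_of_type_algebra L
    by (rule moduleI) (auto simp: smult_l_distr smult_r_distr smult_assoc
        intro: cring_from_type_algebra abelian_group_axioms)
  show ?thesis
  proof
    assume U: "submodule U ring_of_type_algebra L"
    note e = m.submoduleE[OF U]
    have "\<zero> \<in> U" using submodule.axioms(1)[OF U] subgroup.one_closed by fastforce
    with e show "subspace_of L U" by (auto simp: subspace_of_def)
  next
    assume U: "subspace_of L U"
    then show "submodule U ring_of_type_algebra L"
      by (intro m.submoduleI) (auto simp: subspace_of_def minus_smult subset_iff)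
  qed
qed

lemma subspace_diff:
  assumes "subspace_of L U" "x \<in> U" "y \<in> U" shows "x \<ominus> y \<in> U"
  using subspace_ofD[OF assms(1)] assms(2,3) by (simp add: minus_conv)

lemma subspace_carrier: "subspace_of L (carrier L)"
  by (auto simp: subspace_of_def)

lemma subspace_Inter:
  assumes "\<And>U. U \<in> F \<Longrightarrow> subspace_of L U" "F \<noteq> {}" shows "subspace_of L (\<Inter>F)"
  using assms unfolding subspace_of_def by (blast 8)

lemma alg_ideal_iff: "alg_ideal L I \<longleftrightarrow> subspace_of L I \<and>
    (\<forall>x\<in>carrier L. \<forall>y\<in>I. x \<otimes> y \<in> I \<and> y \<otimes> x \<in> I)"
  by (simp add: alg_ideal_def submodule_iff)

lemma lin_span_subspace: "A \<subseteq> carrier L \<Longrightarrow> subspace_of L (lin_span L A)"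
  unfolding lin_span_def hull_def submodule_iff
  by (rule subspace_Inter) (auto intro: subspace_carrier)

lemma lin_span_incl: "A \<subseteq> lin_span L A"
  unfolding lin_span_def by (rule hull_subset)

lemma lin_span_minimal: "A \<subseteq> U \<Longrightarrow> subspace_of L U \<Longrightarrow> lin_span L A \<subseteq> U"
  unfolding lin_span_def by (rule hull_minimal) (auto simp: submodule_iff)

lemma ideal_gen_ideal: "A \<subseteq> carrier L \<Longrightarrow> alg_ideal L (ideal_gen L A)"
proof -
  assume A: "A \<subseteq> carrier L"
  \<comment> \<open>The hull is an intersection over a nonempty family, since the whole algebra
    belongs to it.\<close>
  have c: "carrier L \<in> {t. alg_ideal L t \<and> A \<subseteq> t}"
    using A by (auto simp: alg_ideal_iff subspace_carrier)
  have "subspace_of L (\<Inter>{t. alg_ideal L t \<and> A \<subseteq> t})"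
    using c by (intro subspace_Inter) (auto simp: alg_ideal_iff)
  then show ?thesis unfolding ideal_gen_def hull_def
    by (auto simp: alg_ideal_iff)
qed

lemma ideal_gen_incl: "A \<subseteq> ideal_gen L A"
  unfolding ideal_gen_def by (rule hull_subset)

lemma ideal_gen_minimal: "A \<subseteq> I \<Longrightarrow> alg_ideal L I \<Longrightarrow> ideal_gen L A \<subseteq> I"
  unfolding ideal_gen_def by (rule hull_minimal)

end

section \<open>Homomorphisms, and transport of the axioms along surjections\<close>

lemma alg_homI:
  assumes "\<And>x. x \<in> carrier L \<Longrightarrow> f x \<in> carrier M"
    "\<And>x y. x \<in> carrier L \<Longrightarrow> y \<in> carrier L \<Longrightarrow> f (x \<oplus>\<^bsub>L\<^esub> y) = f x \<oplus>\<^bsub>M\<^esub> f y"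
    "\<And>a x. x \<in> carrier L \<Longrightarrow> f (a \<odot>\<^bsub>L\<^esub> x) = a \<odot>\<^bsub>M\<^esub> f x"
    "\<And>x y. x \<in> carrier L \<Longrightarrow> y \<in> carrier L \<Longrightarrow> f (x \<otimes>\<^bsub>L\<^esub> y) = f x \<otimes>\<^bsub>M\<^esub> f y"
  shows "f \<in> alg_hom L M"
  using assms by (auto simp: alg_hom_def)

lemma alg_homD:
  assumes "f \<in> alg_hom L M"
  shows "\<And>x. x \<in> carrier L \<Longrightarrow> f x \<in> carrier M"
    "\<And>x y. x \<in> carrier L \<Longrightarrow> y \<in> carrier L \<Longrightarrow> f (x \<oplus>\<^bsub>L\<^esub> y) = f x \<oplus>\<^bsub>M\<^esub> f y"
    "\<And>a x. x \<in> carrier L \<Longrightarrow> f (a \<odot>\<^bsub>L\<^esub> x) = a \<odot>\<^bsub>M\<^esub> f x"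
    "\<And>x y. x \<in> carrier L \<Longrightarrow> y \<in> carrier L \<Longrightarrow> f (x \<otimes>\<^bsub>L\<^esub> y) = f x \<otimes>\<^bsub>M\<^esub> f y"
  using assms by (auto simp: alg_hom_def)

lemma alg_hom_zero:
  assumes "nonassoc_algebra L" "nonassoc_algebra M" "f \<in> alg_hom L M"
  shows "f \<zero>\<^bsub>L\<^esub> = \<zero>\<^bsub>M\<^esub>"
proof -
  interpret L: nonassoc_algebra L by fact
  interpret M: nonassoc_algebra M by fact
  have "f (0 \<odot>\<^bsub>L\<^esub> \<zero>\<^bsub>L\<^esub>) = 0 \<odot>\<^bsub>M\<^esub> f \<zero>\<^bsub>L\<^esub>" using alg_homD(3)[OF assms(3)] L.zero_closed by blast
  then show ?thesis using alg_homD(1)[OF assms(3)] by simp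
qed

lemma alg_hom_comp:
  assumes "f \<in> alg_hom L M" "g \<in> alg_hom M N" shows "(\<lambda>x. g (f x)) \<in> alg_hom L N"
  using assms by (auto simp: alg_hom_def Pi_iff)

lemma alg_hom_vimage_subspace:
  assumes "nonassoc_algebra L" "nonassoc_algebra M" "f \<in> alg_hom L M" "subspace_of M U"
  shows "subspace_of L {x \<in> carrier L. f x \<in> U}"
proof -
  interpret L: nonassoc_algebra L by fact
  show ?thesis
    using subspace_ofD[OF assms(4)] alg_homD[OF assms(3)] alg_hom_zero[OF assms(1-3)]
    by (intro subspace_ofI) auto
qed

lemma alg_hom_vimage_ideal:
  assumes "nonassoc_algebra L" "nonassoc_algebra M" "f \<in> alg_hom L M" "alg_ideal M U"
  shows "alg_ideal L {x \<in> carrier L. f x \<in> U}"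
proof -
  interpret L: nonassoc_algebra L by fact
  interpret M: nonassoc_algebra M by fact
  show ?thesis
    using alg_hom_vimage_subspace[OF assms(1-3), of U] assms(4) alg_homD[OF assms(3)]
    by (auto simp: L.alg_ideal_iff M.alg_ideal_iff)
qed

text \<open>Each axiom is an identity or a closure property, so it passes to a surjective image. Of
  \<open>Q\<close> only the operations are given, which makes this the way to equip a coset algebra
  with its axioms; the zeros are matched separately because \<open>alg_hom\<close> does not mention
  them.\<close>

lemma nonassoc_algebra_image:
  assumes "nonassoc_algebra L" and f: "f \<in> alg_hom L Q" and surj: "f ` carrier L = carrier Q"
    and zero: "f \<zero>\<^bsub>L\<^esub> = \<zero>\<^bsub>Q\<^esub>"
  shows "nonassoc_algebra Q"
proof -
  interpret L: nonassoc_algebra L by fact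
  note h = alg_homD[OF f]
  have "abelian_group Q"
  proof (rule abelian_groupI)
    fix x y assume "x \<in> carrier Q" "y \<in> carrier Q"
    then obtain x' y' where "x = f x'" "y = f y'"
      "x' \<in> carrier L" "y' \<in> carrier L" using surj by blast
    then show "x \<oplus>\<^bsub>Q\<^esub> y \<in> carrier Q"
      by (simp add: h(2)[symmetric] h(1))
  next
    fix x y z assume a: "x \<in> carrier Q" "y \<in> carrier Q" "z \<in> carrier Q"
    then obtain x' y' z' where "x = f x'" "y = f y'" "z = f z'"
      "x' \<in> carrier L" "y' \<in> carrier L" "z' \<in> carrier L" using surj by blast
    then show "(x \<oplus>\<^bsub>Q\<^esub> y) \<oplus>\<^bsub>Q\<^esub> z = x \<oplus>\<^bsub>Q\<^esub> (y \<oplus>\<^bsub>Q\<^esub> z)"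
      by (simp add: h(2)[symmetric] L.a_assoc)
  next
    fix x y assume a: "x \<in> carrier Q" "y \<in> carrier Q"
    then obtain x' y' where "x = f x'" "y = f y'"
      "x' \<in> carrier L" "y' \<in> carrier L" using surj by blast
    then show "x \<oplus>\<^bsub>Q\<^esub> y = y \<oplus>\<^bsub>Q\<^esub> x"
      by (simp add: h(2)[symmetric] L.a_comm)
  next
    show "\<zero>\<^bsub>Q\<^esub> \<in> carrier Q" using zero h(1) by (metis L.zero_closed)
  next
    fix x assume a: "x \<in> carrier Q"
    then obtain x' where x: "x = f x'" "x' \<in> carrier L" using surj by blast
    then show "\<zero>\<^bsub>Q\<^esub> \<oplus>\<^bsub>Q\<^esub> x = x"
      by (simp add: h(2)[symmetric] zero[symmetric])
    have "f (\<ominus>\<^bsub>L\<^esub> x') \<oplus>\<^bsub>Q\<^esub> x = \<zero>\<^bsub>Q\<^esub>"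
      using x by (simp add: h(2)[symmetric] zero[symmetric] L.l_neg)
    then show "\<exists>y\<in>carrier Q. y \<oplus>\<^bsub>Q\<^esub> x = \<zero>\<^bsub>Q\<^esub>" using x h(1) by blast
  qed
  moreover have "nonassoc_algebra_axioms Q"
  proof
    fix x y z a b assume x: "x \<in> carrier Q"
    then obtain x' where x': "x = f x'" "x' \<in> carrier L" using surj by blast
    show "a \<odot>\<^bsub>Q\<^esub> x \<in> carrier Q" using x' by (simp add: h(3)[symmetric] h(1))
    show "(a + b) \<odot>\<^bsub>Q\<^esub> x = a \<odot>\<^bsub>Q\<^esub> x \<oplus>\<^bsub>Q\<^esub> b \<odot>\<^bsub>Q\<^esub> x"
      using x' by (simp add: h(3)[symmetric] h(2)[symmetric] L.smult_l_distr)
    show "a \<odot>\<^bsub>Q\<^esub> (b \<odot>\<^bsub>Q\<^esub> x) = (a * b) \<odot>\<^bsub>Q\<^esub> x"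
      using x' by (simp add: h(3)[symmetric] L.smult_assoc)
    show "1 \<odot>\<^bsub>Q\<^esub> x = x"
      using x' by (simp add: h(3)[symmetric])
    assume "y \<in> carrier Q"
    then obtain y' where y': "y = f y'" "y' \<in> carrier L" using surj by blast
    show "a \<odot>\<^bsub>Q\<^esub> (x \<oplus>\<^bsub>Q\<^esub> y) = a \<odot>\<^bsub>Q\<^esub> x \<oplus>\<^bsub>Q\<^esub> a \<odot>\<^bsub>Q\<^esub> y"
      using x' y' by (simp add: h(3)[symmetric] h(2)[symmetric] L.smult_r_distr)
    show "x \<otimes>\<^bsub>Q\<^esub> y \<in> carrier Q" using x' y' by (simp add: h(4)[symmetric] h(1))
    show "(a \<odot>\<^bsub>Q\<^esub> x) \<otimes>\<^bsub>Q\<^esub> y = a \<odot>\<^bsub>Q\<^esub> (x \<otimes>\<^bsub>Q\<^esub> y)" "x \<otimes>\<^bsub>Q\<^esub> (a \<odot>\<^bsub>Q\<^esub> y) = a \<odot>\<^bsub>Q\<^esub> (x \<otimes>\<^bsub>Q\<^esub> y)"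
      using x' y' by (simp_all add: h(3)[symmetric] h(4)[symmetric] L.mult_smult_l L.mult_smult_r)
    assume "z \<in> carrier Q"
    then obtain z' where z': "z = f z'" "z' \<in> carrier L" using surj by blast
    show "(x \<oplus>\<^bsub>Q\<^esub> y) \<otimes>\<^bsub>Q\<^esub> z = x \<otimes>\<^bsub>Q\<^esub> z \<oplus>\<^bsub>Q\<^esub> y \<otimes>\<^bsub>Q\<^esub> z" "z \<otimes>\<^bsub>Q\<^esub> (x \<oplus>\<^bsub>Q\<^esub> y) = z \<otimes>\<^bsub>Q\<^esub> x \<oplus>\<^bsub>Q\<^esub> z \<otimes>\<^bsub>Q\<^esub> y"
      using x' y' z' by (simp_all add: h(2)[symmetric] h(4)[symmetric] L.mult_l_distr L.mult_r_distr)
  qed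
  ultimately show ?thesis by (simp add: nonassoc_algebra_def)
qed

lemma lie_image:
  assumes "lie L" and f: "f \<in> alg_hom L Q" and surj: "f ` carrier L = carrier Q"
    and zero: "f \<zero>\<^bsub>L\<^esub> = \<zero>\<^bsub>Q\<^esub>"
  shows "lie Q"
proof -
  interpret L: lie L by fact
  interpret Q: nonassoc_algebra Q
    by (rule nonassoc_algebra_image[OF _ f surj zero]) unfold_locales
  note h = alg_homD[OF f]
  show ?thesis
  proof
    fix x y z assume x: "x \<in> carrier Q"
    then obtain x' where x': "x = f x'" "x' \<in> carrier L" using surj by blast
    then show "x \<otimes>\<^bsub>Q\<^esub> x = \<zero>\<^bsub>Q\<^esub>" by (simp add: h(4)[symmetric] L.mult_self zero)
    assume "y \<in> carrier Q" "z \<in> carrier Q"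
    then obtain y' z' where y': "y = f y'" "y' \<in> carrier L" "z = f z'" "z' \<in> carrier L"
      using surj by blast
    show "x \<otimes>\<^bsub>Q\<^esub> (y \<otimes>\<^bsub>Q\<^esub> z) \<oplus>\<^bsub>Q\<^esub> y \<otimes>\<^bsub>Q\<^esub> (z \<otimes>\<^bsub>Q\<^esub> x) \<oplus>\<^bsub>Q\<^esub> z \<otimes>\<^bsub>Q\<^esub> (x \<otimes>\<^bsub>Q\<^esub> y) = \<zero>\<^bsub>Q\<^esub>"
      using x' y' by (simp add: h(4)[symmetric] h(2)[symmetric] L.jacobi zero)
  qed
qed

subsection \<open>Quotients\<close>

text \<open>The product and the scalar multiplication of \<open>quot_alg\<close> are unions over
  representatives; this evaluates such a union once the choice of representative is known not to
  matter.\<close>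

lemma UN_eqI: "x \<in> A \<Longrightarrow> (\<And>y. y \<in> A \<Longrightarrow> f y = B) \<Longrightarrow> (\<Union>y\<in>A. f y) = B"
  by auto

locale algebra_quotient = nonassoc_algebra +
  fixes I assumes ideal: "alg_ideal L I"
begin

lemma I_subspace: "subspace_of L I" and
  I_mult: "x \<in> carrier L \<Longrightarrow> y \<in> I \<Longrightarrow> x \<otimes> y \<in> I" "x \<in> carrier L \<Longrightarrow> y \<in> I \<Longrightarrow> y \<otimes> x \<in> I"
  using ideal by (auto simp: alg_ideal_iff)

lemma I_abelian_subgroup: "abelian_subgroup I L"
proof (rule abelian_subgroupI3)
  show "additive_subgroup I L"
    using ideal by (simp add: alg_ideal_def submodule_def additive_subgroup_def)
qed (rule abelian_group_axioms)

sublocale sub: abelian_subgroup I L by (rule I_abelian_subgroup)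

lemma mem_coset: "x \<in> carrier L \<Longrightarrow> y \<in> carrier L \<Longrightarrow> y \<in> I +> x \<longleftrightarrow> y \<ominus> x \<in> I"
  by (simp add: sub.a_rcos_module minus_eq)

lemma coset_eq_iff:
  assumes "x \<in> carrier L" "y \<in> carrier L"
  shows "I +> x = I +> y \<longleftrightarrow> y \<ominus> x \<in> I"
proof
  assume "I +> x = I +> y"
  then have "y \<in> I +> x" using sub.a_rcos_self[OF assms(2)] by simp
  then show "y \<ominus> x \<in> I" using assms by (simp add: mem_coset)
next
  assume "y \<ominus> x \<in> I"
  then show "I +> x = I +> y" using assms mem_coset sub.a_repr_independence' by blast
qed

lemma mem_cosetD:
  assumes "x \<in> carrier L" "y \<in> I +> x"
  shows "y \<in> carrier L" "y \<ominus> x \<in> I"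
  using sub.a_elemrcos_carrier[OF assms] assms mem_coset by simp_all

lemma quot_alg_simps:
  "carrier (quot_alg L I) = (\<lambda>x. I +> x) ` carrier L" "\<zero>\<^bsub>quot_alg L I\<^esub> = I"
  by (auto simp: quot_alg_def FactRing_def A_RCOSETS_def' a_r_coset_def')

text \<open>Settles once and for all that the operations on cosets are well defined. The axioms of
  the quotient then follow from \<open>nonassoc_algebra_image\<close> instead of being checked on
  cosets.\<close>

lemma quot_alg_hom: "(\<lambda>x. I +> x) \<in> alg_hom L (quot_alg L I)"
proof (rule alg_homI)
  fix x assume x: "x \<in> carrier L"
  show "I +> x \<in> carrier (quot_alg L I)" using x by (simp add: quot_alg_simps)
  show "I +> (a \<odot> x) = a \<odot>\<^bsub>quot_alg L I\<^esub> (I +> x)" for a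
  proof -
    have "I +> (a \<odot> y) = I +> (a \<odot> x)" if "y \<in> I +> x" for y
    proof -
      note y = mem_cosetD[OF x that]
      have "a \<odot> y \<ominus> a \<odot> x = a \<odot> (y \<ominus> x)"
        using x y by (simp add: minus_conv smult_r_distr smult_assoc)
      also have "\<dots> \<in> I" using y subspace_ofD(4)[OF I_subspace] by simp
      finally show ?thesis using x y coset_eq_iff[of "a \<odot> x" "a \<odot> y"] by simp
    qed
    moreover have "x \<in> I +> x" using x by (simp add: sub.a_rcos_self)
    ultimately have "(\<Union>y\<in>I +> x. I +> (a \<odot> y)) = I +> (a \<odot> x)" by (intro UN_eqI)
    then show ?thesis by (simp add: quot_alg_def)
  qed
  fix y assume y: "y \<in> carrier L"
  show "I +> (x \<oplus> y) = (I +> x) \<oplus>\<^bsub>quot_alg L I\<^esub> (I +> y)"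
    using x y by (simp add: quot_alg_def FactRing_def sub.a_rcos_sum)
  have "I +> (x' \<otimes> y') = I +> (x \<otimes> y)" if "x' \<in> I +> x" "y' \<in> I +> y" for x' y'
  proof -
    note c = mem_cosetD[OF x that(1)] mem_cosetD[OF y that(2)]
    have "x' \<otimes> y' \<ominus> x \<otimes> y = x' \<otimes> (y' \<ominus> y) \<oplus> (x' \<ominus> x) \<otimes> y"
    proof -
      have "x' \<otimes> (y' \<ominus> y) \<oplus> (x' \<ominus> x) \<otimes> y =
        x' \<otimes> y' \<oplus> ((- 1) \<odot> (x' \<otimes> y) \<oplus> x' \<otimes> y) \<oplus> (- 1) \<odot> (x \<otimes> y)"
        using x y c by (simp add: minus_conv mult_l_distr mult_r_distr mult_smult_l mult_smult_r a_assoc)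
      also have "(- 1) \<odot> (x' \<otimes> y) \<oplus> x' \<otimes> y = \<zero>"
        using x y c by (simp add: smult_neg1 l_neg)
      finally show ?thesis using x y c by (simp add: minus_conv)
    qed
    also have "\<dots> \<in> I" using c x y I_mult subspace_ofD(3)[OF I_subspace] by simp
    finally show ?thesis using x y c coset_eq_iff[of "x \<otimes> y" "x' \<otimes> y'"] by simp
  qed
  moreover have "x \<in> I +> x" "y \<in> I +> y" using x y by (simp_all add: sub.a_rcos_self)
  ultimately have "(\<Union>x'\<in>I +> x. \<Union>y'\<in>I +> y. I +> (x' \<otimes> y')) = I +> (x \<otimes> y)"
    by (intro UN_eqI)
  then show "I +> (x \<otimes> y) = (I +> x) \<otimes>\<^bsub>quot_alg L I\<^esub> (I +> y)"
    by (simp add: quot_alg_def FactRing_def rcoset_mult_def)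
qed

lemma quot_zero: "I +> \<zero> = \<zero>\<^bsub>quot_alg L I\<^esub>"
  using a_coset_add_zero[OF sub.a_subset] by (simp add: quot_alg_simps)

lemma quot_nonassoc: "nonassoc_algebra (quot_alg L I)"
  by (rule nonassoc_algebra_image[OF _ quot_alg_hom _ quot_zero])
    (unfold_locales, simp add: quot_alg_simps)

lemma quot_eq_zero_iff: "x \<in> carrier L \<Longrightarrow> I +> x = \<zero>\<^bsub>quot_alg L I\<^esub> \<longleftrightarrow> x \<in> I"
  using coset_eq_iff[of \<zero> x] by (auto simp: quot_zero minus_conv)

lemma quot_universal:
  assumes "nonassoc_algebra M" and F: "F \<in> alg_hom L M" and zero: "\<And>x. x \<in> I \<Longrightarrow> F x = \<zero>\<^bsub>M\<^esub>"
  obtains F' where "F' \<in> alg_hom (quot_alg L I) M" "\<And>x. x \<in> carrier L \<Longrightarrow> F' (I +> x) = F x"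
proof -
  interpret M: nonassoc_algebra M by fact
  note h = alg_homD[OF F] and q = alg_homD(2-4)[OF quot_alg_hom]
  \<comment> \<open>An arbitrary representative is chosen; any two differ by an element of
    \<open>I\<close>, which \<open>F\<close> kills.\<close>
  define F' where "F' A = F (SOME x. x \<in> carrier L \<and> I +> x = A)" for A
  have F': "F' (I +> x) = F x" if x: "x \<in> carrier L" for x
  proof -
    define y where "y = (SOME y. y \<in> carrier L \<and> I +> y = I +> x)"
    have "y \<in> carrier L \<and> I +> y = I +> x" unfolding y_def by (rule someI[of _ x]) (use x in simp)
    then have y: "y \<in> carrier L" "y \<ominus> x \<in> I" using x coset_eq_iff[of x y] by auto
    have "F (y \<ominus> x) = F y \<ominus>\<^bsub>M\<^esub> F x" using x y by (simp add: h minus_conv M.minus_conv)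
    then have "F y = F x" using zero[OF y(2)] h(1) x y M.eq_iff_diff[of "F y" "F x"] by simp
    then show ?thesis by (simp add: F'_def y_def)
  qed
  have "F' \<in> alg_hom (quot_alg L I) M"
  proof (rule alg_homI)
    fix x y a assume "x \<in> carrier (quot_alg L I)"
    then obtain x' where x: "x = I +> x'" "x' \<in> carrier L" by (auto simp: quot_alg_simps)
    show "F' x \<in> carrier M" using x F' h by simp
    show "F' (a \<odot>\<^bsub>quot_alg L I\<^esub> x) = a \<odot>\<^bsub>M\<^esub> F' x"
      using x F' h by (simp add: q[symmetric])
    assume "y \<in> carrier (quot_alg L I)"
    then obtain y' where y: "y = I +> y'" "y' \<in> carrier L" by (auto simp: quot_alg_simps)
    show "F' (x \<oplus>\<^bsub>quot_alg L I\<^esub> y) = F' x \<oplus>\<^bsub>M\<^esub> F' y" "F' (x \<otimes>\<^bsub>quot_alg L I\<^esub> y) = F' x \<otimes>\<^bsub>M\<^esub> F' y"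
      using x y F' h by (simp_all add: q[symmetric])
  qed
  with F' show ?thesis using that by blast
qed

end

lemma quot_lie:
  assumes "lie L" "alg_ideal L I" shows "lie (quot_alg L I)"
proof -
  interpret lie L by fact
  interpret algebra_quotient L I by unfold_locales (rule assms(2))
  show ?thesis
    by (rule lie_image[OF assms(1) quot_alg_hom _ quot_zero]) (simp add: quot_alg_simps)
qed

subsection \<open>The lower central series\<close>

text \<open>The recursion has separate clauses at 0 and 1, both giving the whole algebra, so the
  uniform step starts at index 1.\<close>

lemma lower_central_Suc:
  "i \<ge> 1 \<Longrightarrow> lower_central L (Suc i) =
     lin_span L {x \<otimes>\<^bsub>L\<^esub> y | x y. x \<in> carrier L \<and> y \<in> lower_central L i}"
  by (cases i) auto

lemma lower_central_1: "lower_central L 1 = carrier L" by simp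

context nonassoc_algebra
begin

lemma lower_central_subspace: "subspace_of L (lower_central L i)"
proof (induction i)
  case (Suc i)
  show ?case
  proof (cases "i = 0")
    case False
    then have "lower_central L (Suc i) =
        lin_span L {x \<otimes> y | x y. x \<in> carrier L \<and> y \<in> lower_central L i}"
      by (simp add: lower_central_Suc)
    then show ?thesis using subspace_ofD(1)[OF Suc] by (auto intro!: lin_span_subspace)
  qed (simp add: subspace_carrier)
qed (simp add: subspace_carrier)

lemma lower_central_closed: "x \<in> lower_central L i \<Longrightarrow> x \<in> carrier L"
  using lower_central_subspace by (rule subspace_ofD(1))

lemma mult_lower_central:
  "i \<ge> 1 \<Longrightarrow> x \<in> carrier L \<Longrightarrow> y \<in> lower_central L i \<Longrightarrow> x \<otimes> y \<in> lower_central L (Suc i)"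
  by (subst lower_central_Suc) (auto intro!: subsetD[OF lin_span_incl])

lemma lower_central_Suc_subset:
  assumes "i \<ge> 1" "subspace_of L U"
    "\<And>x y. x \<in> carrier L \<Longrightarrow> y \<in> lower_central L i \<Longrightarrow> x \<otimes> y \<in> U"
  shows "lower_central L (Suc i) \<subseteq> U"
  unfolding lower_central_Suc[OF assms(1)] using assms(2,3) by (intro lin_span_minimal) auto

text \<open>Minimality of the lower central series among the families closed under its recursion. It
  serves as the induction principle for the later inclusions.\<close>

lemma lower_central_subset:
  assumes "i \<ge> 1" "carrier L \<subseteq> U 1" "\<And>i. i \<ge> 1 \<Longrightarrow> subspace_of L (U i)"
    "\<And>i x y. i \<ge> 1 \<Longrightarrow> x \<in> carrier L \<Longrightarrow> y \<in> U i \<Longrightarrow> x \<otimes> y \<in> U (Suc i)"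
  shows "lower_central L i \<subseteq> U i"
  using assms(1)
proof (induction i rule: dec_induct)
  case base
  then show ?case using assms(2) by simp
next
  case (step i)
  then show ?case by (intro lower_central_Suc_subset) (auto intro: assms)
qed

lemma lower_central_antimono:
  assumes "1 \<le> i" "i \<le> j" shows "lower_central L j \<subseteq> lower_central L i"
proof -
  have *: "lower_central L (Suc k) \<subseteq> lower_central L k" if "k \<ge> 1" for k
    using that
  proof (induction k rule: dec_induct)
    case base
    then show ?case unfolding lower_central_1 using lower_central_closed by blast
  next
    case (step k)
    then show ?case
      by (intro lower_central_Suc_subset lower_central_subspace)
        (auto intro: mult_lower_central)
  qed
  show ?thesis using assms(2)
  proof (induction j rule: dec_induct)
    case (step j)
    then show ?case using *[of j] assms(1) by simp
  qed simp
qed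

end

lemma alg_hom_lower_central:
  assumes "nonassoc_algebra L" "nonassoc_algebra M" and F: "F \<in> alg_hom L M"
    and "i \<ge> 1" "x \<in> lower_central L i"
  shows "F x \<in> lower_central M i"
proof -
  interpret L: nonassoc_algebra L by fact
  interpret M: nonassoc_algebra M by fact
  have "lower_central L i \<subseteq> {x \<in> carrier L. F x \<in> lower_central M i}"
    by (rule L.lower_central_subset[where U = "\<lambda>i. {x \<in> carrier L. F x \<in> lower_central M i}"])
      (use assms(4) alg_homD[OF F] in \<open>auto intro!: alg_hom_vimage_subspace[OF assms(1-3)]
        M.lower_central_subspace M.mult_lower_central\<close>)
  then show ?thesis using assms(5) by blast
qed

context lie
begin

lemma mult_anticomm:
  assumes "x \<in> carrier L" "y \<in> carrier L" shows "y \<otimes> x = (- 1) \<odot> (x \<otimes> y)"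
proof -
  have "\<zero> = (x \<oplus> y) \<otimes> (x \<oplus> y)" using mult_self[of "x \<oplus> y"] assms by simp
  also have "\<dots> = y \<otimes> x \<oplus> x \<otimes> y"
    using assms by (simp add: mult_l_distr mult_r_distr mult_self[of x] mult_self[of y])
  finally have "y \<otimes> x \<oplus> x \<otimes> y = \<zero>" ..
  then have "\<ominus> (x \<otimes> y) = y \<otimes> x" using assms by (intro minus_equality) auto
  then show ?thesis using assms by (simp add: smult_neg1)
qed

lemma lower_central_ideal: assumes "i \<ge> 1" shows "alg_ideal L (lower_central L i)"
proof -
  have "x \<otimes> y \<in> lower_central L i" if "x \<in> carrier L" "y \<in> lower_central L i" for x y
    using mult_lower_central[OF assms that] lower_central_antimono[of i "Suc i"] assms by auto
  moreover from this have "y \<otimes> x \<in> lower_central L i"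
    if "x \<in> carrier L" "y \<in> lower_central L i" for x y
    using that lower_central_closed[of y i] subspace_ofD(4)[OF lower_central_subspace[of i]]
    by (simp add: mult_anticomm[of x y])
  ultimately show ?thesis
    using lower_central_subspace[of i] by (simp add: alg_ideal_iff)
qed

text \<open>By the Jacobi identity (a b) y = a (b y) - b (a y), so bracketing with a commutator
  raises the index by two. This bounds the error terms of endomorphisms and derivations that are the
  identity modulo commutators.\<close>

lemma mult_lower_central_2:
  assumes i: "i \<ge> 1" and x: "x \<in> lower_central L 2" and y: "y \<in> lower_central L i"
  shows "x \<otimes> y \<in> lower_central L (i + 2)"
proof -
  have yc: "y \<in> carrier L" using y by (rule lower_central_closed)
  let ?U = "{x \<in> carrier L. x \<otimes> y \<in> lower_central L (i + 2)}"
  note s = subspace_ofD[OF lower_central_subspace[of "i + 2"]]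
  have "subspace_of L ?U"
    using s yc by (intro subspace_ofI) (auto simp: mult_l_distr mult_smult_l)
  moreover have "a \<otimes> b \<in> ?U" if ab: "a \<in> carrier L" "b \<in> carrier L" for a b
  proof -
    have "a \<otimes> (b \<otimes> y) \<in> lower_central L (i + 2)" "b \<otimes> (a \<otimes> y) \<in> lower_central L (i + 2)"
      using mult_lower_central[of "Suc i" a "b \<otimes> y"] mult_lower_central[of "Suc i" b "a \<otimes> y"]
        mult_lower_central[of i b y] mult_lower_central[of i a y] i ab y by auto
    then have m: "a \<otimes> (b \<otimes> y) \<oplus> (- 1) \<odot> (b \<otimes> (a \<otimes> y)) \<in> lower_central L (i + 2)"
      using s by blast
    have "a \<otimes> (b \<otimes> y) \<oplus> b \<otimes> (y \<otimes> a) \<oplus> y \<otimes> (a \<otimes> b) = \<zero>"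
      using jacobi ab yc by simp
    moreover have "b \<otimes> (y \<otimes> a) = (- 1) \<odot> (b \<otimes> (a \<otimes> y))"
      using ab yc mult_anticomm[of a y] mult_smult_r[of b "a \<otimes> y" "- 1"] by simp
    moreover have "y \<otimes> (a \<otimes> b) = \<ominus> ((a \<otimes> b) \<otimes> y)"
      using ab yc mult_anticomm[of "a \<otimes> b" y] by (simp add: smult_neg1)
    ultimately have "a \<otimes> (b \<otimes> y) \<oplus> (- 1) \<odot> (b \<otimes> (a \<otimes> y)) \<ominus> (a \<otimes> b) \<otimes> y = \<zero>"
      by (simp add: minus_eq)
    then have "a \<otimes> (b \<otimes> y) \<oplus> (- 1) \<odot> (b \<otimes> (a \<otimes> y)) = (a \<otimes> b) \<otimes> y"
      using ab yc by (subst eq_iff_diff) auto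
    then show ?thesis using m ab by simp
  qed
  ultimately have "lower_central L (Suc 1) \<subseteq> ?U"
    by (intro lower_central_Suc_subset) auto
  then show ?thesis using x by (auto simp: numeral_2_eq_2)
qed

end

section \<open>The free nonassociative algebra\<close>

lemma magma_alg_simps [simp]:
  "carrier (magma_alg S) = {p. \<forall>t\<in>Poly_Mapping.keys p. magma_atoms t \<subseteq> S}"
  "x \<otimes>\<^bsub>magma_alg S\<^esub> y = magma_mult x y" "\<zero>\<^bsub>magma_alg S\<^esub> = 0" "x \<oplus>\<^bsub>magma_alg S\<^esub> y = x + y"
  "a \<odot>\<^bsub>magma_alg S\<^esub> x = Poly_Mapping.map ((*) a) x"
  by (simp_all add: magma_alg_def)

lemma lookup_smult: "Poly_Mapping.lookup (Poly_Mapping.map ((*) a) p) t = a * Poly_Mapping.lookup p t"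
  for a :: "'k::field"
  by (simp add: Poly_Mapping.map.rep_eq when_def)

text \<open>A tree splits as \<open>Br s t\<close> in at most one way, so each coefficient of a
  product is a single product of coefficients.\<close>

lemma lookup_magma_mult:
  "Poly_Mapping.lookup (magma_mult p q) u =
     (case u of Gen a \<Rightarrow> 0 | Br s t \<Rightarrow> Poly_Mapping.lookup p s * Poly_Mapping.lookup q t)"
  for p :: "'s magma \<Rightarrow>\<^sub>0 'k::field"
proof (cases u)
  case (Gen a)
  then show ?thesis by (simp add: magma_mult_def lookup_sum lookup_single)
next
  case (Br s t)
  have "Poly_Mapping.lookup (magma_mult p q) u =
    (\<Sum>s'\<in>Poly_Mapping.keys p. \<Sum>t'\<in>Poly_Mapping.keys q.
       if t' = t then (if s' = s then Poly_Mapping.lookup p s * Poly_Mapping.lookup q t else 0) else 0)"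
    unfolding magma_mult_def lookup_sum Br
    by (intro sum.cong refl) (auto simp: lookup_single when_def)
  also have "\<dots> = Poly_Mapping.lookup p s * Poly_Mapping.lookup q t"
    by (cases "t \<in> Poly_Mapping.keys q"; cases "s \<in> Poly_Mapping.keys p")
      (simp_all add: sum.delta in_keys_iff)
  finally show ?thesis using Br by simp
qed

lemma keys_magma_mult:
  "u \<in> Poly_Mapping.keys (magma_mult p q) \<Longrightarrow>
     \<exists>s\<in>Poly_Mapping.keys p. \<exists>t\<in>Poly_Mapping.keys q. u = Br s t" for p :: "'s magma \<Rightarrow>\<^sub>0 'k::field"
  by (cases u) (auto simp: in_keys_iff lookup_magma_mult)

lemma magma_alg_nonassoc: "nonassoc_algebra (magma_alg S :: ('k::field, 's magma \<Rightarrow>\<^sub>0 'k) module)"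
proof -
  have keys_smult: "Poly_Mapping.keys (Poly_Mapping.map ((*) a) p) \<subseteq> Poly_Mapping.keys p"
    for a and p :: "'s magma \<Rightarrow>\<^sub>0 'k"
    by (auto simp: in_keys_iff lookup_smult)
  have "abelian_group (magma_alg S :: ('k, 's magma \<Rightarrow>\<^sub>0 'k) module)"
  proof (rule abelian_groupI)
    fix x y :: "'s magma \<Rightarrow>\<^sub>0 'k"
    assume x: "x \<in> carrier (magma_alg S)"
    then have "- x \<in> carrier (magma_alg S)" by simp
    moreover have "- x \<oplus>\<^bsub>magma_alg S\<^esub> x = \<zero>\<^bsub>magma_alg S\<^esub>" by simp
    ultimately show "\<exists>y\<in>carrier (magma_alg S). y \<oplus>\<^bsub>magma_alg S\<^esub> x = \<zero>\<^bsub>magma_alg S\<^esub>" by blast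
    assume "y \<in> carrier (magma_alg S)"
    then show "x \<oplus>\<^bsub>magma_alg S\<^esub> y \<in> carrier (magma_alg S)"
      using x Poly_Mapping.keys_add[of x y] by auto
  qed (auto simp: ac_simps)
  moreover have "nonassoc_algebra_axioms (magma_alg S :: ('k, 's magma \<Rightarrow>\<^sub>0 'k) module)"
    by unfold_locales
      (use keys_smult in \<open>auto intro!: poly_mapping_eqI dest!: keys_magma_mult split: magma.split
        simp: lookup_smult lookup_magma_mult lookup_add algebra_simps\<close>, blast+)
  ultimately show ?thesis by (simp add: nonassoc_algebra_def)
qed

fun tree_eval :: "('k, 'a) module \<Rightarrow> ('s \<Rightarrow> 'a) \<Rightarrow> 's magma \<Rightarrow> 'a" where
  "tree_eval L f (Gen a) = f a"
| "tree_eval L f (Br s t) = tree_eval L f s \<otimes>\<^bsub>L\<^esub> tree_eval L f t"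

context nonassoc_algebra
begin

lemma finsum_eqI:
  assumes "\<And>i. i \<in> A \<Longrightarrow> f i = g i" "\<And>i. i \<in> A \<Longrightarrow> g i \<in> carrier L"
  shows "finsum L f A = finsum L g A"
  using assms by (intro finsum_cong') auto

lemma finsum_prod:
  assumes "finite A" "finite B" "\<And>i j. i \<in> A \<Longrightarrow> j \<in> B \<Longrightarrow> f i j \<in> carrier L"
  shows "finsum L (\<lambda>(i, j). f i j) (A \<times> B) = finsum L (\<lambda>i. finsum L (f i) B) A"
  using assms(1,3)
proof (induction A rule: finite_induct)
  case (insert i A)
  have "insert i A \<times> B = Pair i ` B \<union> A \<times> B" by auto
  moreover have "finsum L (\<lambda>(i, j). f i j) (Pair i ` B \<union> A \<times> B) =
      finsum L (\<lambda>(i, j). f i j) (Pair i ` B) \<oplus> finsum L (\<lambda>(i, j). f i j) (A \<times> B)"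
    using insert assms(2) by (intro finsum_Un_disjoint) auto
  moreover have "finsum L (\<lambda>(i, j). f i j) (Pair i ` B) = finsum L (f i) B"
    using insert by (subst finsum_reindex) (auto simp: inj_on_def)
  moreover have "finsum L (\<lambda>i. finsum L (f i) B) (insert i A) =
      finsum L (f i) B \<oplus> finsum L (\<lambda>i. finsum L (f i) B) A"
    using insert assms(2) by (intro finsum_insert) (auto intro!: finsum_closed)
  ultimately show ?case using insert by simp
qed simp

lemma finsum_smult:
  assumes "finite A" "\<And>i. i \<in> A \<Longrightarrow> f i \<in> carrier L"
  shows "a \<odot> finsum L f A = finsum L (\<lambda>i. a \<odot> f i) A"
  using assms by (induction A rule: finite_induct) (simp_all add: smult_r_distr Pi_def)

lemma finsum_mult_left:
  assumes "finite A" "\<And>i. i \<in> A \<Longrightarrow> f i \<in> carrier L" "y \<in> carrier L"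
  shows "y \<otimes> finsum L f A = finsum L (\<lambda>i. y \<otimes> f i) A"
  using assms by (induction A rule: finite_induct) (simp_all add: mult_r_distr Pi_def)

lemma finsum_mult_right:
  assumes "finite A" "\<And>i. i \<in> A \<Longrightarrow> f i \<in> carrier L" "y \<in> carrier L"
  shows "finsum L f A \<otimes> y = finsum L (\<lambda>i. f i \<otimes> y) A"
  using assms by (induction A rule: finite_induct) (simp_all add: mult_l_distr Pi_def)

lemma finsum_mono_neutral:
  assumes "finite B" "A \<subseteq> B" "\<And>i. i \<in> B \<Longrightarrow> f i \<in> carrier L" "\<And>i. i \<in> B - A \<Longrightarrow> f i = \<zero>"
  shows "finsum L f B = finsum L f A"
proof -
  have "finsum L f B = finsum L f (A \<union> (B - A))" using assms(2) by (simp add: Un_absorb1)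
  also have "\<dots> = finsum L f A \<oplus> finsum L f (B - A)"
    using assms by (intro finsum_Un_disjoint) (auto intro: finite_subset)
  also have "finsum L f (B - A) = \<zero>"
    using assms(4) by (subst finsum_cong'[of _ "B - A" "\<lambda>_. \<zero>"]) auto
  also have "finsum L f A \<oplus> \<zero> = finsum L f A"
    using assms(2,3) by (intro r_zero finsum_closed) auto
  finally show ?thesis .
qed

lemma magma_universal:
  assumes f: "\<And>a. a \<in> S \<Longrightarrow> f a \<in> carrier L"
  obtains F where "F \<in> alg_hom (magma_alg S :: ('k, 's magma \<Rightarrow>\<^sub>0 'k) module) L"
    "\<And>a. a \<in> S \<Longrightarrow> F (Poly_Mapping.single (Gen a) 1) = f a"
proof -
  let ?l = "Poly_Mapping.lookup" and ?k = Poly_Mapping.keys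
  let ?e = "tree_eval L f"
  have e: "?e t \<in> carrier L" if "magma_atoms t \<subseteq> S" for t
    using that by (induction t) (auto simp: f)
  define F where "F p = finsum L (\<lambda>t. ?l p t \<odot> ?e t) (?k p)" for p :: "'s magma \<Rightarrow>\<^sub>0 'k"
  \<comment> \<open>Summing over any finite set that contains the support allows p, q and p + q to
    be compared over one index set.\<close>
  have F: "F p = finsum L (\<lambda>t. ?l p t \<odot> ?e t) T"
    if "finite T" "?k p \<subseteq> T" "\<And>t. t \<in> T \<Longrightarrow> magma_atoms t \<subseteq> S" for p :: "'s magma \<Rightarrow>\<^sub>0 'k" and T
    unfolding F_def using that
    by (intro finsum_mono_neutral[symmetric]) (auto simp: in_keys_iff e)
  have add: "F (p + q) = F p \<oplus> F q"
    if "p \<in> carrier (magma_alg S)" "q \<in> carrier (magma_alg S)" for p q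
  proof -
    let ?T = "?k p \<union> ?k q"
    have T: "finite ?T" "\<And>t. t \<in> ?T \<Longrightarrow> magma_atoms t \<subseteq> S" using that by auto
    have "F (p + q) = finsum L (\<lambda>t. ?l (p + q) t \<odot> ?e t) ?T"
      using T Poly_Mapping.keys_add[of p q] by (intro F) auto
    also have "\<dots> = finsum L (\<lambda>t. ?l p t \<odot> ?e t \<oplus> ?l q t \<odot> ?e t) ?T"
      using T e by (intro finsum_eqI) (auto simp: lookup_add smult_l_distr)
    also have "\<dots> = finsum L (\<lambda>t. ?l p t \<odot> ?e t) ?T \<oplus> finsum L (\<lambda>t. ?l q t \<odot> ?e t) ?T"
      using T e by (intro finsum_addf) auto
    also have "finsum L (\<lambda>t. ?l p t \<odot> ?e t) ?T = F p" using T by (intro F[symmetric]) auto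
    also have "finsum L (\<lambda>t. ?l q t \<odot> ?e t) ?T = F q" using T by (intro F[symmetric]) auto
    finally show ?thesis .
  qed
  have smult: "F (Poly_Mapping.map ((*) a) p) = a \<odot> F p" if "p \<in> carrier (magma_alg S)" for a p
  proof -
    have T: "finite (?k p)" "\<And>t. t \<in> ?k p \<Longrightarrow> magma_atoms t \<subseteq> S" using that by auto
    have "F (Poly_Mapping.map ((*) a) p) = finsum L (\<lambda>t. ?l (Poly_Mapping.map ((*) a) p) t \<odot> ?e t) (?k p)"
      using T by (intro F) (auto simp: in_keys_iff lookup_smult)
    also have "\<dots> = finsum L (\<lambda>t. a \<odot> (?l p t \<odot> ?e t)) (?k p)"
      using T e by (intro finsum_eqI) (auto simp: lookup_smult smult_assoc)
    also have "\<dots> = a \<odot> F p"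
      unfolding F_def using T e by (intro finsum_smult[symmetric]) auto
    finally show ?thesis .
  qed
  have mult: "F (magma_mult p q) = F p \<otimes> F q"
    if "p \<in> carrier (magma_alg S)" "q \<in> carrier (magma_alg S)" for p q
  proof -
    let ?B = "(\<lambda>(s, t). Br s t) ` (?k p \<times> ?k q)"
    have T: "\<And>t. t \<in> ?k p \<Longrightarrow> magma_atoms t \<subseteq> S" "\<And>t. t \<in> ?k q \<Longrightarrow> magma_atoms t \<subseteq> S"
      using that by auto
    have "F (magma_mult p q) = finsum L (\<lambda>t. ?l (magma_mult p q) t \<odot> ?e t) ?B"
      using T by (intro F) (auto dest!: keys_magma_mult, blast+)
    also have "\<dots> = finsum L (\<lambda>x. ?l (magma_mult p q) (case x of (s, t) \<Rightarrow> Br s t) \<odot>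
        ?e (case x of (s, t) \<Rightarrow> Br s t)) (?k p \<times> ?k q)"
      using T e by (intro finsum_reindex) (auto simp: inj_on_def)
    also have "\<dots> = finsum L (\<lambda>(s, t). (?l p s \<odot> ?e s) \<otimes> (?l q t \<odot> ?e t)) (?k p \<times> ?k q)"
      using T e
      by (intro finsum_eqI) (auto simp: lookup_magma_mult mult_smult_l mult_smult_r smult_assoc
          mult.commute)
    also have "\<dots> = finsum L (\<lambda>s. finsum L (\<lambda>t. (?l p s \<odot> ?e s) \<otimes> (?l q t \<odot> ?e t)) (?k q)) (?k p)"
      using T e by (intro finsum_prod) auto
    also have "\<dots> = finsum L (\<lambda>s. (?l p s \<odot> ?e s) \<otimes> F q) (?k p)"
      unfolding F_def using T e
      by (intro finsum_eqI) (auto intro!: finsum_mult_left[symmetric] finsum_closed)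
    also have "\<dots> = F p \<otimes> F q"
      unfolding F_def using T e
      by (intro finsum_mult_right[symmetric]) (auto intro!: finsum_closed)
    finally show ?thesis .
  qed
  have "F \<in> alg_hom (magma_alg S) L"
  proof (rule alg_homI)
    fix p :: "'s magma \<Rightarrow>\<^sub>0 'k" assume "p \<in> carrier (magma_alg S)"
    then show "F p \<in> carrier L" unfolding F_def by (intro finsum_closed) (auto simp: e)
  qed (use add smult mult in auto)
  moreover have "F (Poly_Mapping.single (Gen a) 1) = f a" if "a \<in> S" for a
    using that f by (simp add: F_def)
  ultimately show ?thesis using that by blast
qed

end

lemma magma_generated:
  assumes U: "subspace_of (magma_alg S :: ('k::field, 's magma \<Rightarrow>\<^sub>0 'k) module) U"
    and mult: "\<And>x y. x \<in> U \<Longrightarrow> y \<in> U \<Longrightarrow> magma_mult x y \<in> U"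
    and gen: "\<And>a. a \<in> S \<Longrightarrow> Poly_Mapping.single (Gen a) 1 \<in> U"
    and p: "p \<in> carrier (magma_alg S)"
  shows "p \<in> U"
proof -
  have one: "Poly_Mapping.single t 1 \<in> U" if "magma_atoms t \<subseteq> S" for t
    using that
  proof (induction t)
    case (Br s t)
    then have "magma_mult (Poly_Mapping.single s 1) (Poly_Mapping.single t 1) \<in> U"
      by (intro mult) auto
    then show ?case by (simp add: magma_mult_def)
  qed (auto intro: gen)
  have single: "Poly_Mapping.single t c \<in> U" if "magma_atoms t \<subseteq> S" for t c
  proof -
    have "Poly_Mapping.map ((*) c) (Poly_Mapping.single t 1) = Poly_Mapping.single t c"
      by (rule poly_mapping_eqI) (auto simp: lookup_smult lookup_single when_def)
    then show ?thesis using subspace_ofD(4)[OF U one[OF that], of c] by simp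
  qed
  have "(\<Sum>t\<in>T. Poly_Mapping.single t (Poly_Mapping.lookup p t)) \<in> U"
    if "finite T" "T \<subseteq> Poly_Mapping.keys p" for T
    using that
  proof (induction T rule: finite_induct)
    case (insert t T)
    then have "Poly_Mapping.single t (Poly_Mapping.lookup p t) \<in> U"
      using p by (intro single) auto
    then show ?case using subspace_ofD(3)[OF U] insert by simp
  qed (use subspace_ofD(2)[OF U] in simp)
  moreover have "(\<Sum>t\<in>Poly_Mapping.keys p. Poly_Mapping.single t (Poly_Mapping.lookup p t)) = p"
    by (rule poly_mapping_eqI) (auto simp: lookup_sum lookup_single when_def in_keys_iff sum.delta')
  ultimately show ?thesis by (metis finite_keys order_refl)
qed


section \<open>Universal properties\<close>

lemma alg_ideal_zero: "nonassoc_algebra L \<Longrightarrow> alg_ideal L {\<zero>\<^bsub>L\<^esub>}"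
proof -
  assume "nonassoc_algebra L"
  then interpret nonassoc_algebra L .
  show ?thesis by (auto simp: alg_ideal_iff subspace_of_def)
qed

text \<open>The zero set of \<open>F\<close> is the preimage of the zero ideal, hence an ideal, and
  it contains \<open>A\<close>.\<close>

lemma ideal_gen_hom_zero:
  assumes "nonassoc_algebra L" "nonassoc_algebra M" "F \<in> alg_hom L M"
    and A: "A \<subseteq> carrier L" "\<And>x. x \<in> A \<Longrightarrow> F x = \<zero>\<^bsub>M\<^esub>" and x: "x \<in> ideal_gen L A"
  shows "F x = \<zero>\<^bsub>M\<^esub>"
proof -
  interpret nonassoc_algebra L by fact
  have "ideal_gen L A \<subseteq> {x \<in> carrier L. F x \<in> {\<zero>\<^bsub>M\<^esub>}}"
    by (rule ideal_gen_minimal[OF _ alg_hom_vimage_ideal[OF assms(1-3) alg_ideal_zero[OF assms(2)]]])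
      (use A in auto)
  then show ?thesis using x by blast
qed

lemma lie_nonassoc: "lie L \<Longrightarrow> nonassoc_algebra L"
  by (simp add: lie_def)

text \<open>The brackets generating the terms of \<open>M\<close> lift along the surjection. Applied
  to the last quotient map, this makes \<open>nil_lie\<close> nilpotent.\<close>

lemma lower_central_image:
  assumes "nonassoc_algebra L" "nonassoc_algebra M" and F: "F \<in> alg_hom L M"
    and surj: "F ` carrier L = carrier M" and "i \<ge> 1"
  shows "lower_central M i \<subseteq> F ` lower_central L i"
proof -
  interpret L: nonassoc_algebra L by fact
  interpret M: nonassoc_algebra M by fact
  note h = alg_homD[OF F]
  show ?thesis
  proof (rule M.lower_central_subset[where U = "\<lambda>i. F ` lower_central L i"])
    fix i :: nat
    note s = subspace_ofD[OF L.lower_central_subspace[of i]]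
    show "subspace_of M (F ` lower_central L i)"
    proof (rule subspace_ofI)
      show "\<zero>\<^bsub>M\<^esub> \<in> F ` lower_central L i"
        using alg_hom_zero[OF assms(1-3)] s(2) by (metis imageI)
    qed (use s h in \<open>auto simp flip: h(2,3)\<close>)
    fix x y assume i: "1 \<le> i" and "x \<in> carrier M" "y \<in> F ` lower_central L i"
    then obtain x' y' where "x = F x'" "y = F y'" "x' \<in> carrier L" "y' \<in> lower_central L i"
      using surj by blast
    then show "x \<otimes>\<^bsub>M\<^esub> y \<in> F ` lower_central L (Suc i)"
      using s(1) L.mult_lower_central[OF i] by (auto simp: h(4)[symmetric])
  qed (use surj assms(5) in auto)
qed

context
  fixes S :: "'s set"
begin

lemma lie_relators_subset: "lie_relators (magma_alg S :: ('k::field, _) module) \<subseteq> carrier (magma_alg S)"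
proof -
  interpret nonassoc_algebra "magma_alg S :: ('k, _) module" by (rule magma_alg_nonassoc)
  show ?thesis
    unfolding lie_relators_def by (auto simp del: magma_alg_simps)
qed

lemma free_lie_ideal: "alg_ideal (magma_alg S :: ('k::field, _) module) (free_lie_ideal S)"
proof -
  interpret nonassoc_algebra "magma_alg S :: ('k, _) module" by (rule magma_alg_nonassoc)
  show ?thesis unfolding free_lie_ideal_def by (rule ideal_gen_ideal[OF lie_relators_subset])
qed

lemma free_lie_quotient: "algebra_quotient (magma_alg S :: ('k::field, _) module) (free_lie_ideal S)"
  unfolding algebra_quotient_def algebra_quotient_axioms_def
  by (intro conjI magma_alg_nonassoc free_lie_ideal)

lemma free_lie_lie: "lie (free_lie S :: ('k::field, _) module)"
proof -
  let ?A = "magma_alg S :: ('k, _) module" and ?F = "free_lie S :: ('k, _) module"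
  interpret algebra_quotient ?A "free_lie_ideal S" by (rule free_lie_quotient)
  interpret F: nonassoc_algebra ?F using quot_nonassoc by (simp add: free_lie_def)
  define \<rho> where "\<rho> x = free_lie_ideal S +>\<^bsub>?A\<^esub> x" for x
  have \<rho>: "\<rho> \<in> alg_hom ?A ?F" "carrier ?F = \<rho> ` carrier ?A"
    using quot_alg_hom quot_alg_simps(1) by (simp_all add: free_lie_def \<rho>_def[abs_def])
  note h = alg_homD(2-4)[OF \<rho>(1)]
  have z: "\<rho> x = \<zero>\<^bsub>?F\<^esub>" if "x \<in> lie_relators ?A" for x
  proof -
    have "x \<in> free_lie_ideal S"
      using that ideal_gen_incl unfolding free_lie_ideal_def by blast
    moreover from this have "x \<in> carrier ?A" using subspace_ofD(1)[OF I_subspace] by blast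
    ultimately show ?thesis using quot_eq_zero_iff by (simp add: free_lie_def \<rho>_def)
  qed
  show ?thesis
  proof
    fix x y w assume "x \<in> carrier ?F"
    then obtain x' where x: "x = \<rho> x'" "x' \<in> carrier ?A" using \<rho>(2) by blast
    then have "x' \<otimes>\<^bsub>?A\<^esub> x' \<in> lie_relators ?A" unfolding lie_relators_def by blast
    then show "x \<otimes>\<^bsub>?F\<^esub> x = \<zero>\<^bsub>?F\<^esub>" unfolding x(1) h(3)[OF x(2) x(2), symmetric] by (rule z)
    assume "y \<in> carrier ?F" "w \<in> carrier ?F"
    then obtain y' w' where y: "y = \<rho> y'" "y' \<in> carrier ?A" "w = \<rho> w'" "w' \<in> carrier ?A"
      unfolding \<rho>(2) by (elim imageE)
    have "x' \<otimes>\<^bsub>?A\<^esub> (y' \<otimes>\<^bsub>?A\<^esub> w') \<oplus>\<^bsub>?A\<^esub> y' \<otimes>\<^bsub>?A\<^esub> (w' \<otimes>\<^bsub>?A\<^esub> x') \<oplus>\<^bsub>?A\<^esub> w' \<otimes>\<^bsub>?A\<^esub> (x' \<otimes>\<^bsub>?A\<^esub> y')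
        \<in> lie_relators ?A"
      unfolding lie_relators_def
      by (rule UnI2, rule CollectI, rule exI[of _ x'], rule exI[of _ y'], rule exI[of _ w'])
        (simp add: x(2) y(2,4) del: magma_alg_simps)
    then have "\<rho> (x' \<otimes>\<^bsub>?A\<^esub> (y' \<otimes>\<^bsub>?A\<^esub> w') \<oplus>\<^bsub>?A\<^esub> y' \<otimes>\<^bsub>?A\<^esub> (w' \<otimes>\<^bsub>?A\<^esub> x') \<oplus>\<^bsub>?A\<^esub> w' \<otimes>\<^bsub>?A\<^esub> (x' \<otimes>\<^bsub>?A\<^esub> y')) = \<zero>\<^bsub>?F\<^esub>"
      by (rule z)
    then show "x \<otimes>\<^bsub>?F\<^esub> (y \<otimes>\<^bsub>?F\<^esub> w) \<oplus>\<^bsub>?F\<^esub> y \<otimes>\<^bsub>?F\<^esub> (w \<otimes>\<^bsub>?F\<^esub> x) \<oplus>\<^bsub>?F\<^esub> w \<otimes>\<^bsub>?F\<^esub> (x \<otimes>\<^bsub>?F\<^esub> y) = \<zero>\<^bsub>?F\<^esub>"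
      using x(2) y(2,4) unfolding x(1) y(1,3) by (simp add: h del: magma_alg_simps)
  qed
qed

lemma free_gen_closed: "a \<in> S \<Longrightarrow> free_gen S a \<in> carrier (free_lie S :: ('k::field, _) module)"
proof -
  assume a: "a \<in> S"
  interpret algebra_quotient "magma_alg S :: ('k, _) module" "free_lie_ideal S" by (rule free_lie_quotient)
  show ?thesis using alg_homD(1)[OF quot_alg_hom, of "Poly_Mapping.single (Gen a) 1"] a
    by (simp add: free_lie_def free_gen_def)
qed

lemma free_lie_universal:
  assumes "lie (L :: ('k::field, 'a) module)" and f: "\<And>a. a \<in> S \<Longrightarrow> f a \<in> carrier L"
  obtains F where "F \<in> alg_hom (free_lie S) L" "\<And>a. a \<in> S \<Longrightarrow> F (free_gen S a) = f a"
proof -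
  let ?A = "magma_alg S :: ('k, _) module"
  interpret L: lie L by fact
  interpret algebra_quotient ?A "free_lie_ideal S" by (rule free_lie_quotient)
  obtain G where G: "G \<in> alg_hom ?A L" "\<And>a. a \<in> S \<Longrightarrow> G (Poly_Mapping.single (Gen a) 1) = f a"
    using L.magma_universal[of S f] f by blast
  note h = alg_homD[OF G(1)]
  have "G x = \<zero>\<^bsub>L\<^esub>" if "x \<in> lie_relators ?A" for x
    using that unfolding lie_relators_def
    by (auto simp: h L.mult_self L.jacobi simp del: magma_alg_simps)
  then have "G x = \<zero>\<^bsub>L\<^esub>" if "x \<in> free_lie_ideal S" for x
    using ideal_gen_hom_zero[OF nonassoc_algebra_axioms L.nonassoc_algebra_axioms G(1) lie_relators_subset] that
    unfolding free_lie_ideal_def by blast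
  then obtain F where "F \<in> alg_hom (free_lie S) L"
    "\<And>x. x \<in> carrier ?A \<Longrightarrow> F (free_lie_ideal S +>\<^bsub>?A\<^esub> x) = G x"
    using quot_universal[OF L.nonassoc_algebra_axioms G(1), folded free_lie_def] by blast
  then show ?thesis using that G(2) by (simp add: free_gen_def)
qed

context
  fixes E :: "'s set set"
begin

lemma graph_relators_subset:
  "{free_gen S \<alpha> \<otimes>\<^bsub>(free_lie S :: ('k::field, _) module)\<^esub> free_gen S \<beta> | \<alpha> \<beta>.
          \<alpha> \<in> S \<and> \<beta> \<in> S \<and> {\<alpha>, \<beta>} \<notin> E} \<subseteq> carrier (free_lie S :: ('k::field, _) module)"
proof -
  interpret lie "free_lie S :: ('k, _) module" by (rule free_lie_lie)
  show ?thesis using free_gen_closed by auto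
qed

lemma graph_lie_quotient: "algebra_quotient (free_lie S :: ('k::field, _) module) (graph_ideal S E)"
proof -
  interpret lie "free_lie S :: ('k, _) module" by (rule free_lie_lie)
  show ?thesis
    by unfold_locales (simp add: graph_ideal_def ideal_gen_ideal[OF graph_relators_subset])
qed

lemma graph_lie_lie: "lie (graph_lie S E :: ('k::field, _) module)"
  unfolding graph_lie_def
  by (intro quot_lie free_lie_lie algebra_quotient.ideal[OF graph_lie_quotient])

lemma nil_lie_quotient:
  "algebra_quotient (graph_lie S E :: ('k::field, _) module) (lower_central (graph_lie S E) (c + 1))"
proof -
  interpret lie "graph_lie S E :: ('k, _) module" by (rule graph_lie_lie)
  show ?thesis by unfold_locales (rule lower_central_ideal, simp)
qed

lemma nil_lie_lie: "lie (nil_lie S E c :: ('k::field, _) module)"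
  unfolding nil_lie_def
  by (intro quot_lie graph_lie_lie algebra_quotient.ideal[OF nil_lie_quotient])

lemma nil_lie_nilpotent:
  "lower_central (nil_lie S E c :: ('k::field, _) module) (c + 1) \<subseteq> {\<zero>\<^bsub>(nil_lie S E c :: ('k, _) module)\<^esub>}"
proof -
  let ?N = "nil_lie S E c :: ('k, _) module" and ?G = "graph_lie S E :: ('k, _) module"
  interpret algebra_quotient ?G "lower_central ?G (c + 1)" by (rule nil_lie_quotient)
  have "lower_central ?N (c + 1) \<subseteq> (\<lambda>x. lower_central ?G (c + 1) +>\<^bsub>?G\<^esub> x) ` lower_central ?G (c + 1)"
    unfolding nil_lie_def
    by (rule lower_central_image[OF _ _ quot_alg_hom quot_alg_simps(1)[symmetric]])
      (use quot_nonassoc nonassoc_algebra_axioms in auto)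
  also have "\<dots> \<subseteq> {\<zero>\<^bsub>?N\<^esub>}"
    unfolding nil_lie_def using quot_eq_zero_iff lower_central_closed[of _ "c + 1"] by blast
  finally show ?thesis .
qed

text \<open>The map descends through the three quotients in turn: the Lie relators die because
  \<open>L\<close> is Lie, the graph relators by \<open>rel\<close>, the last term by
  \<open>nil\<close>. With twisted algebras, dual numbers, complexifications and the two-step model
  as targets it produces all the maps built from vertices.\<close>

theorem nil_lie_universal:
  assumes "lie (L :: ('k::field, 'a) module)" and f: "\<And>a. a \<in> S \<Longrightarrow> f a \<in> carrier L"
    and rel: "\<And>a b. a \<in> S \<Longrightarrow> b \<in> S \<Longrightarrow> {a, b} \<notin> E \<Longrightarrow> f a \<otimes>\<^bsub>L\<^esub> f b = \<zero>\<^bsub>L\<^esub>"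
    and nil: "lower_central L (c + 1) \<subseteq> {\<zero>\<^bsub>L\<^esub>}"
  obtains F where "F \<in> alg_hom (nil_lie S E c) L" "\<And>a. a \<in> S \<Longrightarrow> F (vertex S E c a) = f a"
proof -
  let ?F = "free_lie S :: ('k, _) module" and ?G = "graph_lie S E :: ('k, _) module"
  interpret L: lie L by fact
  interpret g: algebra_quotient ?F "graph_ideal S E" by (rule graph_lie_quotient)
  interpret n: algebra_quotient ?G "lower_central ?G (c + 1)" by (rule nil_lie_quotient)
  obtain F1 where F1: "F1 \<in> alg_hom ?F L" "\<And>a. a \<in> S \<Longrightarrow> F1 (free_gen S a) = f a"
    using free_lie_universal[OF assms(1), of f] f by metis
  have "F1 x = \<zero>\<^bsub>L\<^esub>" if "x \<in> graph_ideal S E" for x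
    using that unfolding graph_ideal_def
    by (rule ideal_gen_hom_zero[OF g.nonassoc_algebra_axioms L.nonassoc_algebra_axioms F1(1)
          graph_relators_subset, rotated])
      (auto simp: alg_homD(4)[OF F1(1)] free_gen_closed F1(2) rel)
  then obtain F2 where F2: "F2 \<in> alg_hom ?G L"
    "\<And>x. x \<in> carrier ?F \<Longrightarrow> F2 (graph_ideal S E +>\<^bsub>?F\<^esub> x) = F1 x"
    using g.quot_universal[OF L.nonassoc_algebra_axioms F1(1), folded graph_lie_def] by blast
  have "F2 x = \<zero>\<^bsub>L\<^esub>" if "x \<in> lower_central ?G (c + 1)" for x
    using alg_hom_lower_central[OF n.nonassoc_algebra_axioms L.nonassoc_algebra_axioms F2(1) _ that] nil
    by auto
  then obtain F3 where F3: "F3 \<in> alg_hom (nil_lie S E c) L"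
    "\<And>x. x \<in> carrier ?G \<Longrightarrow> F3 (lower_central ?G (c + 1) +>\<^bsub>?G\<^esub> x) = F2 x"
    using n.quot_universal[OF L.nonassoc_algebra_axioms F2(1), folded nil_lie_def] by blast
  have "F3 (vertex S E c a) = f a" if a: "a \<in> S" for a
  proof -
    have "graph_ideal S E +>\<^bsub>?F\<^esub> free_gen S a \<in> carrier ?G"
      using alg_homD(1)[OF g.quot_alg_hom free_gen_closed[OF a]] by (simp add: graph_lie_def)
    then show ?thesis unfolding vertex_def by (simp only: F3(2) F2(2) F1(2) free_gen_closed a)
  qed
  with F3(1) show ?thesis using that by blast
qed

lemma magma_onto_nil_lie:
  obtains \<rho> where "\<rho> \<in> alg_hom (magma_alg S) (nil_lie S E c :: ('k::field, _) module)"
    "\<rho> ` carrier (magma_alg S) = carrier (nil_lie S E c :: ('k, _) module)"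
    "\<And>a. a \<in> S \<Longrightarrow> \<rho> (Poly_Mapping.single (Gen a) 1) = vertex S E c a"
proof -
  let ?A = "magma_alg S :: ('k, _) module"
  let ?F = "free_lie S :: ('k, _) module" and ?G = "graph_lie S E :: ('k, _) module"
  interpret f: algebra_quotient ?A "free_lie_ideal S" by (rule free_lie_quotient)
  interpret g: algebra_quotient ?F "graph_ideal S E" by (rule graph_lie_quotient)
  interpret n: algebra_quotient ?G "lower_central ?G (c + 1)" by (rule nil_lie_quotient)
  define \<rho> where "\<rho> x = lower_central ?G (c + 1) +>\<^bsub>?G\<^esub> (graph_ideal S E +>\<^bsub>?F\<^esub>
      (free_lie_ideal S +>\<^bsub>?A\<^esub> x))" for x
  have "(\<lambda>x. graph_ideal S E +>\<^bsub>?F\<^esub> (free_lie_ideal S +>\<^bsub>?A\<^esub> x)) \<in> alg_hom ?A ?G"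
    unfolding graph_lie_def
    by (rule alg_hom_comp[OF f.quot_alg_hom]) (use g.quot_alg_hom in \<open>simp add: free_lie_def\<close>)
  then have 1: "\<rho> \<in> alg_hom ?A (nil_lie S E c)"
    unfolding nil_lie_def \<rho>_def by (rule alg_hom_comp[OF _ n.quot_alg_hom])
  have "carrier ?F = (\<lambda>x. free_lie_ideal S +>\<^bsub>?A\<^esub> x) ` carrier ?A"
    using f.quot_alg_simps(1) by (simp add: free_lie_def)
  moreover have "carrier ?G = (\<lambda>x. graph_ideal S E +>\<^bsub>?F\<^esub> x) ` carrier ?F"
    using g.quot_alg_simps(1) by (simp add: graph_lie_def)
  ultimately have 2: "\<rho> ` carrier ?A = carrier (nil_lie S E c :: ('k, _) module)"
    using n.quot_alg_simps(1) by (simp add: nil_lie_def image_image \<rho>_def)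
  show ?thesis using that[OF 1 2] by (simp add: \<rho>_def vertex_def free_gen_def)
qed

lemma vertex_closed: "a \<in> S \<Longrightarrow> vertex S E c a \<in> carrier (nil_lie S E c :: ('k::field, _) module)"
proof -
  assume a: "a \<in> S"
  obtain \<rho> where \<rho>: "\<rho> \<in> alg_hom (magma_alg S) (nil_lie S E c :: ('k::field, _) module)"
    "\<And>a. a \<in> S \<Longrightarrow> \<rho> (Poly_Mapping.single (Gen a) 1) = vertex S E c a"
    by (rule magma_onto_nil_lie) blast
  show ?thesis using alg_homD(1)[OF \<rho>(1), of "Poly_Mapping.single (Gen a) 1"] \<rho>(2) a by simp
qed

text \<open>The algebra is a quotient of \<open>magma_alg\<close>, whose elements are combinations
  of iterated products of generators. This is the induction principle for its elements.\<close>

theorem nil_lie_generated: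
  assumes U: "subspace_of (nil_lie S E c :: ('k::field, _) module) U"
    and mult: "\<And>x y. x \<in> U \<Longrightarrow> y \<in> U \<Longrightarrow> x \<otimes>\<^bsub>(nil_lie S E c :: ('k, _) module)\<^esub> y \<in> U"
    and gen: "\<And>a. a \<in> S \<Longrightarrow> vertex S E c a \<in> U"
    and x: "x \<in> carrier (nil_lie S E c :: ('k, _) module)"
  shows "x \<in> U"
proof -
  let ?A = "magma_alg S :: ('k, _) module" and ?N = "nil_lie S E c :: ('k, _) module"
  obtain \<rho> where \<rho>: "\<rho> \<in> alg_hom ?A ?N" "\<rho> ` carrier ?A = carrier ?N"
    "\<And>a. a \<in> S \<Longrightarrow> \<rho> (Poly_Mapping.single (Gen a) 1) = vertex S E c a"
    by (rule magma_onto_nil_lie) blast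
  have m: "nonassoc_algebra ?A" by (rule magma_alg_nonassoc)
  then interpret A: nonassoc_algebra ?A .
  have "p \<in> {p \<in> carrier ?A. \<rho> p \<in> U}" if "p \<in> carrier ?A" for p
  proof (rule magma_generated[OF alg_hom_vimage_subspace[OF m lie_nonassoc[OF nil_lie_lie] \<rho>(1) U] _ _ that])
    fix x y assume xy: "x \<in> {p \<in> carrier ?A. \<rho> p \<in> U}" "y \<in> {p \<in> carrier ?A. \<rho> p \<in> U}"
    then have "\<rho> (x \<otimes>\<^bsub>?A\<^esub> y) \<in> U" using alg_homD(4)[OF \<rho>(1)] mult by (simp del: magma_alg_simps)
    then show "magma_mult x y \<in> {p \<in> carrier ?A. \<rho> p \<in> U}"
      using xy A.mult_closed[of x y] by simp
  qed (use gen \<rho>(3) in simp)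
  then show ?thesis using x unfolding \<rho>(2)[symmetric] by blast
qed

lemma vertex_mult_zero:
  assumes "a \<in> S" "b \<in> S" "{a, b} \<notin> E"
  shows "vertex S E c a \<otimes>\<^bsub>(nil_lie S E c :: ('k::field, _) module)\<^esub> vertex S E c b =
    \<zero>\<^bsub>(nil_lie S E c :: ('k, _) module)\<^esub>"
proof -
  let ?F = "free_lie S :: ('k, _) module" and ?G = "graph_lie S E :: ('k, _) module"
  interpret g: algebra_quotient ?F "graph_ideal S E" by (rule graph_lie_quotient)
  interpret n: algebra_quotient ?G "lower_central ?G (c + 1)" by (rule nil_lie_quotient)
  note f = free_gen_closed[OF assms(1)] free_gen_closed[OF assms(2)]
  let ?g = "\<lambda>x. graph_ideal S E +>\<^bsub>?F\<^esub> x"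
  have gc: "?g (free_gen S a) \<in> carrier ?G" "?g (free_gen S b) \<in> carrier ?G"
    using alg_homD(1)[OF g.quot_alg_hom] f by (simp_all add: graph_lie_def)
  have "free_gen S a \<otimes>\<^bsub>?F\<^esub> free_gen S b \<in> graph_ideal S E"
    unfolding graph_ideal_def
    by (rule subsetD[OF g.ideal_gen_incl], rule CollectI, rule exI[of _ a], rule exI[of _ b])
      (simp add: assms)
  then have "?g (free_gen S a) \<otimes>\<^bsub>?G\<^esub> ?g (free_gen S b) = \<zero>\<^bsub>?G\<^esub>"
    unfolding graph_lie_def alg_homD(4)[OF g.quot_alg_hom f, symmetric]
    using f by (simp add: g.quot_eq_zero_iff)
  then show ?thesis
    using alg_homD(4)[OF n.quot_alg_hom gc] n.quot_zero by (simp add: vertex_def nil_lie_def)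
qed

end

end

text \<open>The equaliser of two homomorphisms is a subalgebra, so agreement on the vertices spreads
  to everything.\<close>

lemma nil_lie_hom_eqI:
  assumes "nonassoc_algebra L" "F \<in> alg_hom (nil_lie S E c) L" "G \<in> alg_hom (nil_lie S E c) L"
    and "\<And>a. a \<in> S \<Longrightarrow> F (vertex S E c a) = G (vertex S E c a)"
    and "x \<in> carrier (nil_lie S E c :: ('k::field, _) module)"
  shows "F x = G x"
proof -
  let ?N = "nil_lie S E c :: ('k, _) module"
  interpret N: lie ?N by (rule nil_lie_lie)
  note n = N.nonassoc_algebra_axioms
  have "x \<in> {x \<in> carrier ?N. F x = G x}"
    by (rule nil_lie_generated[OF _ _ _ assms(5)])
      (use assms(4) alg_homD[OF assms(2)] alg_homD[OF assms(3)] alg_hom_zero[OF n assms(1,2)]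
        alg_hom_zero[OF n assms(1,3)] in \<open>auto intro!: subspace_ofI vertex_closed\<close>)
  then show ?thesis by simp
qed

section \<open>Change of scalars and quadratic extensions\<close>

text \<open>Restriction of scalars along \<theta>. A \<theta>-semilinear multiplicative map from L
  to M is a plain homomorphism from L to \<open>twist_scalars \<theta> M\<close>, so the theory of
  \<open>alg_hom\<close> and the universal property cover antilinear maps and the inclusion of the
  reals as well.\<close>

definition twist_scalars :: "('k \<Rightarrow> 'l) \<Rightarrow> ('l, 'a) module \<Rightarrow> ('k, 'a) module" where
  "twist_scalars \<theta> L =
     \<lparr>carrier = carrier L, monoid.mult = monoid.mult L, one = monoid.one L,
      ring.zero = ring.zero L, ring.add = ring.add L,
      module.smult = (\<lambda>a. module.smult L (\<theta> a))\<rparr>"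

lemma twist_scalars_simps [simp]:
  "carrier (twist_scalars \<theta> L) = carrier L" "x \<otimes>\<^bsub>twist_scalars \<theta> L\<^esub> y = x \<otimes>\<^bsub>L\<^esub> y"
  "\<zero>\<^bsub>twist_scalars \<theta> L\<^esub> = \<zero>\<^bsub>L\<^esub>" "x \<oplus>\<^bsub>twist_scalars \<theta> L\<^esub> y = x \<oplus>\<^bsub>L\<^esub> y"
  "a \<odot>\<^bsub>twist_scalars \<theta> L\<^esub> x = \<theta> a \<odot>\<^bsub>L\<^esub> x"
  by (simp_all add: twist_scalars_def)

definition field_hom :: "('k::field \<Rightarrow> 'l::field) \<Rightarrow> bool" where
  "field_hom \<theta> \<longleftrightarrow> \<theta> 1 = 1 \<and> (\<forall>a b. \<theta> (a + b) = \<theta> a + \<theta> b) \<and> (\<forall>a b. \<theta> (a * b) = \<theta> a * \<theta> b)"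

lemma lie_twist_scalars:
  assumes "lie L" "field_hom \<theta>" shows "lie (twist_scalars \<theta> L)"
proof -
  interpret lie L by fact
  have "abelian_group (twist_scalars \<theta> L)"
    by (rule abelian_groupI) (auto simp: a_ac intro: l_neg)
  moreover have "nonassoc_algebra_axioms (twist_scalars \<theta> L)"
    by unfold_locales
      (use assms(2) in \<open>auto simp: field_hom_def smult_l_distr smult_r_distr smult_assoc
        mult_l_distr mult_r_distr mult_smult_l mult_smult_r\<close>)
  moreover have "lie_axioms (twist_scalars \<theta> L)"
    by unfold_locales (simp_all add: mult_self jacobi)
  ultimately show ?thesis by (simp add: lie_def nonassoc_algebra_def)
qed

text \<open>A subspace of \<open>L\<close> remains one when only the scalars in the image of
  \<theta> act. The inclusion is what bounds the nilpotency class of the twisted algebra.\<close>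

lemma lower_central_twist_scalars:
  assumes "lie L" "field_hom \<theta>" "i \<ge> 1"
  shows "lower_central (twist_scalars \<theta> L) i \<subseteq> lower_central L i"
proof -
  interpret lie L by fact
  interpret T: lie "twist_scalars \<theta> L" using assms by (intro lie_twist_scalars)
  show ?thesis
    by (rule T.lower_central_subset[OF assms(3)])
      (use subspace_ofD[OF lower_central_subspace] in
        \<open>auto intro!: subspace_ofI mult_lower_central\<close>)
qed

text \<open>Extension of scalars along \<open>k[t]/(t\<^sup>2 - q)\<close>, with \<open>v + t w\<close> written \<open>(v, w)\<close>: the case
  \<open>q = -1\<close> underlies complexification, the case \<open>q = 0\<close> turns derivations into homomorphisms.\<close>

definition pair_alg :: "'k::field \<Rightarrow> ('k, 'a) module \<Rightarrow> ('k, 'a \<times> 'a) module" where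
  "pair_alg q L =
     \<lparr>carrier = carrier L \<times> carrier L,
      monoid.mult = (\<lambda>(v, w) (v', w').
        (v \<otimes>\<^bsub>L\<^esub> v' \<oplus>\<^bsub>L\<^esub> q \<odot>\<^bsub>L\<^esub> (w \<otimes>\<^bsub>L\<^esub> w'), v \<otimes>\<^bsub>L\<^esub> w' \<oplus>\<^bsub>L\<^esub> w \<otimes>\<^bsub>L\<^esub> v')),
      one = undefined,
      ring.zero = (\<zero>\<^bsub>L\<^esub>, \<zero>\<^bsub>L\<^esub>),
      ring.add = (\<lambda>(v, w) (v', w'). (v \<oplus>\<^bsub>L\<^esub> v', w \<oplus>\<^bsub>L\<^esub> w')),
      module.smult = (\<lambda>a (v, w). (a \<odot>\<^bsub>L\<^esub> v, a \<odot>\<^bsub>L\<^esub> w))\<rparr>"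

lemma pair_alg_simps [simp]:
  "carrier (pair_alg q L) = carrier L \<times> carrier L"
  "(v, w) \<otimes>\<^bsub>pair_alg q L\<^esub> (v', w') =
     (v \<otimes>\<^bsub>L\<^esub> v' \<oplus>\<^bsub>L\<^esub> q \<odot>\<^bsub>L\<^esub> (w \<otimes>\<^bsub>L\<^esub> w'), v \<otimes>\<^bsub>L\<^esub> w' \<oplus>\<^bsub>L\<^esub> w \<otimes>\<^bsub>L\<^esub> v')"
  "\<zero>\<^bsub>pair_alg q L\<^esub> = (\<zero>\<^bsub>L\<^esub>, \<zero>\<^bsub>L\<^esub>)"
  "(v, w) \<oplus>\<^bsub>pair_alg q L\<^esub> (v', w') = (v \<oplus>\<^bsub>L\<^esub> v', w \<oplus>\<^bsub>L\<^esub> w')"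
  "a \<odot>\<^bsub>pair_alg q L\<^esub> (v, w) = (a \<odot>\<^bsub>L\<^esub> v, a \<odot>\<^bsub>L\<^esub> w)"
  by (simp_all add: pair_alg_def)

context lie
begin

lemma pair_alg_abelian_group: "abelian_group (pair_alg q L)"
proof (rule abelian_groupI)
  fix x assume "x \<in> carrier (pair_alg q L)"
  then show "\<exists>y\<in>carrier (pair_alg q L). y \<oplus>\<^bsub>pair_alg q L\<^esub> x = \<zero>\<^bsub>pair_alg q L\<^esub>"
    by (intro bexI[of _ "(\<ominus> fst x, \<ominus> snd x)"]) (auto simp: l_neg)
qed (auto simp: a_ac)

lemma pair_alg_lie: "lie (pair_alg q L)"
proof -
  let ?P = "pair_alg q L"
  have "nonassoc_algebra_axioms ?P"
    by unfold_locales
      (auto simp: smult_l_distr smult_r_distr smult_assoc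
        mult_l_distr mult_r_distr mult_smult_l mult_smult_r a_ac mult.commute)
  moreover have "lie_axioms ?P"
  proof
    fix x y z assume c: "x \<in> carrier ?P" "y \<in> carrier ?P" "z \<in> carrier ?P"
    obtain a a' b b' d d' where x: "x = (a, a')" "y = (b, b')" "z = (d, d')"
      by (cases x, cases y, cases z)
    with c have [simp]: "a \<in> carrier L" "a' \<in> carrier L" "b \<in> carrier L" "b' \<in> carrier L"
      "d \<in> carrier L" "d' \<in> carrier L" by auto
    show "x \<otimes>\<^bsub>?P\<^esub> x = \<zero>\<^bsub>?P\<^esub>"
      using mult_anticomm[of a a'] by (simp add: x mult_self smult_neg1 r_neg)
    let ?J = "\<lambda>x y z. x \<otimes> (y \<otimes> z) \<oplus> y \<otimes> (z \<otimes> x) \<oplus> z \<otimes> (x \<otimes> y)"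
    \<comment> \<open>Expansion by powers of t, with t squared replaced by q: terms with an even
      number of t form the first component, those with an odd number the second, and each group is a
      Jacobi expression in \<open>L\<close>.\<close>
    have "x \<otimes>\<^bsub>?P\<^esub> (y \<otimes>\<^bsub>?P\<^esub> z) \<oplus>\<^bsub>?P\<^esub> y \<otimes>\<^bsub>?P\<^esub> (z \<otimes>\<^bsub>?P\<^esub> x) \<oplus>\<^bsub>?P\<^esub> z \<otimes>\<^bsub>?P\<^esub> (x \<otimes>\<^bsub>?P\<^esub> y) =
      (?J a b d \<oplus> q \<odot> (?J a b' d' \<oplus> ?J a' b d' \<oplus> ?J a' b' d),
       ?J a b d' \<oplus> ?J a b' d \<oplus> ?J a' b d \<oplus> q \<odot> ?J a' b' d')"
      by (simp add: x mult_r_distr smult_r_distr mult_smult_r a_ac)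
    also have "\<dots> = \<zero>\<^bsub>?P\<^esub>" by (simp add: jacobi)
    finally show "x \<otimes>\<^bsub>?P\<^esub> (y \<otimes>\<^bsub>?P\<^esub> z) \<oplus>\<^bsub>?P\<^esub> y \<otimes>\<^bsub>?P\<^esub> (z \<otimes>\<^bsub>?P\<^esub> x) \<oplus>\<^bsub>?P\<^esub> z \<otimes>\<^bsub>?P\<^esub> (x \<otimes>\<^bsub>?P\<^esub> y) = \<zero>\<^bsub>?P\<^esub>" .
  qed
  ultimately show ?thesis using pair_alg_abelian_group by (simp add: lie_def nonassoc_algebra_def)
qed

text \<open>Stated for any algebra \<open>P\<close> on pairs with this product, possibly over
  another field, so that it serves both \<open>pair_alg\<close> and the complexification of a real
  algebra.\<close>

lemma lower_central_Times_subset: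
  assumes "nonassoc_algebra P" "i \<ge> 1"
    and "carrier P = carrier L \<times> carrier L" "\<zero>\<^bsub>P\<^esub> = (\<zero>, \<zero>)"
    and "\<And>v w v' w'. (v, w) \<oplus>\<^bsub>P\<^esub> (v', w') = (v \<oplus> v', w \<oplus> w')"
    and "\<And>a U v w. subspace_of L U \<Longrightarrow> v \<in> U \<Longrightarrow> w \<in> U \<Longrightarrow> a \<odot>\<^bsub>P\<^esub> (v, w) \<in> U \<times> U"
    and "\<And>v w v' w'. v \<in> carrier L \<Longrightarrow> w \<in> carrier L \<Longrightarrow> v' \<in> carrier L \<Longrightarrow> w' \<in> carrier L \<Longrightarrow>
      (v, w) \<otimes>\<^bsub>P\<^esub> (v', w') = (v \<otimes> v' \<oplus> q \<odot> (w \<otimes> w'), v \<otimes> w' \<oplus> w \<otimes> v')"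
  shows "lower_central P i \<subseteq> lower_central L i \<times> lower_central L i"
proof -
  interpret P: nonassoc_algebra P by fact
  show ?thesis
  proof (rule P.lower_central_subset[OF assms(2)])
    fix i :: nat
    note s = subspace_ofD[OF lower_central_subspace[of i]]
    show "subspace_of P (lower_central L i \<times> lower_central L i)"
      using s assms(6)[OF lower_central_subspace[of i]]
      by (intro subspace_ofI) (auto simp: assms)
    fix x y assume "1 \<le> i" "x \<in> carrier P" "y \<in> lower_central L i \<times> lower_central L i"
    then show "x \<otimes>\<^bsub>P\<^esub> y \<in> lower_central L (Suc i) \<times> lower_central L (Suc i)"
      using s(1) mult_lower_central subspace_ofD[OF lower_central_subspace[of "Suc i"]]
      by (cases x; cases y) (simp add: assms)
  qed (simp add: assms)
qed

lemma lower_central_pair_alg: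
  "i \<ge> 1 \<Longrightarrow> lower_central (pair_alg q L) i \<subseteq> lower_central L i \<times> lower_central L i"
  by (rule lower_central_Times_subset)
    (auto intro: lie_nonassoc[OF pair_alg_lie] subspace_ofD(4))

end

lemma complexification_simps [simp]:
  "carrier (complexification L) = carrier L \<times> carrier L"
  "(v, w) \<otimes>\<^bsub>complexification L\<^esub> (v', w') =
     (v \<otimes>\<^bsub>L\<^esub> v' \<ominus>\<^bsub>L\<^esub> w \<otimes>\<^bsub>L\<^esub> w', v \<otimes>\<^bsub>L\<^esub> w' \<oplus>\<^bsub>L\<^esub> w \<otimes>\<^bsub>L\<^esub> v')"
  "\<zero>\<^bsub>complexification L\<^esub> = (\<zero>\<^bsub>L\<^esub>, \<zero>\<^bsub>L\<^esub>)"
  "(v, w) \<oplus>\<^bsub>complexification L\<^esub> (v', w') = (v \<oplus>\<^bsub>L\<^esub> v', w \<oplus>\<^bsub>L\<^esub> w')"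
  "z \<odot>\<^bsub>complexification L\<^esub> (v, w) =
     (Re z \<odot>\<^bsub>L\<^esub> v \<ominus>\<^bsub>L\<^esub> Im z \<odot>\<^bsub>L\<^esub> w, Re z \<odot>\<^bsub>L\<^esub> w \<oplus>\<^bsub>L\<^esub> Im z \<odot>\<^bsub>L\<^esub> v)"
  by (simp_all add: complexification_def)

text \<open>The two structures differ only in their scalars, so the Jacobi identity of the
  complexification is inherited from \<open>pair_alg_lie\<close>.\<close>

lemma complexification_mult_pair:
  assumes "lie L" "x \<in> carrier L \<times> carrier L" "y \<in> carrier L \<times> carrier L"
  shows "x \<otimes>\<^bsub>complexification L\<^esub> y = x \<otimes>\<^bsub>pair_alg (- 1) L\<^esub> y"
proof -
  interpret lie L by fact
  show ?thesis using assms(2,3) by (cases x; cases y) (simp add: minus_conv)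
qed

lemma complexification_lie:
  assumes "lie L" shows "lie (complexification L)"
proof -
  interpret lie L by fact
  let ?C = "complexification L" and ?P = "pair_alg (- 1) L"
  interpret P: lie ?P by (rule pair_alg_lie)
  have add: "x \<oplus>\<^bsub>?C\<^esub> y = x \<oplus>\<^bsub>?P\<^esub> y" for x y by (cases x; cases y) simp
  have cl: "x \<otimes>\<^bsub>?P\<^esub> y \<in> carrier L \<times> carrier L" "x \<oplus>\<^bsub>?P\<^esub> y \<in> carrier L \<times> carrier L"
    if "x \<in> carrier L \<times> carrier L" "y \<in> carrier L \<times> carrier L" for x y
    using P.mult_closed[of x y] P.a_closed[of x y] that by simp_all
  note m = complexification_mult_pair[OF assms]
  have "abelian_group ?C"
  proof (rule abelian_groupI)
    fix x assume "x \<in> carrier ?C"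
    then show "\<exists>y\<in>carrier ?C. y \<oplus>\<^bsub>?C\<^esub> x = \<zero>\<^bsub>?C\<^esub>"
      by (intro bexI[of _ "(\<ominus>\<^bsub>L\<^esub> fst x, \<ominus>\<^bsub>L\<^esub> snd x)"]) (auto simp: l_neg)
  qed (auto simp: a_ac)
  moreover have "nonassoc_algebra_axioms ?C"
  proof
    fix x y z and a b :: complex assume x: "x \<in> carrier ?C"
    then show "a \<odot>\<^bsub>?C\<^esub> x \<in> carrier ?C" "1 \<odot>\<^bsub>?C\<^esub> x = x" by (auto simp: minus_conv)
    show "(a + b) \<odot>\<^bsub>?C\<^esub> x = a \<odot>\<^bsub>?C\<^esub> x \<oplus>\<^bsub>?C\<^esub> b \<odot>\<^bsub>?C\<^esub> x"
      using x by (auto simp: minus_conv smult_l_distr smult_r_distr smult_assoc a_ac)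
    show "a \<odot>\<^bsub>?C\<^esub> (b \<odot>\<^bsub>?C\<^esub> x) = (a * b) \<odot>\<^bsub>?C\<^esub> x"
    proof -
      obtain v w where [simp]: "x = (v, w)" by (cases x)
      have [simp]: "v \<in> carrier L" "w \<in> carrier L" using x by auto
      show ?thesis
        by (simp add: minus_conv smult_l_distr smult_r_distr smult_assoc a_ac diff_conv_add_uminus
            del: add_uminus_conv_diff)
    qed
    assume y: "y \<in> carrier ?C"
    show "x \<otimes>\<^bsub>?C\<^esub> y \<in> carrier ?C" using x y by (auto simp: minus_conv)
    show "a \<odot>\<^bsub>?C\<^esub> (x \<oplus>\<^bsub>?C\<^esub> y) = a \<odot>\<^bsub>?C\<^esub> x \<oplus>\<^bsub>?C\<^esub> a \<odot>\<^bsub>?C\<^esub> y"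
      using x y by (auto simp: minus_conv smult_r_distr smult_assoc a_ac)
    show "(a \<odot>\<^bsub>?C\<^esub> x) \<otimes>\<^bsub>?C\<^esub> y = a \<odot>\<^bsub>?C\<^esub> (x \<otimes>\<^bsub>?C\<^esub> y)" "x \<otimes>\<^bsub>?C\<^esub> (a \<odot>\<^bsub>?C\<^esub> y) = a \<odot>\<^bsub>?C\<^esub> (x \<otimes>\<^bsub>?C\<^esub> y)"
      using x y by (auto simp: minus_conv mult_l_distr mult_r_distr smult_r_distr smult_assoc
          mult_smult_l mult_smult_r a_ac)
    assume z: "z \<in> carrier ?C"
    show "(x \<oplus>\<^bsub>?C\<^esub> y) \<otimes>\<^bsub>?C\<^esub> z = x \<otimes>\<^bsub>?C\<^esub> z \<oplus>\<^bsub>?C\<^esub> y \<otimes>\<^bsub>?C\<^esub> z"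
      "z \<otimes>\<^bsub>?C\<^esub> (x \<oplus>\<^bsub>?C\<^esub> y) = z \<otimes>\<^bsub>?C\<^esub> x \<oplus>\<^bsub>?C\<^esub> z \<otimes>\<^bsub>?C\<^esub> y"
      using x y z P.mult_l_distr[of x y z] P.mult_r_distr[of x y z] by (simp_all add: m add cl)
  qed
  moreover have "lie_axioms ?C"
  proof
    fix x y z assume x: "x \<in> carrier ?C"
    then show "x \<otimes>\<^bsub>?C\<^esub> x = \<zero>\<^bsub>?C\<^esub>" using P.mult_self[of x] by (simp add: m)
    assume "y \<in> carrier ?C" "z \<in> carrier ?C"
    then show "x \<otimes>\<^bsub>?C\<^esub> (y \<otimes>\<^bsub>?C\<^esub> z) \<oplus>\<^bsub>?C\<^esub> y \<otimes>\<^bsub>?C\<^esub> (z \<otimes>\<^bsub>?C\<^esub> x) \<oplus>\<^bsub>?C\<^esub> z \<otimes>\<^bsub>?C\<^esub> (x \<otimes>\<^bsub>?C\<^esub> y) = \<zero>\<^bsub>?C\<^esub>"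
      using x P.jacobi[of x y z] by (simp add: m add cl)
  qed
  ultimately show ?thesis by (simp add: lie_def nonassoc_algebra_def)
qed

lemma lower_central_complexification:
  assumes "lie L" "i \<ge> 1"
  shows "lower_central (complexification L) i \<subseteq> lower_central L i \<times> lower_central L i"
proof -
  interpret lie L by fact
  show ?thesis
  proof (rule lower_central_Times_subset[OF lie_nonassoc[OF complexification_lie[OF assms(1)]] assms(2),
          where q = "- 1"])
    fix a U v w assume U: "subspace_of L U" and "v \<in> U" "w \<in> U"
    then show "a \<odot>\<^bsub>complexification L\<^esub> (v, w) \<in> U \<times> U"
      using subspace_ofD(3,4)[OF U] subspace_diff[OF U] by simp
  qed (simp_all add: minus_conv)
qed

section \<open>The two-step model\<close>

text \<open>The quotient by the third term of the lower central series, in coordinates: linear forms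
  on the vertices together with alternating forms supported on the edges.\<close>

definition edge_form :: "'s set set \<Rightarrow> ('s \<Rightarrow> 'k::field) \<Rightarrow> ('s \<Rightarrow> 'k) \<Rightarrow> 's \<times> 's \<Rightarrow> 'k" where
  "edge_form E x y = (\<lambda>(a, b). if {a, b} \<in> E then x a * y b - x b * y a else 0)"

definition two_step :: "'s set set \<Rightarrow> ('k::field, ('s \<Rightarrow> 'k) \<times> ('s \<times> 's \<Rightarrow> 'k)) module" where
  "two_step E =
     \<lparr>carrier = UNIV, monoid.mult = (\<lambda>p q. (\<lambda>_. 0, edge_form E (fst p) (fst q))),
      one = undefined, ring.zero = (\<lambda>_. 0, \<lambda>_. 0),
      ring.add = (\<lambda>p q. (\<lambda>a. fst p a + fst q a, \<lambda>e. snd p e + snd q e)),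
      module.smult = (\<lambda>r p. (\<lambda>a. r * fst p a, \<lambda>e. r * snd p e))\<rparr>"

lemma two_step_simps [simp]:
  "carrier (two_step E) = UNIV" "p \<otimes>\<^bsub>two_step E\<^esub> q = (\<lambda>_. 0, edge_form E (fst p) (fst q))"
  "\<zero>\<^bsub>two_step E\<^esub> = (\<lambda>_. 0, \<lambda>_. 0)"
  "p \<oplus>\<^bsub>two_step E\<^esub> q = (\<lambda>a. fst p a + fst q a, \<lambda>e. snd p e + snd q e)"
  "r \<odot>\<^bsub>two_step E\<^esub> p = (\<lambda>a. r * fst p a, \<lambda>e. r * snd p e)"
  by (simp_all add: two_step_def)

lemma two_step_lie: "lie (two_step E :: ('k::field, ('s \<Rightarrow> 'k) \<times> ('s \<times> 's \<Rightarrow> 'k)) module)"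
proof -
  let ?T = "two_step E :: ('k, ('s \<Rightarrow> 'k) \<times> ('s \<times> 's \<Rightarrow> 'k)) module"
  have "abelian_group ?T"
  proof (rule abelian_groupI)
    fix x assume "x \<in> carrier ?T"
    show "\<exists>y\<in>carrier ?T. y \<oplus>\<^bsub>?T\<^esub> x = \<zero>\<^bsub>?T\<^esub>"
      by (intro bexI[of _ "(\<lambda>a. - fst x a, \<lambda>e. - snd x e)"]) auto
  qed (auto simp: ac_simps)
  moreover have "nonassoc_algebra_axioms ?T"
    by unfold_locales (auto simp: edge_form_def fun_eq_iff algebra_simps)
  moreover have "lie_axioms ?T"
    by unfold_locales (auto simp: edge_form_def fun_eq_iff)
  ultimately show ?thesis by (simp add: lie_def nonassoc_algebra_def)
qed

text \<open>A product has no linear part and therefore multiplies to zero, so the third term of the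
  series vanishes; c > 1 says that the index c + 1 is at least 3.\<close>

lemma two_step_nilpotent:
  assumes "c > 1"
  shows "lower_central (two_step E :: ('k::field, ('s \<Rightarrow> 'k) \<times> ('s \<times> 's \<Rightarrow> 'k)) module) (c + 1)
    \<subseteq> {\<zero>\<^bsub>(two_step E :: ('k, ('s \<Rightarrow> 'k) \<times> ('s \<times> 's \<Rightarrow> 'k)) module)\<^esub>}"
proof -
  let ?T = "two_step E :: ('k, ('s \<Rightarrow> 'k) \<times> ('s \<times> 's \<Rightarrow> 'k)) module"
  interpret lie ?T by (rule two_step_lie)
  let ?U = "\<lambda>i::nat. if i \<le> 1 then UNIV else if i = 2 then {p. fst p = (\<lambda>_. 0)} else {\<zero>\<^bsub>?T\<^esub>}"
  have "lower_central ?T (c + 1) \<subseteq> ?U (c + 1)"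
    by (rule lower_central_subset)
      (auto intro!: subspace_ofI simp: edge_form_def fun_eq_iff split: if_splits)
  then show ?thesis using assms by simp
qed

section \<open>Semilinear homomorphisms, isomorphisms and their inverses\<close>

definition field_aut :: "(complex \<Rightarrow> complex) \<Rightarrow> (complex \<Rightarrow> complex) \<Rightarrow> bool" where
  "field_aut \<theta> \<theta>' \<longleftrightarrow> field_hom \<theta> \<and> field_hom \<theta>' \<and> (\<forall>a. \<theta>' (\<theta> a) = a) \<and> (\<forall>a. \<theta> (\<theta>' a) = a)"

lemma field_hom_simps: "field_hom (\<lambda>a. a)" "field_hom cnj" "field_hom complex_of_real"
  by (auto simp: field_hom_def)

lemma field_aut_simps: "field_aut (\<lambda>a. a) (\<lambda>a. a)" "field_aut cnj cnj"
  by (auto simp: field_aut_def field_hom_simps)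

lemma alg_hom_twist: "F \<in> alg_hom L M \<Longrightarrow> F \<in> alg_hom (twist_scalars \<theta> L) (twist_scalars \<theta> M)"
  by (auto simp: alg_hom_def)

lemma alg_hom_twist_comp:
  "F \<in> alg_hom L (twist_scalars \<theta> M) \<Longrightarrow> G \<in> alg_hom M (twist_scalars \<theta>' K) \<Longrightarrow>
    (\<lambda>x. G (F x)) \<in> alg_hom L (twist_scalars (\<lambda>a. \<theta>' (\<theta> a)) K)"
  by (auto simp: alg_hom_def Pi_iff)

lemma alg_hom_twist_id [simp]: "alg_hom L (twist_scalars (\<lambda>a. a) M) = alg_hom L M"
  by (auto simp: alg_hom_def)

lemma alg_isoI:
  assumes "F \<in> alg_hom L M" "\<And>y. y \<in> carrier M \<Longrightarrow> G y \<in> carrier L"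
    "\<And>x. x \<in> carrier L \<Longrightarrow> G (F x) = x" "\<And>y. y \<in> carrier M \<Longrightarrow> F (G y) = y"
  shows "F \<in> alg_iso L M"
  using assms alg_homD(1)[OF assms(1)] unfolding alg_iso_def
  by (auto intro!: bij_betw_byWitness[of _ G])

lemma alg_iso_hom: "F \<in> alg_iso L M \<Longrightarrow> F \<in> alg_hom L M"
  by (simp add: alg_iso_def)

lemma alg_iso_cong:
  assumes "F \<in> alg_iso L M" "nonassoc_algebra L" "\<And>x. x \<in> carrier L \<Longrightarrow> F' x = F x"
  shows "F' \<in> alg_iso L M"
proof -
  interpret nonassoc_algebra L by fact
  have "bij_betw F' (carrier L) (carrier M)"
    using assms(1,3) bij_betw_cong[of "carrier L" F' F] by (simp add: alg_iso_def)
  moreover have "F' \<in> alg_hom L M"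
    using alg_homD[OF alg_iso_hom[OF assms(1)]] by (intro alg_homI) (simp_all add: assms(3))
  ultimately show ?thesis by (simp add: alg_iso_def)
qed

text \<open>Closure of the source carrier under the operations suffices to invert. In this form it
  applies to fixed point algebras, for which only closure is checked.\<close>

lemma alg_iso_inverse:
  assumes "F \<in> alg_iso L M"
    and closed: "\<And>x y. x \<in> carrier L \<Longrightarrow> y \<in> carrier L \<Longrightarrow> x \<oplus>\<^bsub>L\<^esub> y \<in> carrier L"
      "\<And>x y. x \<in> carrier L \<Longrightarrow> y \<in> carrier L \<Longrightarrow> x \<otimes>\<^bsub>L\<^esub> y \<in> carrier L"
      "\<And>a x. x \<in> carrier L \<Longrightarrow> a \<odot>\<^bsub>L\<^esub> x \<in> carrier L"
  obtains G where "G \<in> alg_hom M L" "\<And>x. x \<in> carrier L \<Longrightarrow> G (F x) = x"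
    "\<And>y. y \<in> carrier M \<Longrightarrow> F (G y) = y"
proof -
  let ?G = "inv_into (carrier L) F"
  have bij: "bij_betw F (carrier L) (carrier M)" using assms(1) by (simp add: alg_iso_def)
  note h = alg_homD[OF alg_iso_hom[OF assms(1)]]
  have GF: "?G (F x) = x" if "x \<in> carrier L" for x
    using bij_betw_inv_into_left[OF bij that] .
  have FG: "F (?G y) = y" if "y \<in> carrier M" for y
    using bij_betw_inv_into_right[OF bij that] .
  have cl: "?G y \<in> carrier L" if "y \<in> carrier M" for y
    using bij_betwE[OF bij_betw_inv_into[OF bij]] that by blast
  have "?G \<in> alg_hom M L"
  proof (rule alg_homI)
    fix x y a assume x: "x \<in> carrier M"
    then show "?G x \<in> carrier L" by (rule cl)
    have "?G (F (a \<odot>\<^bsub>L\<^esub> ?G x)) = a \<odot>\<^bsub>L\<^esub> ?G x" using cl[OF x] by (intro GF) (simp add: closed)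
    then show "?G (a \<odot>\<^bsub>M\<^esub> x) = a \<odot>\<^bsub>L\<^esub> ?G x" by (simp add: h(3)[OF cl[OF x]] FG[OF x])
    assume y: "y \<in> carrier M"
    have "?G (F (?G x \<oplus>\<^bsub>L\<^esub> ?G y)) = ?G x \<oplus>\<^bsub>L\<^esub> ?G y" using cl[OF x] cl[OF y] by (intro GF) (simp add: closed)
    then show "?G (x \<oplus>\<^bsub>M\<^esub> y) = ?G x \<oplus>\<^bsub>L\<^esub> ?G y" by (simp add: h(2)[OF cl[OF x] cl[OF y]] FG[OF x] FG[OF y])
    have "?G (F (?G x \<otimes>\<^bsub>L\<^esub> ?G y)) = ?G x \<otimes>\<^bsub>L\<^esub> ?G y" using cl[OF x] cl[OF y] by (intro GF) (simp add: closed)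
    then show "?G (x \<otimes>\<^bsub>M\<^esub> y) = ?G x \<otimes>\<^bsub>L\<^esub> ?G y" by (simp add: h(4)[OF cl[OF x] cl[OF y]] FG[OF x] FG[OF y])
  qed
  then show ?thesis using that GF FG by blast
qed

lemma alg_iso_comp:
  assumes "F \<in> alg_iso L M" "G \<in> alg_iso M K" shows "(\<lambda>x. G (F x)) \<in> alg_iso L K"
proof -
  have "bij_betw (G \<circ> F) (carrier L) (carrier K)"
    using assms by (intro bij_betw_trans[of F _ "carrier M"]) (auto simp: alg_iso_def)
  moreover have "(\<lambda>x. G (F x)) \<in> alg_hom L K"
    using alg_hom_comp[OF alg_iso_hom[OF assms(1)] alg_iso_hom[OF assms(2)]] .
  ultimately show ?thesis by (simp add: alg_iso_def comp_def)
qed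

lemma complexification_conj_hom:
  assumes "lie L"
  shows "complexification_conj L \<in> alg_hom (complexification L) (twist_scalars cnj (complexification L))"
proof -
  interpret lie L by fact
  show ?thesis
    by (rule alg_homI)
      (auto simp: complexification_conj_def minus_conv minus_smult smult_r_distr smult_assoc
        mult_smult_l mult_smult_r a_ac)
qed

section \<open>Complex Lie algebras\<close>

declare lower_central.simps(3) [simp del]

locale complex_lie = lie L for L :: "(complex, 'a) module" (structure)
begin

abbreviation "lower \<equiv> lower_central L"

lemma twisted_lie: "field_hom \<theta> \<Longrightarrow> lie (twist_scalars \<theta> L)"
  by (rule lie_twist_scalars[OF lie_axioms])

lemma semilinear_closed: "F \<in> alg_hom L (twist_scalars \<theta> L) \<Longrightarrow> x \<in> carrier L \<Longrightarrow> F x \<in> carrier L"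
  by (auto simp: alg_hom_def)

lemma semilinear_simps:
  assumes "F \<in> alg_hom L (twist_scalars \<theta> L)" "x \<in> carrier L"
  shows "y \<in> carrier L \<Longrightarrow> F (x \<oplus> y) = F x \<oplus> F y" "F (a \<odot> x) = \<theta> a \<odot> F x"
    "y \<in> carrier L \<Longrightarrow> F (x \<otimes> y) = F x \<otimes> F y"
  using assms by (auto simp: alg_hom_def)

lemma semilinear_zero:
  assumes "field_hom \<theta>" "F \<in> alg_hom L (twist_scalars \<theta> L)" shows "F \<zero> = \<zero>"
  using alg_hom_zero[OF nonassoc_algebra_axioms lie_nonassoc[OF twisted_lie[OF assms(1)]] assms(2)] by simp

lemma semilinear_lower:
  assumes "field_hom \<theta>" "F \<in> alg_hom L (twist_scalars \<theta> L)" "i \<ge> 1" "x \<in> lower i"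
  shows "F x \<in> lower i"
  using alg_hom_lower_central[OF nonassoc_algebra_axioms lie_nonassoc[OF twisted_lie[OF assms(1)]] assms(2-4)]
    lower_central_twist_scalars[OF lie_axioms assms(1,3)] by blast

subsection \<open>Real forms as fixed point algebras\<close>

text \<open>The record update copies the shape of \<open>twisted_form\<close>, so that the two agree
  by unfolding.\<close>

definition fixed_alg :: "('a \<Rightarrow> 'a) \<Rightarrow>
    (real, 'a) module" where
  "fixed_alg \<sigma> = (restrict_real L)\<lparr>carrier := {v \<in> carrier L. \<sigma> v = v}\<rparr>"

lemma fixed_alg_simps [simp]:
  "carrier (fixed_alg \<sigma>) = {v \<in> carrier L. \<sigma> v = v}" "x \<otimes>\<^bsub>fixed_alg \<sigma>\<^esub> y = x \<otimes> y"
  "x \<oplus>\<^bsub>fixed_alg \<sigma>\<^esub> y = x \<oplus> y" "a \<odot>\<^bsub>fixed_alg \<sigma>\<^esub> x = complex_of_real a \<odot> x"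
  by (simp_all add: fixed_alg_def restrict_real_def)

lemma fixed_alg_iso:
  assumes g: "g \<in> alg_iso L L" and eq: "\<And>x. x \<in> carrier L \<Longrightarrow> \<sigma> (g x) = g (\<sigma>' x)"
    and \<sigma>': "\<And>x. x \<in> carrier L \<Longrightarrow> \<sigma>' x \<in> carrier L"
  shows "\<exists>f. f \<in> alg_iso (fixed_alg \<sigma>) (fixed_alg \<sigma>')" "g \<in> alg_iso (fixed_alg \<sigma>') (fixed_alg \<sigma>)"
proof -
  obtain f where f: "f \<in> alg_hom L L" "\<And>x. x \<in> carrier L \<Longrightarrow> f (g x) = x" "\<And>x. x \<in> carrier L \<Longrightarrow> g (f x) = x"
    using alg_iso_inverse[OF g] by auto
  note F = alg_homD[OF f(1)] and G = alg_homD[OF alg_iso_hom[OF g]]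
  have fs: "\<sigma>' (f x) = f x" if "x \<in> carrier L" "\<sigma> x = x" for x
  proof -
    have "g (\<sigma>' (f x)) = x" using eq[OF F(1)[OF that(1)]] f(3)[OF that(1)] that(2) by simp
    then have "f (g (\<sigma>' (f x))) = f x" by simp
    then show ?thesis using f(2) \<sigma>' F(1) that by simp
  qed
  have gs: "\<sigma> (g x) = g x" if "x \<in> carrier L" "\<sigma>' x = x" for x using eq[OF that(1)] that(2) by simp
  have fh: "f \<in> alg_hom (fixed_alg \<sigma>) (fixed_alg \<sigma>')" by (rule alg_homI) (simp_all add: F fs)
  have gh: "g \<in> alg_hom (fixed_alg \<sigma>') (fixed_alg \<sigma>)" by (rule alg_homI) (simp_all add: G gs)
  have "f \<in> alg_iso (fixed_alg \<sigma>) (fixed_alg \<sigma>')"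
    by (rule alg_isoI[OF fh, of g]) (simp_all add: f F G fs gs)
  then show "\<exists>f. f \<in> alg_iso (fixed_alg \<sigma>) (fixed_alg \<sigma>')" by blast
  show "g \<in> alg_iso (fixed_alg \<sigma>') (fixed_alg \<sigma>)"
    by (rule alg_isoI[OF gh, of f]) (simp_all add: f F G fs gs)
qed

text \<open>\<sigma> is complex conjugation on the complexification of \<open>M\<close>, transported
  along \<open>F\<close>. A pair (v, w) is fixed by conjugation exactly if w = -w, that is w = 0, so
  the fixed points are the image of \<open>M\<close>.\<close>

lemma real_form_fixed_alg:
  fixes M :: "(real, 'm) module"
  assumes "lie M" and F: "F \<in> alg_iso (complexification M) L"
  obtains \<sigma> where "\<sigma> \<in> alg_hom L (twist_scalars cnj L)" "\<And>x. x \<in> carrier L \<Longrightarrow> \<sigma> (\<sigma> x) = x"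
    "(\<lambda>m. F (m, \<zero>\<^bsub>M\<^esub>)) \<in> alg_iso M (fixed_alg \<sigma>)"
proof -
  interpret M: lie M by fact
  let ?C = "complexification M"
  interpret C: lie ?C by (rule complexification_lie[OF assms(1)])
  obtain G where G: "G \<in> alg_hom L ?C" "\<And>x. x \<in> carrier ?C \<Longrightarrow> G (F x) = x" "\<And>y. y \<in> carrier L \<Longrightarrow> F (G y) = y"
    using alg_iso_inverse[OF F C.a_closed C.mult_closed C.smult_closed] by blast
  let ?k = "complexification_conj M"
  note Fh = alg_iso_hom[OF F] and kh = complexification_conj_hom[OF assms(1)]
  note F1 = alg_homD[OF Fh] and G1 = alg_homD(1)[OF G(1)]
  have kc: "?k x \<in> carrier ?C" if "x \<in> carrier ?C" for x using alg_homD(1)[OF kh that] by simp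
  define \<sigma> where "\<sigma> x = F (?k (G x))" for x
  have "\<sigma> \<in> alg_hom L (twist_scalars cnj L)" unfolding \<sigma>_def[abs_def]
    by (rule alg_hom_comp[OF alg_hom_comp[OF G(1) kh] alg_hom_twist[OF Fh]])
  moreover have "\<sigma> (\<sigma> x) = x" if "x \<in> carrier L" for x
  proof -
    have "\<sigma> (\<sigma> x) = F (?k (?k (G x)))" using G(2)[OF kc[OF G1[OF that]]] by (simp add: \<sigma>_def)
    also have "?k (?k (G x)) = G x" using G1[OF that] by (auto simp: complexification_conj_def)
    finally show ?thesis using G(3)[OF that] by simp
  qed
  moreover have "(\<lambda>m. F (m, \<zero>\<^bsub>M\<^esub>)) \<in> alg_iso M (fixed_alg \<sigma>)"
  proof (rule alg_isoI[of _ _ _ "\<lambda>x. fst (G x)"])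
    have m: "(m, \<zero>\<^bsub>M\<^esub>) \<in> carrier ?C" if "m \<in> carrier M" for m using that by simp
    show "(\<lambda>m. F (m, \<zero>\<^bsub>M\<^esub>)) \<in> alg_hom M (fixed_alg \<sigma>)"
    proof (rule alg_homI)
      fix x y a assume x: "x \<in> carrier M"
      show "F (x, \<zero>\<^bsub>M\<^esub>) \<in> carrier (fixed_alg \<sigma>)"
        using F1(1)[OF m[OF x]] G(2)[OF m[OF x]] x by (simp add: \<sigma>_def complexification_conj_def M.minus_smult)
      show "F (a \<odot>\<^bsub>M\<^esub> x, \<zero>\<^bsub>M\<^esub>) = a \<odot>\<^bsub>fixed_alg \<sigma>\<^esub> F (x, \<zero>\<^bsub>M\<^esub>)"
        using F1(3)[OF m[OF x], of "complex_of_real a"] x by (simp add: M.minus_conv)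
      assume y: "y \<in> carrier M"
      show "F (x \<oplus>\<^bsub>M\<^esub> y, \<zero>\<^bsub>M\<^esub>) = F (x, \<zero>\<^bsub>M\<^esub>) \<oplus>\<^bsub>fixed_alg \<sigma>\<^esub> F (y, \<zero>\<^bsub>M\<^esub>)"
        using F1(2)[OF m[OF x] m[OF y]] by simp
      show "F (x \<otimes>\<^bsub>M\<^esub> y, \<zero>\<^bsub>M\<^esub>) = F (x, \<zero>\<^bsub>M\<^esub>) \<otimes>\<^bsub>fixed_alg \<sigma>\<^esub> F (y, \<zero>\<^bsub>M\<^esub>)"
        using F1(4)[OF m[OF x] m[OF y]] x y by (simp add: M.minus_conv)
    qed
    fix x assume "x \<in> carrier (fixed_alg \<sigma>)"
    then have x: "x \<in> carrier L" "\<sigma> x = x" by auto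
    then show "fst (G x) \<in> carrier M" using G1[OF x(1)] by auto
    have "G x = G (\<sigma> x)" using x by simp
    also have "\<dots> = ?k (G x)" using G(2)[OF kc[OF G1[OF x(1)]]] by (simp add: \<sigma>_def)
    finally obtain v w where vw: "G x = (v, w)" "w = \<ominus>\<^bsub>M\<^esub> w" "v \<in> carrier M" "w \<in> carrier M"
      using G1[OF x(1)] by (cases "G x") (auto simp: complexification_conj_def)
    have "w \<oplus>\<^bsub>M\<^esub> w = \<zero>\<^bsub>M\<^esub>" using vw(2) M.r_neg[OF vw(4)] by simp
    then have "2 \<odot>\<^bsub>M\<^esub> w = \<zero>\<^bsub>M\<^esub>" using M.smult_l_distr[OF vw(4), of 1 1] vw(4) by simp
    then have "w = \<zero>\<^bsub>M\<^esub>" using M.smult_eq_zero[OF vw(4), of 2] by simp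
    then show "F (fst (G x), \<zero>\<^bsub>M\<^esub>) = x" using G(3)[OF x(1)] vw(1) by simp
  next
    fix m assume "m \<in> carrier M"
    then show "fst (G (F (m, \<zero>\<^bsub>M\<^esub>))) = m" using G(2)[of "(m, \<zero>\<^bsub>M\<^esub>)"] by simp
  qed
  ultimately show ?thesis using that by blast
qed

lemma fixed_decompose:
  assumes \<sigma>: "\<sigma> \<in> alg_hom L (twist_scalars cnj L)" and inv: "\<And>x. x \<in> carrier L \<Longrightarrow> \<sigma> (\<sigma> x) = x"
    and x: "x \<in> carrier L"
  obtains u v where "u \<in> carrier L" "\<sigma> u = u" "v \<in> carrier L" "\<sigma> v = v" "x = u \<oplus> \<i> \<odot> v"
proof -
  note sc = semilinear_closed[OF \<sigma>] and ss = semilinear_simps[OF \<sigma>]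
  \<comment> \<open>Real and imaginary part of x for the conjugation \<sigma>; \<open>?v\<close> is
    (x - \<sigma> x) / (2 \<i>).\<close>
  let ?u = "(1/2) \<odot> (x \<oplus> \<sigma> x)" and ?v = "(- \<i>/2) \<odot> x \<oplus> (\<i>/2) \<odot> \<sigma> x"
  have "?u \<oplus> \<i> \<odot> ?v = ((1/2) \<odot> x \<oplus> (1/2) \<odot> x) \<oplus> ((1/2) \<odot> \<sigma> x \<oplus> (- 1/2) \<odot> \<sigma> x)"
    using x sc by (simp add: smult_r_distr smult_assoc a_ac)
  also have "\<dots> = x"
    using x sc smult_l_distr[of x "1/2" "1/2"] smult_l_distr[of "\<sigma> x" "1/2" "- 1/2"] by simp
  finally have "x = ?u \<oplus> \<i> \<odot> ?v" by simp
  moreover have "?u \<in> carrier L" "?v \<in> carrier L" using x sc by auto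
  moreover have "\<sigma> ?u = ?u" "\<sigma> ?v = ?v" using x sc by (simp_all add: ss inv a_comm)
  ultimately show ?thesis using that by blast
qed

lemma fixed_decompose_unique:
  assumes \<sigma>: "\<sigma> \<in> alg_hom L (twist_scalars cnj L)"
    and u: "u \<in> carrier L" "\<sigma> u = u" "v \<in> carrier L" "\<sigma> v = v"
    and u': "u' \<in> carrier L" "\<sigma> u' = u'" "v' \<in> carrier L" "\<sigma> v' = v'"
    and eq: "u \<oplus> \<i> \<odot> v = u' \<oplus> \<i> \<odot> v'"
  shows "u = u'" "v = v'"
proof -
  note ss = semilinear_simps[OF \<sigma>]
  have 1: "x \<oplus> \<i> \<odot> y \<oplus> \<sigma> (x \<oplus> \<i> \<odot> y) = 2 \<odot> x"
    if "x \<in> carrier L" "\<sigma> x = x" "y \<in> carrier L" "\<sigma> y = y" for x y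
  proof -
    have "x \<oplus> \<i> \<odot> y \<oplus> \<sigma> (x \<oplus> \<i> \<odot> y) = (x \<oplus> x) \<oplus> (\<i> \<odot> y \<oplus> (- \<i>) \<odot> y)"
      using that by (simp add: ss a_ac)
    also have "\<dots> = 2 \<odot> x"
      using that smult_l_distr[of x 1 1] smult_l_distr[of y \<i> "- \<i>"] by simp
    finally show ?thesis .
  qed
  have "2 \<odot> u = 2 \<odot> u'" using 1[OF u] 1[OF u'] eq by simp
  then have "(1/2) \<odot> (2 \<odot> u) = (1/2) \<odot> (2 \<odot> u')" by simp
  then show "u = u'" using u u' by (simp add: smult_assoc)
  then have "\<i> \<odot> v = \<i> \<odot> v'" using eq u u' by simp
  then have "(- \<i>) \<odot> (\<i> \<odot> v) = (- \<i>) \<odot> (\<i> \<odot> v')" by simp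
  then show "v = v'" using u u' by (simp add: smult_assoc)
qed

text \<open>Extension by g (u + \<i> v) = h u + \<i> h v. It turns a real homomorphism of real forms
  into a complex one that intertwines the conjugations.\<close>

lemma extend_fixed_hom:
  assumes \<sigma>: "\<sigma> \<in> alg_hom L (twist_scalars cnj L)" "\<And>x. x \<in> carrier L \<Longrightarrow> \<sigma> (\<sigma> x) = x"
    and \<sigma>': "\<sigma>' \<in> alg_hom L (twist_scalars cnj L)"
    and h: "h \<in> alg_hom (fixed_alg \<sigma>) (fixed_alg \<sigma>')"
  obtains g where "g \<in> alg_hom L L" "\<And>x. x \<in> carrier L \<Longrightarrow> \<sigma>' (g x) = g (\<sigma> x)"
    "\<And>u. u \<in> carrier L \<Longrightarrow> \<sigma> u = u \<Longrightarrow> g u = h u"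
proof -
  note sc = semilinear_closed[OF \<sigma>(1)] and ss = semilinear_simps[OF \<sigma>(1)] and ss' = semilinear_simps[OF \<sigma>']
  define F where "F = {u \<in> carrier L. \<sigma> u = u}"
  have Fc: "u \<in> carrier L" if "u \<in> F" for u using that by (simp add: F_def)
  have Fops: "u \<oplus> v \<in> F" "u \<otimes> v \<in> F" if "u \<in> F" "v \<in> F" for u v
    using that by (simp_all add: F_def ss)
  have Fscale: "complex_of_real a \<odot> u \<in> F" if "u \<in> F" for u a
    using that by (simp add: F_def ss)
  have hc: "h u \<in> carrier L" "\<sigma>' (h u) = h u" if "u \<in> F" for u
    using alg_homD(1)[OF h, of u] that by (simp_all add: F_def)
  have h2: "h (u \<oplus> v) = h u \<oplus> h v" "h (u \<otimes> v) = h u \<otimes> h v"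
    if "u \<in> F" "v \<in> F" for u v
    using alg_homD(2,4)[OF h, of u] that by (simp_all add: F_def)
  have hscale: "h (complex_of_real a \<odot> u) = complex_of_real a \<odot> h u" if "u \<in> F" for u a
    using alg_homD(3)[OF h, of u] that by (simp add: F_def)
  have h0: "h \<zero> = \<zero>" "\<zero> \<in> F"
  proof -
    show z: "\<zero> \<in> F" using semilinear_zero[OF field_hom_simps(2) \<sigma>(1)] by (simp add: F_def)
    show "h \<zero> = \<zero>" using hscale[OF z, of 0] hc[OF z] by simp
  qed
  have ex: "\<exists>u v. u \<in> F \<and> v \<in> F \<and> x = u \<oplus> \<i> \<odot> v" if "x \<in> carrier L" for x
  proof (rule fixed_decompose[OF \<sigma> that])
    fix u v assume "u \<in> carrier L" "\<sigma> u = u" "v \<in> carrier L" "\<sigma> v = v" and x: "x = u \<oplus> \<i> \<odot> v"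
    then have "u \<in> F" "v \<in> F" by (simp_all add: F_def)
    with x show ?thesis by blast
  qed
  define g where "g x = (THE y. \<exists>u v. u \<in> F \<and> v \<in> F \<and> x = u \<oplus> \<i> \<odot> v \<and> y = h u \<oplus> \<i> \<odot> h v)" for x
  have guv: "g (u \<oplus> \<i> \<odot> v) = h u \<oplus> \<i> \<odot> h v" if uv: "u \<in> F" "v \<in> F" for u v
    unfolding g_def
  proof (rule the_equality)
    fix y assume "\<exists>u' v'. u' \<in> F \<and> v' \<in> F \<and> u \<oplus> \<i> \<odot> v = u' \<oplus> \<i> \<odot> v' \<and> y = h u' \<oplus> \<i> \<odot> h v'"
    then obtain u' v' where y: "u' \<in> F" "v' \<in> F" "u \<oplus> \<i> \<odot> v = u' \<oplus> \<i> \<odot> v'" "y = h u' \<oplus> \<i> \<odot> h v'"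
      by blast
    then have "u = u'" "v = v'"
      using fixed_decompose_unique[OF \<sigma>(1) _ _ _ _ _ _ _ _ y(3)] uv by (auto simp: F_def)
    then show "y = h u \<oplus> \<i> \<odot> h v" using y(4) by simp
  qed (use uv in blast)
  have "g \<in> alg_hom L L"
  proof (rule alg_homI)
    fix x y and a :: complex assume "x \<in> carrier L"
    then obtain u v where x: "u \<in> F" "v \<in> F" "x = u \<oplus> \<i> \<odot> v" using ex by blast
    note c = Fc[OF x(1)] Fc[OF x(2)] hc(1)[OF x(1)] hc(1)[OF x(2)]
    show "g x \<in> carrier L" unfolding x(3) guv[OF x(1,2)] using c by simp
    show "g (a \<odot> x) = a \<odot> g x"
    proof -
      \<comment> \<open>\<open>h\<close> is only real linear, so the scalars must appear as
        \<open>complex_of_real\<close>, signs included, before it can be applied.\<close>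
      let ?p = "complex_of_real (Re a)" and ?q = "complex_of_real (Im a)" and ?q' = "complex_of_real (- Im a)"
      have scal: "a \<odot> (s \<oplus> \<i> \<odot> t) =
          (?p \<odot> s \<oplus> ?q' \<odot> t) \<oplus> \<i> \<odot> (?p \<odot> t \<oplus> ?q \<odot> s)"
        if "s \<in> carrier L" "t \<in> carrier L" for s t
      proof -
        have "a \<odot> (s \<oplus> \<i> \<odot> t) = (?p + \<i> * ?q) \<odot> (s \<oplus> \<i> \<odot> t)"
          using complex_eq[of a] by simp
        also have "\<dots> = (?p \<odot> s \<oplus> ?q' \<odot> t) \<oplus> \<i> \<odot> (?p \<odot> t \<oplus> ?q \<odot> s)"
          using that by (simp add: smult_l_distr smult_r_distr smult_assoc a_ac smult_diff
              mult.commute mult.left_commute distrib_left)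
        finally show ?thesis .
      qed
      have "?p \<odot> u \<oplus> ?q' \<odot> v \<in> F" "?p \<odot> v \<oplus> ?q \<odot> u \<in> F"
        by (intro Fops(1) Fscale x(1,2))+
      note gg = guv[OF this]
      have "g (a \<odot> x) = h (?p \<odot> u \<oplus> ?q' \<odot> v) \<oplus> \<i> \<odot> h (?p \<odot> v \<oplus> ?q \<odot> u)"
        unfolding x(3) scal[OF c(1,2)] by (rule gg)
      also have "\<dots> = (?p \<odot> h u \<oplus> ?q' \<odot> h v) \<oplus> \<i> \<odot> (?p \<odot> h v \<oplus> ?q \<odot> h u)"
        by (simp only: h2 hscale Fscale x(1,2))
      also have "\<dots> = a \<odot> g x" unfolding x(3) guv[OF x(1,2)] scal[OF c(3,4)] ..
      finally show ?thesis .
    qed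
    assume "y \<in> carrier L"
    then obtain u' v' where y: "u' \<in> F" "v' \<in> F" "y = u' \<oplus> \<i> \<odot> v'" using ex by blast
    note c' = Fc[OF y(1)] Fc[OF y(2)] hc(1)[OF y(1)] hc(1)[OF y(2)]
    have "x \<oplus> y = (u \<oplus> u') \<oplus> \<i> \<odot> (v \<oplus> v')"
      using c c' by (simp add: x(3) y(3) smult_r_distr a_ac)
    then show "g (x \<oplus> y) = g x \<oplus> g y"
      using guv[OF Fops(1)[OF x(1) y(1)] Fops(1)[OF x(2) y(2)]] x y guv[OF x(1,2)] guv[OF y(1,2)] c c'
      by (simp add: h2 smult_r_distr a_ac)
    have mult: "(s \<oplus> \<i> \<odot> t) \<otimes> (s' \<oplus> \<i> \<odot> t') =
        (s \<otimes> s' \<oplus> complex_of_real (- 1) \<odot> (t \<otimes> t')) \<oplus> \<i> \<odot> (s \<otimes> t' \<oplus> t \<otimes> s')"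
      if "s \<in> carrier L" "t \<in> carrier L" "s' \<in> carrier L" "t' \<in> carrier L" for s t s' t'
      using that by (simp add: mult_l_distr mult_r_distr mult_smult_l mult_smult_r
          smult_r_distr smult_assoc a_ac)
    have "u \<otimes> u' \<oplus> complex_of_real (- 1) \<odot> (v \<otimes> v') \<in> F" "u \<otimes> v' \<oplus> v \<otimes> u' \<in> F"
      by (intro Fops Fscale x(1,2) y(1,2))+
    note gg = guv[OF this]
    have "g (x \<otimes> y) = h (u \<otimes> u' \<oplus> complex_of_real (- 1) \<odot> (v \<otimes> v')) \<oplus>
        \<i> \<odot> h (u \<otimes> v' \<oplus> v \<otimes> u')"
      unfolding x(3) y(3) mult[OF c(1,2) c'(1,2)] by (rule gg)
    also have "\<dots> = (h u \<otimes> h u' \<oplus> complex_of_real (- 1) \<odot> (h v \<otimes> h v')) \<oplus>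
        \<i> \<odot> (h u \<otimes> h v' \<oplus> h v \<otimes> h u')"
      by (simp only: h2 hscale Fops Fscale x(1,2) y(1,2))
    also have "\<dots> = g x \<otimes> g y"
      unfolding x(3) y(3) guv[OF x(1,2)] guv[OF y(1,2)] mult[OF c(3,4) c'(3,4)] ..
    finally show "g (x \<otimes> y) = g x \<otimes> g y" .
  qed
  moreover have "\<sigma>' (g x) = g (\<sigma> x)" if "x \<in> carrier L" for x
  proof -
    obtain u v where x: "u \<in> F" "v \<in> F" "x = u \<oplus> \<i> \<odot> v" using ex[OF \<open>x \<in> carrier L\<close>] by blast
    let ?w = "complex_of_real (- 1) \<odot> v"
    have w: "?w \<in> F" by (rule Fscale[OF x(2)])
    note c = Fc[OF x(1)] Fc[OF x(2)] hc[OF x(1)] hc[OF x(2)]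
    have "\<sigma> x = u \<oplus> \<i> \<odot> ?w"
      using x c by (simp add: F_def ss smult_assoc)
    then have "g (\<sigma> x) = h u \<oplus> \<i> \<odot> (complex_of_real (- 1) \<odot> h v)"
      using guv[OF x(1) w] hscale[OF x(2), of "- 1"] by simp
    moreover have "\<sigma>' (g x) = h u \<oplus> (- \<i>) \<odot> h v"
      unfolding x(3) guv[OF x(1,2)] using c by (simp add: ss')
    ultimately show ?thesis using c by (simp add: smult_assoc)
  qed
  moreover have "g u = h u" if "u \<in> carrier L" "\<sigma> u = u" for u
    using guv[of u "\<zero>"] h0 that hc[of u] by (simp add: F_def)
  ultimately show ?thesis using that by blast
qed

lemma extend_fixed_iso:
  assumes \<sigma>: "\<sigma> \<in> alg_hom L (twist_scalars cnj L)" "\<And>x. x \<in> carrier L \<Longrightarrow> \<sigma> (\<sigma> x) = x"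
    and \<sigma>': "\<sigma>' \<in> alg_hom L (twist_scalars cnj L)" "\<And>x. x \<in> carrier L \<Longrightarrow> \<sigma>' (\<sigma>' x) = x"
    and h: "h \<in> alg_hom (fixed_alg \<sigma>) (fixed_alg \<sigma>')" and h': "h' \<in> alg_hom (fixed_alg \<sigma>') (fixed_alg \<sigma>)"
    and h'h: "\<And>x. x \<in> carrier (fixed_alg \<sigma>) \<Longrightarrow> h' (h x) = x"
    and hh': "\<And>x. x \<in> carrier (fixed_alg \<sigma>') \<Longrightarrow> h (h' x) = x"
  obtains g g' where "g \<in> alg_hom L L" "g' \<in> alg_hom L L" "\<And>x. x \<in> carrier L \<Longrightarrow> \<sigma>' (g x) = g (\<sigma> x)"
    "\<And>x. x \<in> carrier L \<Longrightarrow> g' (g x) = x" "\<And>x. x \<in> carrier L \<Longrightarrow> g (g' x) = x"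
proof -
  obtain g where g: "g \<in> alg_hom L L" "\<And>x. x \<in> carrier L \<Longrightarrow> \<sigma>' (g x) = g (\<sigma> x)"
    "\<And>u. u \<in> carrier L \<Longrightarrow> \<sigma> u = u \<Longrightarrow> g u = h u" using extend_fixed_hom[OF \<sigma> \<sigma>'(1) h] by blast
  obtain g' where g': "g' \<in> alg_hom L L" "\<And>x. x \<in> carrier L \<Longrightarrow> \<sigma> (g' x) = g' (\<sigma>' x)"
    "\<And>u. u \<in> carrier L \<Longrightarrow> \<sigma>' u = u \<Longrightarrow> g' u = h' u" using extend_fixed_hom[OF \<sigma>' \<sigma>(1) h'] by blast
  \<comment> \<open>The fixed points of a conjugation span the algebra over the complex numbers, so
    it is enough to know the composite there.\<close>
  have comp: "k' (k x) = x"
    if \<rho>: "\<rho> \<in> alg_hom L (twist_scalars cnj L)" "\<And>x. x \<in> carrier L \<Longrightarrow> \<rho> (\<rho> x) = x"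
      and k: "k \<in> alg_hom L L" "k' \<in> alg_hom L L"
      and fix_: "\<And>u. u \<in> carrier L \<Longrightarrow> \<rho> u = u \<Longrightarrow> k' (k u) = u" and x: "x \<in> carrier L" for \<rho> k k' x
  proof -
    obtain u v where uv: "u \<in> carrier L" "\<rho> u = u" "v \<in> carrier L" "\<rho> v = v" "x = u \<oplus> \<i> \<odot> v"
      using fixed_decompose[OF \<rho> x] by blast
    have "k' (k x) = k' (k u) \<oplus> \<i> \<odot> k' (k v)"
      using uv by (simp add: alg_homD[OF k(1)] alg_homD[OF k(2)])
    then show ?thesis using fix_ uv by simp
  qed
  have "g' (g u) = u" if "u \<in> carrier L" "\<sigma> u = u" for u
    using that g(3) g'(3)[of "h u"] h'h[of u] alg_homD(1)[OF h, of u] by simp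
  from comp[OF \<sigma> g(1) g'(1) this] have 1: "\<And>x. x \<in> carrier L \<Longrightarrow> g' (g x) = x" .
  have "g (g' u) = u" if "u \<in> carrier L" "\<sigma>' u = u" for u
    using that g'(3) g(3)[of "h' u"] hh'[of u] alg_homD(1)[OF h', of u] by simp
  from comp[OF \<sigma>' g'(1) g(1) this] have 2: "\<And>x. x \<in> carrier L \<Longrightarrow> g (g' x) = x" .
  show ?thesis using that[OF g(1) g'(1) g(2) 1 2] .
qed

end

subsection \<open>Grading derivations\<close>

locale nilpotent_complex_lie = complex_lie +
  fixes c :: nat
  assumes nilpotent: "lower_central L (c + 1) \<subseteq> {\<zero>}"
begin

lemma lower_top: "k \<ge> c + 1 \<Longrightarrow> x \<in> lower k \<Longrightarrow> x = \<zero>"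
  using nilpotent lower_central_antimono[of "c + 1" k] by auto

text \<open>A derivation that is the identity modulo commutators; its eigenvalue m marks degree m. A
  derivation is used in place of a direct sum decomposition because the defining conditions are
  affine in \<delta>, so such derivations can be averaged.\<close>

definition grading :: "('a \<Rightarrow> 'a) \<Rightarrow> bool" where
  "grading \<delta> \<longleftrightarrow> (\<forall>x\<in>carrier L. \<delta> x \<in> carrier L) \<and>
     (\<forall>x\<in>carrier L. \<forall>y\<in>carrier L. \<delta> (x \<oplus> y) = \<delta> x \<oplus> \<delta> y) \<and>
     (\<forall>a. \<forall>x\<in>carrier L. \<delta> (a \<odot> x) = a \<odot> \<delta> x) \<and>
     (\<forall>x\<in>carrier L. \<forall>y\<in>carrier L. \<delta> (x \<otimes> y) = \<delta> x \<otimes> y \<oplus> x \<otimes> \<delta> y) \<and>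
     (\<forall>x\<in>carrier L. \<delta> x \<ominus> x \<in> lower 2)"

lemma gradingD:
  assumes "grading \<delta>" "x \<in> carrier L"
  shows "\<delta> x \<in> carrier L" "y \<in> carrier L \<Longrightarrow> \<delta> (x \<oplus> y) = \<delta> x \<oplus> \<delta> y"
    "\<delta> (a \<odot> x) = a \<odot> \<delta> x"
    "y \<in> carrier L \<Longrightarrow> \<delta> (x \<otimes> y) = \<delta> x \<otimes> y \<oplus> x \<otimes> \<delta> y"
    "\<delta> x \<ominus> x \<in> lower 2"
  using assms by (auto simp: grading_def)

lemma lower_in_carrier: "x \<in> lower k \<Longrightarrow> x \<in> carrier L"
  by (rule lower_central_closed)

lemmas lower_closed = subspace_ofD(2,3,4)[OF lower_central_subspace]

lemma lower_diff: "x \<in> lower k \<Longrightarrow> y \<in> lower k \<Longrightarrow> x \<ominus> y \<in> lower k"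
  by (rule subspace_diff[OF lower_central_subspace])

text \<open>\<sigma> \<delta> \<sigma> is again a complex linear derivation, as \<sigma> is
  antilinear and used twice, and it satisfies the same conditions; its mean with \<delta> commutes
  with \<sigma>.\<close>

lemma grading_average:
  assumes \<delta>: "grading \<delta>" and \<sigma>: "\<sigma> \<in> alg_hom L (twist_scalars cnj L)"
    and inv: "\<And>x. x \<in> carrier L \<Longrightarrow> \<sigma> (\<sigma> x) = x"
  obtains \<epsilon> where "grading \<epsilon>" "\<And>x. x \<in> carrier L \<Longrightarrow> \<sigma> (\<epsilon> x) = \<epsilon> (\<sigma> x)"
proof -
  note d = gradingD[OF \<delta>] and s = semilinear_closed[OF \<sigma>] and h = semilinear_simps[OF \<sigma>]
  define \<epsilon> where "\<epsilon> x = (1/2) \<odot> (\<delta> x \<oplus> \<sigma> (\<delta> (\<sigma> x)))" for x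
  have "\<sigma> (\<epsilon> x) = \<epsilon> (\<sigma> x)" if "x \<in> carrier L" for x
    using that by (simp add: \<epsilon>_def h d s inv a_comm)
  moreover have "grading \<epsilon>"
    unfolding grading_def
  proof (intro conjI ballI allI)
    fix x y a assume x: "x \<in> carrier L"
    then show "\<epsilon> x \<in> carrier L" by (simp add: \<epsilon>_def d s)
    show "\<epsilon> (a \<odot> x) = a \<odot> \<epsilon> x"
      using x by (simp add: \<epsilon>_def h d s smult_r_distr smult_assoc)
    have "\<sigma> (\<delta> (\<sigma> x)) \<ominus> x = \<sigma> (\<delta> (\<sigma> x) \<ominus> \<sigma> x)"
      using x by (simp add: minus_conv h d s inv)
    also have "\<dots> \<in> lower 2" using x d s by (intro semilinear_lower[OF field_hom_simps(2) \<sigma>]) auto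
    finally have 2: "\<sigma> (\<delta> (\<sigma> x)) \<ominus> x \<in> lower 2" .
    have "\<epsilon> x \<ominus> x = (1/2) \<odot> ((\<delta> x \<ominus> x) \<oplus> (\<sigma> (\<delta> (\<sigma> x)) \<ominus> x))"
    proof -
      have "(1/2) \<odot> ((\<delta> x \<ominus> x) \<oplus> (\<sigma> (\<delta> (\<sigma> x)) \<ominus> x)) =
        \<epsilon> x \<oplus> ((- 1/2) \<odot> x \<oplus> (- 1/2) \<odot> x)"
        using x by (simp add: \<epsilon>_def h d s minus_conv smult_r_distr smult_assoc a_ac)
      also have "(- 1/2) \<odot> x \<oplus> (- 1/2) \<odot> x = (- 1) \<odot> x"
        using x smult_l_distr[of x "- 1/2" "- 1/2"] by simp
      finally show ?thesis using x by (simp add: \<epsilon>_def d s minus_conv)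
    qed
    also have "\<dots> \<in> lower 2" using 2 d(5)[OF x] lower_closed by simp
    finally show "\<epsilon> x \<ominus> x \<in> lower 2" .
    assume y: "y \<in> carrier L"
    show "\<epsilon> (x \<oplus> y) = \<epsilon> x \<oplus> \<epsilon> y"
      using x y by (simp add: \<epsilon>_def h d s smult_r_distr a_ac)
    show "\<epsilon> (x \<otimes> y) = \<epsilon> x \<otimes> y \<oplus> x \<otimes> \<epsilon> y"
      using x y by (simp add: \<epsilon>_def h d s inv smult_r_distr mult_l_distr mult_r_distr
          mult_smult_l mult_smult_r a_ac)
  qed
  ultimately show ?thesis using that by blast
qed

text \<open>By the Leibniz rule the eigenvalues 1 of x and i of y add up on the bracket. The
  deviation \<delta> x - x is a commutator, so \<open>mult_lower_central_2\<close> pushes its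
  contribution one term further down.\<close>

lemma grading_lower:
  assumes \<delta>: "grading \<delta>" and "i \<ge> 1" "x \<in> lower i"
  shows "\<delta> x \<ominus> of_nat i \<odot> x \<in> lower (Suc i)"
  using assms(2,3)
proof (induction i arbitrary: x rule: dec_induct)
  case base
  then show ?case using gradingD(5)[OF \<delta>, of x] by (simp add: numeral_2_eq_2)
next
  case (step i)
  note d = gradingD[OF \<delta>]
  let ?U = "{x \<in> carrier L. \<delta> x \<ominus> of_nat (Suc i) \<odot> x \<in> lower (Suc (Suc i))}"
  have z: "\<delta> \<zero> = \<zero>" using d(3)[of "\<zero>" 0] d(1) by simp
  have "lower (Suc i) \<subseteq> ?U"
  proof (rule lower_central_Suc_subset[OF step(1)])
    show "subspace_of L ?U"
    proof (rule subspace_ofI)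
      fix x y a assume x: "x \<in> ?U"
      have "\<delta> (a \<odot> x) \<ominus> of_nat (Suc i) \<odot> (a \<odot> x) = a \<odot> (\<delta> x \<ominus> of_nat (Suc i) \<odot> x)"
        using x by (simp add: d minus_conv smult_r_distr smult_assoc mult.commute del: of_nat_Suc)
      then show "a \<odot> x \<in> ?U" using x lower_closed by (simp del: of_nat_Suc)
      assume y: "y \<in> ?U"
      have "\<delta> (x \<oplus> y) \<ominus> of_nat (Suc i) \<odot> (x \<oplus> y) =
          (\<delta> x \<ominus> of_nat (Suc i) \<odot> x) \<oplus> (\<delta> y \<ominus> of_nat (Suc i) \<odot> y)"
        using x y by (simp add: d minus_conv smult_r_distr a_ac del: of_nat_Suc)
      then show "x \<oplus> y \<in> ?U" using x y lower_closed by (simp del: of_nat_Suc)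
    qed (use lower_closed z in \<open>auto simp: minus_conv\<close>)
    fix x y assume x: "x \<in> carrier L" and y: "y \<in> lower i"
    have yc: "y \<in> carrier L" using y by (rule lower_in_carrier)
    have "\<delta> (x \<otimes> y) \<ominus> of_nat (Suc i) \<odot> (x \<otimes> y) =
        (\<delta> x \<ominus> x) \<otimes> y \<oplus> x \<otimes> (\<delta> y \<ominus> of_nat i \<odot> y)"
      using x yc by (simp add: d minus_conv mult_l_distr mult_r_distr mult_smult_l
          mult_smult_r smult_assoc smult_r_distr smult_l_distr smult_diff a_ac)
    also have "\<dots> \<in> lower (Suc (Suc i))"
      using mult_lower_central_2[OF step(1) d(5)[OF x] y]
        mult_lower_central[OF _ x step.IH[OF y]] by (intro lower_closed(2)) simp_all
    finally show "x \<otimes> y \<in> ?U" using x yc by simp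
  qed
  then show ?case using step.prems by blast
qed

text \<open>On the factor of index j the derivation acts as j, which differs from m for every j
  \<ge> k. Hence z sinks from each term of the series into the next, down to zero.\<close>

lemma grading_eigen_zero:
  assumes \<delta>: "grading \<delta>" and z: "z \<in> lower k" "k \<ge> 1" and eig: "\<delta> z = of_nat m \<odot> z" "m < k"
  shows "z = \<zero>"
proof -
  have zc: "z \<in> carrier L" using z(1) by (rule lower_in_carrier)
  have "z \<in> lower j" if "j \<ge> k" for j
    using that
  proof (induction j rule: dec_induct)
    case (step j)
    have "\<delta> z \<ominus> of_nat j \<odot> z \<in> lower (Suc j)"
      using step z(2) by (intro grading_lower[OF \<delta>]) auto
    moreover have "\<delta> z \<ominus> of_nat j \<odot> z = (of_nat m - of_nat j) \<odot> z"
      using zc by (simp add: eig minus_conv smult_assoc smult_diff)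
    ultimately have "inverse (of_nat m - of_nat j) \<odot> ((of_nat m - of_nat j) \<odot> z) \<in> lower (Suc j)"
      using lower_closed(3) by simp
    moreover have "(of_nat m :: complex) - of_nat j \<noteq> 0"
      using eig(2) step(1) by simp
    ultimately show ?case using zc by (simp add: smult_assoc)
  qed (rule z(1))
  \<comment> \<open>The maximum meets both demands: at least k for the induction, at least c + 1 for
    nilpotency.\<close>
  from this[of "max k (c + 1)"] show ?thesis by (intro lower_top[of "max k (c + 1)"]) auto
qed

lemma grading_diff:
  assumes "grading \<delta>" "x \<in> carrier L" "y \<in> carrier L"
  shows "\<delta> (x \<ominus> y) = \<delta> x \<ominus> \<delta> y"
  using assms(2,3) by (simp add: minus_conv gradingD[OF assms(1)])

lemma degree_one_unique:
  assumes \<delta>: "grading \<delta>" and u: "u \<in> carrier L" "\<delta> u = u" and v: "v \<in> carrier L" "\<delta> v = v"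
    and "u \<ominus> v \<in> lower 2"
  shows "u = v"
proof -
  have "\<delta> (u \<ominus> v) = of_nat 1 \<odot> (u \<ominus> v)" using u v by (simp add: grading_diff[OF \<delta>])
  then have "u \<ominus> v = \<zero>" using assms(6) by (intro grading_eigen_zero[OF \<delta>, of _ 2 1]) auto
  then show ?thesis using u v eq_iff_diff[of u v] by simp
qed

text \<open>Successive approximation along the lower central series: each correction moves the
  defect \<delta> u - u one term further, until nilpotency makes it zero.\<close>

lemma degree_one_exists:
  assumes \<delta>: "grading \<delta>" and x: "x \<in> carrier L"
  shows "\<exists>u\<in>carrier L. \<delta> u = u \<and> u \<ominus> x \<in> lower 2"
proof -
  note d = gradingD[OF \<delta>]
  have "\<exists>u\<in>carrier L. u \<ominus> x \<in> lower 2 \<and> \<delta> u \<ominus> u \<in> lower (Suc j)" if "j \<ge> 1" for j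
    using that
  proof (induction j rule: dec_induct)
    case base
    have "x \<ominus> x \<in> lower 2" using x lower_closed(1) by (simp add: minus_eq r_neg)
    then show ?case using d(5)[OF x] x by (intro bexI[of _ x]) (simp_all add: numeral_2_eq_2)
  next
    case (step j)
    then obtain u where u: "u \<in> carrier L" "u \<ominus> x \<in> lower 2" "\<delta> u \<ominus> u \<in> lower (Suc j)" by blast
    define e where "e = \<delta> u \<ominus> u"
    have e: "e \<in> lower (Suc j)" "e \<in> carrier L" using u d by (auto simp: e_def)
    have j: "of_nat j \<noteq> (0::complex)" using step(1) by simp
    \<comment> \<open>On this factor \<delta> multiplies e by j + 1, so \<delta> - 1 multiplies it
      by j. Adding -e / j to u therefore cancels the defect e up to the remainder
      \<open>?r\<close>.\<close>
    let ?r = "\<delta> e \<ominus> of_nat (Suc j) \<odot> e" and ?b = "- 1 / of_nat j :: complex"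
    have r: "?r \<in> lower (Suc (Suc j))" using e by (intro grading_lower[OF \<delta>]) auto
    let ?u = "u \<oplus> ?b \<odot> e"
    have "e \<in> lower 2" using e(1) lower_central_antimono[of 2 "Suc j"] step(1) by auto
    then have "(u \<ominus> x) \<oplus> ?b \<odot> e \<in> lower 2" using u lower_closed by blast
    then have "?u \<ominus> x \<in> lower 2" using u e x by (simp add: minus_eq a_ac)
    moreover have "\<delta> ?u \<ominus> ?u = ?b \<odot> ?r"
    proof -
      have b: "?b * (- of_nat (Suc j)) = 1 + (- ?b)" using j by (simp add: field_simps)
      have "\<delta> ?u \<ominus> ?u = (\<delta> u \<ominus> u) \<oplus> (?b \<odot> \<delta> e \<oplus> (- ?b) \<odot> e)"
        using u(1) e(2) by (simp add: d minus_conv smult_r_distr smult_assoc a_ac)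
      also have "\<dots> = ?b \<odot> \<delta> e \<oplus> (1 \<odot> e \<oplus> (- ?b) \<odot> e)"
        using e(2) d(1)[OF e(2)] by (simp add: e_def[symmetric] a_lcomm)
      also have "1 \<odot> e \<oplus> (- ?b) \<odot> e = (?b * (- of_nat (Suc j))) \<odot> e"
        unfolding b using smult_l_distr[OF e(2), of 1 "- ?b"] by simp
      also have "?b \<odot> \<delta> e \<oplus> (?b * (- of_nat (Suc j))) \<odot> e = ?b \<odot> ?r"
        using e(2) d(1)[OF e(2)] by (simp add: minus_conv smult_r_distr smult_assoc del: of_nat_Suc)
      finally show ?thesis .
    qed
    moreover have "?b \<odot> ?r \<in> lower (Suc (Suc j))" using r by (rule lower_closed(3))
    ultimately show ?case using u e by (intro bexI[of _ ?u]) auto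
  qed
  from this[of "c + 1"] obtain u where u: "u \<in> carrier L" "u \<ominus> x \<in> lower 2" "\<delta> u \<ominus> u \<in> lower (Suc (c + 1))"
    by auto
  then have "\<delta> u \<ominus> u = \<zero>" using lower_top[of "Suc (c + 1)"] by simp
  then have "\<delta> u = u" using u d(1) eq_iff_diff[of "\<delta> u" u] by simp
  with u show ?thesis by blast
qed

subsection \<open>Unipotent endomorphisms\<close>

text \<open>Multiplicative counterpart of \<open>grading_lower\<close>: on a bracket the deviation
  from the identity splits into one term for each factor, and both lie deep enough.\<close>

lemma unipotent_lower:
  assumes h: "h \<in> alg_hom L L" and un: "\<And>x. x \<in> carrier L \<Longrightarrow> h x \<ominus> x \<in> lower 2"
    and "i \<ge> 1" "x \<in> lower i"
  shows "h x \<ominus> x \<in> lower (Suc i)"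
  using assms(3,4)
proof (induction i arbitrary: x rule: dec_induct)
  case base
  then show ?case using un[of x] by (simp add: numeral_2_eq_2)
next
  case (step i)
  note H = alg_homD[OF h]
  let ?U = "{x \<in> carrier L. h x \<ominus> x \<in> lower (Suc (Suc i))}"
  have z: "h \<zero> = \<zero>" using alg_hom_zero[OF nonassoc_algebra_axioms nonassoc_algebra_axioms h] .
  have "lower (Suc i) \<subseteq> ?U"
  proof (rule lower_central_Suc_subset[OF step(1)])
    show "subspace_of L ?U"
    proof (rule subspace_ofI)
      fix x y a assume x: "x \<in> ?U"
      have "h (a \<odot> x) \<ominus> a \<odot> x = a \<odot> (h x \<ominus> x)"
        using x by (simp add: H minus_conv smult_r_distr smult_assoc)
      then show "a \<odot> x \<in> ?U" using x lower_closed by simp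
      assume y: "y \<in> ?U"
      have "h (x \<oplus> y) \<ominus> (x \<oplus> y) = (h x \<ominus> x) \<oplus> (h y \<ominus> y)"
        using x y by (simp add: H minus_conv smult_r_distr a_ac)
      then show "x \<oplus> y \<in> ?U" using x y lower_closed by simp
    qed (use lower_closed z in \<open>auto simp: minus_conv\<close>)
    fix x y assume x: "x \<in> carrier L" and y: "y \<in> lower i"
    have yc: "y \<in> carrier L" using y by (rule lower_in_carrier)
    have "(h x \<ominus> x) \<otimes> h y \<oplus> x \<otimes> (h y \<ominus> y) =
        h x \<otimes> h y \<oplus> ((- 1) \<odot> (x \<otimes> h y) \<oplus> x \<otimes> h y) \<oplus> (- 1) \<odot> (x \<otimes> y)"
      using x yc H(1) by (simp add: minus_conv mult_l_distr mult_r_distr mult_smult_l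
          mult_smult_r a_assoc)
    also have "(- 1) \<odot> (x \<otimes> h y) \<oplus> x \<otimes> h y = \<zero>"
      using x yc H(1) by (simp add: smult_neg1 l_neg)
    finally have "h (x \<otimes> y) \<ominus> x \<otimes> y =
        (h x \<ominus> x) \<otimes> h y \<oplus> x \<otimes> (h y \<ominus> y)"
      using x yc H by (simp add: minus_conv)
    also have "\<dots> \<in> lower (Suc (Suc i))"
    proof (rule lower_closed(2))
      have "h x \<ominus> x \<in> lower 2" using un[OF x] .
      moreover have "h y \<in> lower i"
        using semilinear_lower[OF field_hom_simps(1), of h i y] h step(1) y by simp
      ultimately show "(h x \<ominus> x) \<otimes> h y \<in> lower (Suc (Suc i))"
        using mult_lower_central_2[OF step(1), of "h x \<ominus> x" "h y"] by simp
      show "x \<otimes> (h y \<ominus> y) \<in> lower (Suc (Suc i))"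
        using mult_lower_central[of "Suc i" x "h y \<ominus> y"] x step.IH[OF y] by simp
    qed
    finally show "x \<otimes> y \<in> ?U" using x yc by simp
  qed
  then show ?case using step.prems by blast
qed

text \<open>Both halves descend the lower central series in place of a dimension count: a difference
  with zero image sinks to zero, and preimages are approximated step by step.\<close>

lemma unipotent_bij:
  assumes h: "h \<in> alg_hom L L" and un: "\<And>x. x \<in> carrier L \<Longrightarrow> h x \<ominus> x \<in> lower 2"
  shows "inj_on h (carrier L)" "h ` carrier L = carrier L"
proof -
  note H = alg_homD[OF h]
  have un: "h x \<ominus> x \<in> lower (Suc i)" if "i \<ge> 1" "x \<in> lower i" for i x
    using unipotent_lower[OF h _ that] un by blast
  have hdiff: "h (x \<ominus> y) = h x \<ominus> h y" if "x \<in> carrier L" "y \<in> carrier L" for x y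
    using that H by (simp add: minus_conv)
  show "inj_on h (carrier L)"
  proof (rule inj_onI)
    fix x y assume x: "x \<in> carrier L" and y: "y \<in> carrier L" and eq: "h x = h y"
    let ?d = "x \<ominus> y"
    have dc: "?d \<in> carrier L" using x y by simp
    have hd: "h ?d = \<zero>" using x y eq H(1) hdiff eq_iff_diff[of "h x" "h y"] by simp
    have "?d \<in> lower j" if "j \<ge> 1" for j
      using that
    proof (induction j rule: dec_induct)
      case base
      show ?case using dc by (simp only: lower_central_1)
    next
      case (step j)
      have "h ?d \<ominus> ?d \<in> lower (Suc j)" using un[OF step(1) step(3)] .
      then have "(- 1) \<odot> (h ?d \<ominus> ?d) \<in> lower (Suc j)" by (rule lower_closed(3))
      moreover have "(- 1) \<odot> (h ?d \<ominus> ?d) = ?d"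
        unfolding hd using dc by (simp add: minus_conv[of "\<zero>" ?d] smult_assoc)
      ultimately show ?case by simp
    qed
    from this[of "c + 1"] have "?d = \<zero>" by (intro lower_top[of "c + 1"]) auto
    then show "x = y" using x y eq_iff_diff[of x y] by simp
  qed
  show "h ` carrier L = carrier L"
  proof (intro equalityI subsetI)
    fix y assume y: "y \<in> carrier L"
    have "\<exists>x\<in>carrier L. y \<ominus> h x \<in> lower j" if "j \<ge> 1" for j
      using that
    proof (induction j rule: dec_induct)
      case base
      show ?case using y H(1) by (intro bexI[of _ y]) auto
    next
      case (step j)
      then obtain x where x: "x \<in> carrier L" "y \<ominus> h x \<in> lower j" by blast
      \<comment> \<open>As \<open>h\<close> is close to the identity, the defect itself serves as
        the correction to x.\<close>
      let ?e = "y \<ominus> h x"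
      have e: "?e \<in> carrier L" using x y H(1) by simp
      have "y \<ominus> h (x \<oplus> ?e) = ?e \<ominus> h ?e"
        using x y e H by (simp add: minus_eq minus_add a_assoc)
      also have "\<dots> = (- 1) \<odot> (h ?e \<ominus> ?e)"
      proof -
        have "(- 1) \<odot> (p \<ominus> q) = q \<ominus> p" if "p \<in> carrier L" "q \<in> carrier L" for p q
          using that by (simp add: minus_conv smult_r_distr smult_assoc a_comm)
        then show ?thesis using e H(1) by simp
      qed
      also have "\<dots> \<in> lower (Suc j)" using un[OF step(1) x(2)] by (rule lower_closed(3))
      finally show ?case using x e by (intro bexI[of _ "x \<oplus> ?e"]) auto
    qed
    from this[of "c + 1"] obtain x where x: "x \<in> carrier L" "y \<ominus> h x \<in> lower (c + 1)" by auto
    then have "y = h x" using lower_top[of "c + 1" "y \<ominus> h x"] y H(1) eq_iff_diff[of y "h x"] by simp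
    then show "y \<in> h ` carrier L" using x by blast
  qed (use H(1) in blast)
qed

end

section \<open>Linear algebra of finitely supported functions\<close>

definition supported :: "'s set \<Rightarrow> ('s \<Rightarrow> 'k::zero) set" where
  "supported D = {x. \<forall>a. x a \<noteq> 0 \<longrightarrow> a \<in> D}"

definition unit_fun :: "'s \<Rightarrow> 's \<Rightarrow> 'k::zero_neq_one" where
  "unit_fun a = (\<lambda>s. if s = a then 1 else 0)"

lemma unit_fun_supported [simp]: "unit_fun a \<in> supported D \<longleftrightarrow> a \<in> D"
  by (auto simp: unit_fun_def supported_def)

lemma unit_fun_simps [simp]: "unit_fun a a = 1" "s \<noteq> a \<Longrightarrow> unit_fun a s = 0"
  by (auto simp: unit_fun_def)

lemma supportedD: "x \<in> supported D \<Longrightarrow> x a \<noteq> 0 \<Longrightarrow> a \<in> D" "x \<in> supported D \<Longrightarrow> a \<notin> D \<Longrightarrow> x a = 0"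
  by (auto simp: supported_def)

lemma supported_mono: "D \<subseteq> D' \<Longrightarrow> supported D \<subseteq> supported D'"
  by (auto simp: supported_def)

text \<open>Gaussian elimination by induction on the number of equations: a pivot removes one
  equation and one unknown.\<close>

lemma homogeneous_system:
  fixes M :: "'i \<Rightarrow> 't \<Rightarrow> 'k::field"
  assumes "finite T" "finite I" "card T < card I"
  obtains c where "\<exists>i\<in>I. c i \<noteq> 0" "\<And>t. t \<in> T \<Longrightarrow> (\<Sum>i\<in>I. c i * M i t) = 0"
proof -
  have "\<exists>c. (\<exists>i\<in>I. c i \<noteq> 0) \<and> (\<forall>t\<in>T. (\<Sum>i\<in>I. c i * M i t) = 0)"
    using assms
  proof (induction T arbitrary: I M rule: finite_induct)
    case empty
    then have "I \<noteq> {}" by auto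
    then show ?case by (intro exI[of _ "\<lambda>_. 1"]) auto
  next
    case (insert t T)
    show ?case
    proof (cases "\<forall>i\<in>I. M i t = 0")
      case True
      obtain c where c: "\<exists>i\<in>I. c i \<noteq> 0" "\<forall>t\<in>T. (\<Sum>i\<in>I. c i * M i t) = 0"
        using insert.IH[of I M] insert.prems insert.hyps by auto
      then show ?thesis using True by (intro exI[of _ c]) auto
    next
      case False
      then obtain j where j: "j \<in> I" "M j t \<noteq> 0" by blast
      \<comment> \<open>The unknown with index j is eliminated by means of equation t, whose
        coefficient there is nonzero.\<close>
      define M' where "M' i s = M i s - M i t / M j t * M j s" for i s
      have "card T < card (I - {j})" using insert j by (simp add: card_Diff_singleton)
      then obtain c where c: "\<exists>i\<in>I - {j}. c i \<noteq> 0" "\<forall>s\<in>T. (\<Sum>i\<in>I - {j}. c i * M' i s) = 0"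
        using insert.IH[of "I - {j}" M'] insert.prems by auto
      \<comment> \<open>The value of the eliminated unknown that makes equation t hold.\<close>
      define d where "d = - (\<Sum>i\<in>I - {j}. c i * (M i t / M j t))"
      have sum: "(\<Sum>i\<in>I. (if i = j then d else c i) * M i s) = (\<Sum>i\<in>I - {j}. c i * M' i s)" for s
      proof -
        have "(\<Sum>i\<in>I. (if i = j then d else c i) * M i s) =
            d * M j s + (\<Sum>i\<in>I - {j}. (if i = j then d else c i) * M i s)"
          using j insert.prems by (subst sum.remove[of _ j]) auto
        also have "(\<Sum>i\<in>I - {j}. (if i = j then d else c i) * M i s) = (\<Sum>i\<in>I - {j}. c i * M i s)"
          by (intro sum.cong) auto
        also have "d * M j s = - (\<Sum>i\<in>I - {j}. c i * (M i t / M j t * M j s))"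
          by (simp add: d_def sum_distrib_right sum_negf mult.assoc)
        finally show ?thesis by (simp add: M'_def right_diff_distrib sum_subtractf)
      qed
      have "(\<Sum>i\<in>I - {j}. c i * M' i t) = 0" using j by (simp add: M'_def)
      then show ?thesis using c sum by (intro exI[of _ "\<lambda>i. if i = j then d else c i"]) auto
    qed
  qed
  then show ?thesis using that by blast
qed

locale supported_linear =
  fixes S :: "'s set" and f :: "('s \<Rightarrow> complex) \<Rightarrow> 's \<Rightarrow> complex"
  assumes finite_S: "finite S"
    and closed: "x \<in> supported S \<Longrightarrow> f x \<in> supported S"
    and add: "x \<in> supported S \<Longrightarrow> y \<in> supported S \<Longrightarrow> f (\<lambda>s. x s + y s) = (\<lambda>s. f x s + f y s)"
    and scale: "x \<in> supported S \<Longrightarrow> f (\<lambda>s. a * x s) = (\<lambda>s. a * f x s)"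
begin

definition poly_apply :: "complex poly \<Rightarrow> ('s \<Rightarrow> complex) \<Rightarrow> 's \<Rightarrow> complex" where
  "poly_apply p x = (\<lambda>s. \<Sum>k\<le>degree p. coeff p k * (f ^^ k) x s)"

lemma funpow_closed: "x \<in> supported S \<Longrightarrow> (f ^^ k) x \<in> supported S"
  by (induction k) (auto intro: closed)

lemma sum_supported:
  fixes c :: "'i \<Rightarrow> complex"
  assumes "\<And>i. i \<in> I \<Longrightarrow> x i \<in> supported S"
  shows "(\<lambda>s. \<Sum>i\<in>I. c i * x i s) \<in> supported S"
proof -
  have "(\<Sum>i\<in>I. c i * x i s) = 0" if "s \<notin> S" for s
    using assms that by (intro sum.neutral ballI) (simp add: supportedD(2)[where D = S])
  then show ?thesis by (auto simp: supported_def)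
qed

lemma f_sum:
  fixes x :: "'i \<Rightarrow> 's \<Rightarrow> complex"
  assumes "finite I" "\<And>i. i \<in> I \<Longrightarrow> x i \<in> supported S"
  shows "f (\<lambda>s. \<Sum>i\<in>I. c i * x i s) = (\<lambda>s. \<Sum>i\<in>I. c i * f (x i) s)"
  using assms
proof (induction I rule: finite_induct)
  case empty
  show ?case using scale[of "\<lambda>_. 0" 0] by (simp add: supported_def)
next
  case (insert i I)
  have "f (\<lambda>s. c i * x i s + (\<Sum>i\<in>I. c i * x i s)) = (\<lambda>s. f (\<lambda>s. c i * x i s) s + f (\<lambda>s. \<Sum>i\<in>I. c i * x i s) s)"
    using insert by (intro add sum_supported) (auto simp: supported_def)
  then show ?case using insert by (simp add: scale)
qed

lemma funpow_sum:
  fixes x :: "'i \<Rightarrow> 's \<Rightarrow> complex"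
  assumes "finite I" "\<And>i. i \<in> I \<Longrightarrow> x i \<in> supported S"
  shows "(f ^^ k) (\<lambda>s. \<Sum>i\<in>I. c i * x i s) = (\<lambda>s. \<Sum>i\<in>I. c i * (f ^^ k) (x i) s)"
  by (induction k) (simp_all add: f_sum assms funpow_closed)

lemma expand: "x \<in> supported S \<Longrightarrow> x = (\<lambda>s. \<Sum>a\<in>S. x a * unit_fun a s)" for x :: "'s \<Rightarrow> complex"
  using finite_S by (auto simp: fun_eq_iff unit_fun_def sum.delta' supportedD if_distrib cong: if_cong)

lemma poly_apply_le:
  assumes "degree p \<le> N" shows "poly_apply p x s = (\<Sum>k\<le>N. coeff p k * (f ^^ k) x s)"
  unfolding poly_apply_def using assms
  by (intro sum.mono_neutral_left) (auto simp: coeff_eq_0)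

lemma poly_apply_add: "poly_apply (p + q) x s = poly_apply p x s + poly_apply q x s"
  by (subst (1 2 3) poly_apply_le[of _ "max (degree p) (degree q)"])
    (auto simp: degree_add_le sum.distrib algebra_simps)

lemma poly_apply_smult: "poly_apply (smult a p) x s = a * poly_apply p x s"
  by (subst (1 2) poly_apply_le[of _ "degree p"]) (auto simp: sum_distrib_left algebra_simps)

lemma poly_apply_pCons: "poly_apply (pCons a p) x s = a * x s + poly_apply p (f x) s"
proof -
  have "poly_apply (pCons a p) x s = (\<Sum>k\<le>Suc (degree p). coeff (pCons a p) k * (f ^^ k) x s)"
    by (rule poly_apply_le) (rule degree_pCons_le)
  also have "\<dots> = a * x s + (\<Sum>k\<le>degree p. coeff p k * (f ^^ Suc k) x s)"
    by (subst sum.atMost_Suc_shift) simp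
  also have "(\<Sum>k\<le>degree p. coeff p k * (f ^^ Suc k) x s) = poly_apply p (f x) s"
    by (simp add: poly_apply_def funpow_swap1)
  finally show ?thesis .
qed

lemma poly_apply_closed: "x \<in> supported S \<Longrightarrow> poly_apply p x \<in> supported S"
  unfolding poly_apply_def by (rule sum_supported) (rule funpow_closed)

text \<open>The reason for wanting the inverse as a polynomial in \<open>f\<close>: it inherits
  every coordinate subspace stable under \<open>f\<close>, which later keeps the inverse triangular
  for domination.\<close>

lemma poly_apply_stable:
  assumes f: "\<And>y. y \<in> supported D \<Longrightarrow> f y \<in> supported D" and x: "x \<in> supported D"
  shows "poly_apply p x \<in> supported D"
proof -
  have "(f ^^ k) x \<in> supported D" for k by (induction k) (simp_all add: f x)
  then have "poly_apply p x s = 0" if "s \<notin> D" for s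
    using that unfolding poly_apply_def by (intro sum.neutral ballI) (simp add: supportedD(2)[where D = D])
  then show ?thesis unfolding supported_def by blast
qed

lemma f_poly_apply: "x \<in> supported S \<Longrightarrow> f (poly_apply p x) = poly_apply p (f x)"
  unfolding poly_apply_def by (subst f_sum) (auto simp: funpow_swap1 intro: funpow_closed)

text \<open>The powers of \<open>f\<close> with exponents 0 to |S|^2 are one more than the number of
  matrix entries, hence linearly dependent; this weak form of Cayley-Hamilton is enough.\<close>

lemma annihilating_poly:
  obtains q where "q \<noteq> 0" "\<And>x s. x \<in> supported S \<Longrightarrow> poly_apply q x s = 0"
proof -
  let ?N = "card (S \<times> S)"
  obtain c where c: "\<exists>k\<in>{..?N}. c k \<noteq> 0"
    "\<And>t. t \<in> S \<times> S \<Longrightarrow> (\<Sum>k\<in>{..?N}. c k * (f ^^ k) (unit_fun (fst t)) (snd t)) = 0"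
    using homogeneous_system[of "S \<times> S" "{..?N}" "\<lambda>k t. (f ^^ k) (unit_fun (fst t)) (snd t)"] finite_S
    by (auto simp: )
  define q where "q = (\<Sum>k\<le>?N. monom (c k) k)"
  have coeff: "coeff q k = (if k \<le> ?N then c k else 0)" for k
    by (simp add: q_def coeff_sum)
  have 1: "q \<noteq> 0" using c(1) coeff by (metis atMost_iff coeff_0)
  have deg: "degree q \<le> ?N" by (rule degree_le) (simp add: coeff)
  have unit: "(\<Sum>k\<le>?N. c k * (f ^^ k) (unit_fun a) s) = 0" if "a \<in> S" for a s
  proof (cases "s \<in> S")
    case True
    then show ?thesis using c(2)[of "(a, s)"] that by simp
  next
    case False
    then have "(f ^^ k) (unit_fun a) s = 0" for k
      using funpow_closed[of "unit_fun a" k] that by (auto simp: supportedD)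
    then show ?thesis by simp
  qed
  have "poly_apply q x s = 0" if x: "x \<in> supported S" for x s
  proof -
    have "poly_apply q x s = (\<Sum>k\<le>?N. c k * (f ^^ k) x s)"
      by (subst poly_apply_le[OF deg]) (simp add: coeff)
    also have "\<dots> = (\<Sum>k\<le>?N. c k * (f ^^ k) (\<lambda>s. \<Sum>a\<in>S. x a * unit_fun a s) s)"
      using expand[OF x] by simp
    also have "\<dots> = (\<Sum>k\<le>?N. c k * (\<Sum>a\<in>S. x a * (f ^^ k) (unit_fun a) s))"
      by (simp add: funpow_sum finite_S)
    also have "\<dots> = (\<Sum>a\<in>S. x a * (\<Sum>k\<le>?N. c k * (f ^^ k) (unit_fun a) s))"
      by (simp add: sum_distrib_left mult.left_commute, subst sum.swap) simp
    also have "\<dots> = 0" using unit by simp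
    finally show ?thesis .
  qed
  with 1 show ?thesis using that by blast
qed

lemma funpow_lin:
  assumes "x \<in> supported S" "y \<in> supported S"
  shows "(f ^^ k) (\<lambda>s. a * x s + b * y s) = (\<lambda>s. a * (f ^^ k) x s + b * (f ^^ k) y s)"
proof (induction k)
  case (Suc k)
  have "(\<lambda>s. c * u s) \<in> supported S" if "u \<in> supported S" for c and u :: "'s \<Rightarrow> complex"
    using that by (auto simp: supported_def)
  then show ?case
    using assms by (simp add: Suc add scale funpow_closed)
qed simp

lemma poly_apply_lin:
  assumes "x \<in> supported S" "y \<in> supported S"
  shows "poly_apply p (\<lambda>s. a * x s + b * y s) s = a * poly_apply p x s + b * poly_apply p y s"
  by (simp add: poly_apply_def funpow_lin[OF assms] sum.distrib sum_distrib_left algebra_simps)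

text \<open>Only finitely many ratios \<open>z / cnj z\<close> can meet the spectrum of \<open>- f\<close>, and off the
  spectrum the inverse is a polynomial in \<open>f\<close>.\<close>

lemma generic_inverse:
  obtains z r where "z \<noteq> 0" "\<And>x s. x \<in> supported S \<Longrightarrow>
    poly_apply r (\<lambda>s. z * x s + cnj z * f x s) s = x s"
proof -
  obtain q where q: "q \<noteq> 0" "\<And>x s. x \<in> supported S \<Longrightarrow> poly_apply q x s = 0"
    using annihilating_poly by blast
  \<comment> \<open>The ratio z / cnj z for z = 1 + \<i> t. Distinct real t give distinct ratios, so
    infinitely many candidates compete with finitely many roots.\<close>
  define w where "w t = Complex 1 t / cnj (Complex 1 t)" for t
  have nz: "Complex 1 t \<noteq> 0" "cnj (Complex 1 t) \<noteq> 0" for t by (auto simp: complex_eq_iff)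
  have "inj w"
  proof (rule injI)
    fix t u assume "w t = w u"
    then have "Complex 1 t * cnj (Complex 1 u) = Complex 1 u * cnj (Complex 1 t)"
      using nz by (simp add: w_def frac_eq_eq)
    then show "t = u" by (simp add: complex_eq_iff)
  qed
  then have "infinite (range w)" by (simp add: finite_image_iff infinite_UNIV_char_0)
  moreover have "finite (uminus ` {u. poly q u = 0})" using q(1) by (simp add: poly_roots_finite)
  ultimately obtain t where t: "w t \<notin> uminus ` {u. poly q u = 0}"
    by (meson finite_subset image_subsetI rangeE subsetI)
  define \<kappa> where "\<kappa> = poly q (- w t)"
  have \<kappa>: "\<kappa> \<noteq> 0" using t by (force simp: \<kappa>_def)
  let ?z = "Complex 1 t" and ?r = "synthetic_div q (- w t)"
  have eq: "w t * poly_apply ?r x s + poly_apply ?r (f x) s = - \<kappa> * x s" if "x \<in> supported S" for x s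
  proof -
    \<comment> \<open>Division of q by X + w with remainder \<kappa>. Since q(f) = 0, this says (w +
      f) r(f) = -\<kappa>; and z + cnj z f = cnj z (w + f), which accounts for the factor -1 / (cnj
      z \<kappa>) below.\<close>
    have "q = [:w t, 1:] * ?r + [:\<kappa>:]"
      using synthetic_div_correct'[of "- w t" q] by (simp add: \<kappa>_def)
    then have "poly_apply q x s = poly_apply (smult (w t) ?r + pCons 0 ?r + [:\<kappa>:]) x s"
      by (metis mult_pCons_left mult_pCons_left mult_zero_left pCons_0_0 add.right_neutral smult_1_left)
    then show ?thesis
      using q(2)[OF that]
      by (simp add: poly_apply_add poly_apply_smult poly_apply_pCons)
         (simp add: poly_apply_def eq_neg_iff_add_eq_0)
  qed
  have "poly_apply (smult (- 1 / (cnj ?z * \<kappa>)) ?r) (\<lambda>s. ?z * x s + cnj ?z * f x s) s = x s"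
    if x: "x \<in> supported S" for x s
  proof -
    have *: "?z * poly_apply ?r x s + cnj ?z * poly_apply ?r (f x) s =
        cnj ?z * (w t * poly_apply ?r x s + poly_apply ?r (f x) s)"
      using nz by (simp add: w_def distrib_left)
    have "poly_apply (smult (- 1 / (cnj ?z * \<kappa>)) ?r) (\<lambda>s. ?z * x s + cnj ?z * f x s) s =
        (- 1 / (cnj ?z * \<kappa>)) * (?z * poly_apply ?r x s + cnj ?z * poly_apply ?r (f x) s)"
      by (subst poly_apply_smult, subst poly_apply_lin[OF x closed[OF x]], rule refl)
    also have "\<dots> = (- 1 / (cnj ?z * \<kappa>)) * (cnj ?z * (- \<kappa> * x s))"
      by (simp only: * eq[OF x])
    also have "\<dots> = x s" using nz(1)[of t] \<kappa> by simp
    finally show ?thesis .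
  qed
  then show ?thesis using that nz(1) by blast
qed

end

section \<open>The coherence preorder\<close>

definition dominated :: "'s set \<Rightarrow> 's set set \<Rightarrow> 's \<Rightarrow> 's \<Rightarrow> bool" where
  "dominated S E a b \<longleftrightarrow> a \<in> S \<and> b \<in> S \<and> open_nbhd S E a \<subseteq> closed_nbhd S E b"

text \<open>Coordinate form of a vanishing bracket: \<open>mult_zero_commuting\<close> and
  \<open>commuting_lift\<close> are the two halves of the correspondence.\<close>

definition commuting :: "'s set set \<Rightarrow> ('s \<Rightarrow> complex) \<Rightarrow> ('s \<Rightarrow> complex) \<Rightarrow> bool" where
  "commuting E x y \<longleftrightarrow> (\<forall>a b. {a, b} \<in> E \<longrightarrow> x a * y b = x b * y a)"

lemma edge_form_eq_0_iff: "edge_form E x y = (\<lambda>_. 0) \<longleftrightarrow> commuting E x y"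
  by (auto simp: edge_form_def commuting_def fun_eq_iff)

locale graph =
  fixes S :: "'s set" and E :: "'s set set"
  assumes simple_graph: "simple_graph S E"
begin

lemma finite_S: "finite S"
  using simple_graph by (simp add: simple_graph_def)

lemma edgeD: "{a, b} \<in> E \<Longrightarrow> a \<in> S" "{a, b} \<in> E \<Longrightarrow> b \<in> S" "{a, b} \<in> E \<Longrightarrow> a \<noteq> b"
  using simple_graph by (auto simp: simple_graph_def)

lemma open_nbhd_iff: "b \<in> open_nbhd S E a \<longleftrightarrow> {a, b} \<in> E"
  using edgeD by (auto simp: open_nbhd_def)

lemma closed_nbhd_iff: "b \<in> closed_nbhd S E a \<longleftrightarrow> b = a \<or> {a, b} \<in> E"
  by (auto simp: closed_nbhd_def open_nbhd_iff)

lemma dominated_iff: "dominated S E a b \<longleftrightarrow> a \<in> S \<and> b \<in> S \<and> (\<forall>s. {a, s} \<in> E \<longrightarrow> s = b \<or> {b, s} \<in> E)"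
  by (auto simp: dominated_def subset_iff open_nbhd_iff closed_nbhd_iff)

lemma dominated_refl: "a \<in> S \<Longrightarrow> dominated S E a a"
  by (auto simp: dominated_iff)

lemma dominated_trans:
  assumes ab: "dominated S E a b" and bc: "dominated S E b c" shows "dominated S E a c"
proof -
  have "s = c \<or> {c, s} \<in> E" if as: "{a, s} \<in> E" for s
  \<comment> \<open>If s is b itself, domination of a by b gives no adjacency between b and s. Then
    a and b are adjacent, and the argument goes through the neighbour a of b instead.\<close>
  proof (cases "s = b")
    case True
    have "{b, a} \<in> E" using as True by (simp add: insert_commute)
    then have "a = c \<or> {c, a} \<in> E" using bc by (auto simp: dominated_iff)
    then show ?thesis
    proof
      assume "a = c" then show ?thesis using as by simp
    next
      assume "{c, a} \<in> E"
      then have "{a, c} \<in> E" by (simp add: insert_commute)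
      then have "c = b \<or> {b, c} \<in> E" using ab by (auto simp: dominated_iff)
      then show ?thesis using True by (auto simp: insert_commute)
    qed
  next
    case False
    then have "{b, s} \<in> E" using as ab by (auto simp: dominated_iff)
    then show ?thesis using bc by (auto simp: dominated_iff)
  qed
  then show ?thesis using assms by (auto simp: dominated_iff)
qed

text \<open>An edge {c, d} would move up, one end at a time, to an edge {a, b}. Distinctness
  matters: two adjacent vertices of one class are both dominated by a single vertex, which has no
  loop.\<close>

lemma nonedge_dominated:
  assumes "{a, b} \<notin> E" "a \<noteq> b" "dominated S E c a" "dominated S E d b"
  shows "{c, d} \<notin> E"
proof
  assume cd: "{c, d} \<in> E"
  then have dc: "{d, c} \<in> E" by (simp add: insert_commute)
  from cd assms(3) have "d = a \<or> {a, d} \<in> E" by (auto simp: dominated_iff)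
  moreover have "{a, d} \<notin> E"
  proof
    assume "{a, d} \<in> E"
    then have "{d, a} \<in> E" by (simp add: insert_commute)
    then have "a = b \<or> {b, a} \<in> E" using assms(4) by (auto simp: dominated_iff)
    then show False using assms(1,2) by (auto simp: insert_commute)
  qed
  moreover from dc assms(4) have "c = b \<or> {b, c} \<in> E" by (auto simp: dominated_iff)
  moreover have "{b, c} \<notin> E"
  proof
    assume "{b, c} \<in> E"
    then have "{c, b} \<in> E" by (simp add: insert_commute)
    then have "b = a \<or> {a, b} \<in> E" using assms(3) by (auto simp: dominated_iff)
    then show False using assms(1,2) by auto
  qed
  ultimately show False using cd assms(1) by (simp add: insert_commute)
qed

section \<open>The subspaces attached to vertices and to coherent components\<close>

definition down :: "'s \<Rightarrow> ('s \<Rightarrow> complex) set" where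
  "down a = supported {b. dominated S E b a}"

lemma down_subset: "down a \<subseteq> supported S"
  unfolding down_def by (rule supported_mono) (auto simp: dominated_def)

lemma unit_down [simp]: "unit_fun b \<in> down a \<longleftrightarrow> dominated S E b a"
  by (simp add: down_def)

lemma down_mono: "dominated S E a b \<Longrightarrow> down a \<subseteq> down b"
  unfolding down_def by (rule supported_mono) (auto intro: dominated_trans)

lemma down_mono_iff: "a \<in> S \<Longrightarrow> down a \<subseteq> down b \<longleftrightarrow> dominated S E a b"
  using down_mono unit_down dominated_refl by blast

lemma commuting_down:
  assumes "{a, b} \<notin> E" "a \<noteq> b" "x \<in> down a" "y \<in> down b"
  shows "commuting E x y"
proof -
  have "x c * y d = 0" if "{c, d} \<in> E" for c d
    using nonedge_dominated[OF assms(1,2), of c d] that assms(3,4) by (auto simp: down_def supported_def)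
  then show ?thesis by (metis commuting_def insert_commute)
qed

lemma coherent_rel_iff: "(a, b) \<in> coherent_rel S E \<longleftrightarrow> dominated S E a b \<and> dominated S E b a"
  by (auto simp: coherent_rel_def dominated_def)

lemma equiv_coherent: "equiv S (coherent_rel S E)"
proof (rule equivI)
  show "coherent_rel S E \<subseteq> S \<times> S" by (auto simp: coherent_rel_def)
  show "refl_on S (coherent_rel S E)" by (auto simp: refl_on_def coherent_rel_iff dominated_refl)
  show "sym (coherent_rel S E)" by (auto simp: sym_def coherent_rel_iff)
  show "trans (coherent_rel S E)"
    unfolding trans_def coherent_rel_iff using dominated_trans by blast
qed

abbreviation "comps \<equiv> coherent_components S E"

abbreviation "cls a \<equiv> coherent_rel S E `` {a}"

lemma cls_in: "a \<in> S \<Longrightarrow> cls a \<in> comps"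
  by (auto simp: coherent_components_def quotient_def)

lemma mem_cls: "b \<in> cls a \<longleftrightarrow> dominated S E a b \<and> dominated S E b a"
  by (simp add: coherent_rel_iff)

lemma comps_eq_cls: "\<kappa> \<in> comps \<Longrightarrow> a \<in> \<kappa> \<Longrightarrow> \<kappa> = cls a"
  unfolding coherent_components_def
  by (metis equiv_class_eq equiv_coherent quotientE Image_singleton_iff)

lemma comps_subset: "\<kappa> \<in> comps \<Longrightarrow> \<kappa> \<subseteq> S"
  unfolding coherent_components_def using equiv_coherent in_quotient_imp_subset by blast

lemma comps_nonempty: "\<kappa> \<in> comps \<Longrightarrow> \<exists>a. a \<in> \<kappa>"
  unfolding coherent_components_def using equiv_coherent in_quotient_imp_non_empty by blast

lemma self_cls: "a \<in> S \<Longrightarrow> a \<in> cls a"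
  by (simp add: coherent_rel_iff dominated_refl)

lemma down_eq_iff: "a \<in> S \<Longrightarrow> b \<in> S \<Longrightarrow> down a = down b \<longleftrightarrow> cls a = cls b"
  by (metis down_mono_iff mem_cls order_refl self_cls subset_antisym down_mono
      comps_eq_cls cls_in)

text \<open>For a component all members of the union coincide (\<open>comp_down_eq\<close>); the
  union avoids choosing a representative.\<close>

definition comp_down :: "'s set \<Rightarrow> ('s \<Rightarrow> complex) set" where
  "comp_down \<kappa> = (\<Union>a\<in>\<kappa>. down a)"

lemma comp_down_eq: "\<kappa> \<in> comps \<Longrightarrow> a \<in> \<kappa> \<Longrightarrow> comp_down \<kappa> = down a"
proof -
  assume a: "\<kappa> \<in> comps" "a \<in> \<kappa>"
  have "down b = down a" if "b \<in> \<kappa>" for b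
    using a that comps_eq_cls[of \<kappa>] comps_subset[of \<kappa>] by (metis down_eq_iff subsetD)
  with a(2) show ?thesis unfolding comp_down_def by (rule UN_eqI)
qed

lemma comp_down_supported: "\<kappa> \<in> comps \<Longrightarrow> comp_down \<kappa> \<subseteq> supported S"
  using down_subset by (auto simp: comp_down_def)

lemma comp_down_inj: "\<kappa> \<in> comps \<Longrightarrow> \<mu> \<in> comps \<Longrightarrow> comp_down \<kappa> = comp_down \<mu> \<Longrightarrow> \<kappa> = \<mu>"
  by (metis comp_down_eq comps_eq_cls comps_nonempty comps_subset down_eq_iff subsetD)

end

section \<open>Commutation-preserving maps permute the coherent components\<close>

text \<open>The inverse map and the inverse field automorphism are carried along explicitly, so that
  \<open>flip\<close> yields each result for the inverse as well.\<close>

locale commuting_pair = graph S E for S :: "'s set" and E +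
  fixes \<theta> \<theta>' :: "complex \<Rightarrow> complex" and f g :: "('s \<Rightarrow> complex) \<Rightarrow> 's \<Rightarrow> complex"
  assumes field_aut: "field_aut \<theta> \<theta>'"
    and f_closed: "x \<in> supported S \<Longrightarrow> f x \<in> supported S"
    and f_add: "x \<in> supported S \<Longrightarrow> y \<in> supported S \<Longrightarrow> f (\<lambda>s. x s + y s) = (\<lambda>s. f x s + f y s)"
    and f_scale: "x \<in> supported S \<Longrightarrow> f (\<lambda>s. a * x s) = (\<lambda>s. \<theta> a * f x s)"
    and f_commuting: "x \<in> supported S \<Longrightarrow> y \<in> supported S \<Longrightarrow> commuting E x y \<Longrightarrow> commuting E (f x) (f y)"
    and g_closed: "x \<in> supported S \<Longrightarrow> g x \<in> supported S"
    and g_add: "x \<in> supported S \<Longrightarrow> y \<in> supported S \<Longrightarrow> g (\<lambda>s. x s + y s) = (\<lambda>s. g x s + g y s)"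
    and g_scale: "x \<in> supported S \<Longrightarrow> g (\<lambda>s. a * x s) = (\<lambda>s. \<theta>' a * g x s)"
    and g_commuting: "x \<in> supported S \<Longrightarrow> y \<in> supported S \<Longrightarrow> commuting E x y \<Longrightarrow> commuting E (g x) (g y)"
    and gf: "x \<in> supported S \<Longrightarrow> g (f x) = x"
    and fg: "x \<in> supported S \<Longrightarrow> f (g x) = x"
begin

lemma flip: "commuting_pair S E \<theta>' \<theta> g f"
  by unfold_locales
    (use field_aut in \<open>auto simp: field_aut_def f_closed f_add f_scale f_commuting
      g_closed g_add g_scale g_commuting fg gf\<close>)

lemma theta [simp]: "\<theta> 0 = 0" "\<theta> 1 = 1" "\<theta> (- 1) = - 1"
  "\<theta> (a + b) = \<theta> a + \<theta> b" "\<theta> (a * b) = \<theta> a * \<theta> b" "\<theta> (\<theta>' a) = a" "\<theta>' (\<theta> a) = a"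
  "\<theta> a = 0 \<longleftrightarrow> a = 0" "\<theta> (of_nat n) = of_nat n"
proof -
  have h: "\<And>a b. \<theta> (a + b) = \<theta> a + \<theta> b" "\<And>a b. \<theta> (a * b) = \<theta> a * \<theta> b" "\<theta> 1 = 1"
    "\<And>a. \<theta> (\<theta>' a) = a" "\<And>a. \<theta>' (\<theta> a) = a"
    using field_aut by (auto simp: field_aut_def field_hom_def)
  show 0: "\<theta> 0 = 0" using h(1)[of 0 0] by simp
  show "\<theta> (- 1) = - 1" using h(1)[of 1 "- 1"] 0 h(3) by (simp add: eq_neg_iff_add_eq_0 add.commute)
  show "\<theta> a = 0 \<longleftrightarrow> a = 0" using 0 h(5) by metis
  show "\<theta> (of_nat n) = of_nat n" by (induction n) (simp_all add: 0 h)
qed (use field_aut in \<open>auto simp: field_aut_def field_hom_def\<close>)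

lemma theta_sum: "\<theta> (sum h A) = (\<Sum>a\<in>A. \<theta> (h a))"
  by (induction A rule: infinite_finite_induct) simp_all

lemma f_expand:
  assumes "x \<in> supported D" "D \<subseteq> S"
  shows "f x = (\<lambda>s. \<Sum>a\<in>D. \<theta> (x a) * f (unit_fun a) s)"
proof -
  have fin: "finite D" using assms(2) finite_S finite_subset by blast
  have *: "f (\<lambda>s. if s \<in> T then x s else 0) = (\<lambda>s. \<Sum>a\<in>T. \<theta> (x a) * f (unit_fun a) s)"
    if "finite T" "T \<subseteq> S" for T
    using that
  proof (induction T rule: finite_induct)
    case empty
    show ?case using f_scale[of "\<lambda>_. 0" 0] by (simp add: supported_def)
  next
    case (insert a T)
    have sc: "(\<lambda>s. x a * unit_fun a s) \<in> supported S"
      using insert by (auto simp: supported_def unit_fun_def)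
    have "(\<lambda>s. if s \<in> insert a T then x s else 0) =
        (\<lambda>s. x a * unit_fun a s + (if s \<in> T then x s else 0))"
      using insert.hyps by (auto simp: fun_eq_iff unit_fun_def)
    then have "f (\<lambda>s. if s \<in> insert a T then x s else 0) =
        (\<lambda>s. f (\<lambda>s. x a * unit_fun a s) s + f (\<lambda>s. if s \<in> T then x s else 0) s)"
      using insert.prems sc by (simp only:) (intro f_add, auto simp: supported_def)
    then show ?case using insert by (simp add: f_scale)
  qed
  have "(\<lambda>s. if s \<in> D then x s else 0) = x" using assms(1) by (auto simp: supported_def fun_eq_iff)
  then show ?thesis using *[OF fin assms(2)] by simp
qed

text \<open>For a transvection \<open>D : c \<mapsto> b\<close> the conjugate \<open>f D g\<close> is again an infinitesimal automorphism,
  and its nonzero matrix entries therefore respect domination.\<close>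

lemma dominated_conjugate:
  assumes bc: "dominated S E b c" and d: "d \<in> S"
    and g: "g (unit_fun d) c \<noteq> 0" and f: "f (unit_fun b) s \<noteq> 0"
  shows "dominated S E s d"
proof (rule ccontr)
  assume nd: "\<not> dominated S E s d"
  have b: "b \<in> S" "c \<in> S" using bc by (auto simp: dominated_def)
  have s: "s \<in> S" using f f_closed[of "unit_fun b"] b supportedD(1) by fastforce
  \<comment> \<open>A neighbour of s outside the closed neighbourhood of d: it commutes with d,
    while the edge {s, t} detects the coefficient at s.\<close>
  with nd d obtain t where t: "{s, t} \<in> E" "t \<noteq> d" "{d, t} \<notin> E" by (auto simp: dominated_iff)
  have tS: "t \<in> S" "s \<noteq> t" using t edgeD by auto
  have sd: "s \<noteq> d" using t by auto
  let ?x = "g (unit_fun d)" and ?y = "g (unit_fun t)"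
  have x: "?x \<in> supported S" "?y \<in> supported S" using d tS g_closed by auto
  have "commuting E (unit_fun d) (unit_fun t :: 's \<Rightarrow> complex)"
    using t d tS by (intro commuting_down[of d t]) (auto simp: dominated_refl)
  then have xy: "commuting E ?x ?y" using d tS by (intro g_commuting) auto
  \<comment> \<open>The combination of \<open>?x\<close> and \<open>?y\<close> without coefficient
    at c. A neighbour of b is c or a neighbour of c, and there commutation of \<open>?x\<close> and
    \<open>?y\<close> makes \<open>?z\<close> vanish, so b commutes with \<open>?z\<close>; its
    image under \<open>f\<close> involves only t and d.\<close>
  let ?z = "\<lambda>r. ?x c * ?y r + (- ?y c) * ?x r"
  have sc: "(\<lambda>r. ?x c * ?y r) \<in> supported S" "(\<lambda>r. - ?y c * ?x r) \<in> supported S"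
    using x by (auto simp: supported_def)
  have "?z r = 0" if "r \<notin> S" for r
    using supportedD(2)[OF x(1) that] supportedD(2)[OF x(2) that] by simp
  then have z: "?z \<in> supported S" unfolding supported_def by blast
  have zero: "?z r = 0" if "{b, r} \<in> E" for r
  proof -
    have "r = c \<or> {c, r} \<in> E" using bc that by (auto simp: dominated_iff)
    then show ?thesis
    proof
      assume "{c, r} \<in> E"
      then have "?x c * ?y r = ?x r * ?y c" using xy unfolding commuting_def by blast
      then show ?thesis by simp
    qed simp
  qed
  have "commuting E (unit_fun b) ?z"
    unfolding commuting_def
  proof (intro allI impI)
    fix p q assume pq: "{p, q} \<in> E"
    then have "unit_fun b p * ?z q = 0" using zero by (cases "p = b") auto
    moreover have "unit_fun b q * ?z p = 0"
      using zero pq by (cases "q = b") (auto simp: insert_commute)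
    ultimately show "unit_fun b p * ?z q = unit_fun b q * ?z p" by (rule trans[OF _ sym])
  qed
  then have "commuting E (f (unit_fun b)) (f ?z)" using b z by (intro f_commuting) auto
  moreover have "f ?z = (\<lambda>r. \<theta> (?x c) * unit_fun t r + \<theta> (- ?y c) * unit_fun d r)"
    using fg[of "unit_fun d"] fg[of "unit_fun t"] d tS
    by (simp only: f_add[OF sc] f_scale[OF x(2)] f_scale[OF x(1)] unit_fun_supported)
  ultimately have "commuting E (f (unit_fun b)) (\<lambda>r. \<theta> (?x c) * unit_fun t r + \<theta> (- ?y c) * unit_fun d r)"
    by (simp only:)
  \<comment> \<open>At the edge {s, t} only the t-term on the left survives, because t differs from
    d and s, and s from d. It is a product of two nonzero numbers, yet the right side is
    zero.\<close>
  from this[unfolded commuting_def, rule_format, OF t(1)]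
  have "f (unit_fun b) s * (\<theta> (?x c) * unit_fun t t + \<theta> (- ?y c) * unit_fun d t) =
      f (unit_fun b) t * (\<theta> (?x c) * unit_fun t s + \<theta> (- ?y c) * unit_fun d s)"
    .
  then show False using t(2) tS(2) sd g f by simp
qed

lemma f_down_subset:
  assumes "a \<in> S" "d \<in> S" "g (unit_fun d) a \<noteq> 0"
  shows "f ` down a \<subseteq> down d"
proof
  fix y assume "y \<in> f ` down a"
  then obtain x where x: "x \<in> down a" "y = f x" by blast
  let ?D = "{b. dominated S E b a}"
  have "y = (\<lambda>s. \<Sum>b\<in>?D. \<theta> (x b) * f (unit_fun b) s)"
    unfolding x(2) using x(1) by (intro f_expand) (auto simp: down_def dominated_def)
  moreover have "f (unit_fun b) s = 0" if "b \<in> ?D" "\<not> dominated S E s d" for b s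
    using dominated_conjugate[of b a d s] that assms by auto
  ultimately have "y s = 0" if "\<not> dominated S E s d" for s using that by simp
  then show "y \<in> down d" unfolding down_def supported_def by blast
qed

text \<open>The diagonal entry of g f at a is 1, so for some d the entry of f from a to d and that
  of g from d to a are both nonzero. \<open>f_down_subset\<close> then applies to f and to
  g.\<close>

lemma f_down:
  assumes "a \<in> S"
  obtains d where "d \<in> S" "f ` down a = down d"
proof -
  have "unit_fun a = g (f (unit_fun a))" using assms gf by simp
  also have "\<dots> = (\<lambda>s. \<Sum>d\<in>S. \<theta>' (f (unit_fun a) d) * g (unit_fun d) s)"
    by (rule commuting_pair.f_expand[OF flip]) (use assms f_closed in auto)
  finally have "(\<Sum>d\<in>S. \<theta>' (f (unit_fun a) d) * g (unit_fun d) a) = 1"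
    by (metis unit_fun_simps(1))
  then have "(\<Sum>d\<in>S. \<theta>' (f (unit_fun a) d) * g (unit_fun d) a) \<noteq> 0" by simp
  then obtain d where d: "d \<in> S" "\<theta>' (f (unit_fun a) d) * g (unit_fun d) a \<noteq> 0"
    by (rule sum.not_neutral_contains_not_neutral)
  interpret fl: commuting_pair S E \<theta>' \<theta> g f by (rule flip)
  have *: "g (unit_fun d) a \<noteq> 0" "f (unit_fun a) d \<noteq> 0" using d by auto
  have "f ` down a \<subseteq> down d" using f_down_subset[OF assms d(1) *(1)] .
  moreover have "down d \<subseteq> f ` down a"
  proof
    fix x assume x: "x \<in> down d"
    then have "g x \<in> down a" using fl.f_down_subset[OF d(1) assms *(2)] by blast
    moreover have "x = f (g x)" using fg x down_subset by (metis subsetD)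
    ultimately show "x \<in> f ` down a" by blast
  qed
  ultimately show ?thesis using that d(1) by blast
qed

lemma g_down: "a \<in> S \<Longrightarrow> f ` down a = down d \<Longrightarrow> g ` down d = down a"
proof -
  assume "a \<in> S" "f ` down a = down d"
  then have "g ` down d = (\<lambda>x. g (f x)) ` down a" by (metis image_image)
  also have "\<dots> = (\<lambda>x. x) ` down a" using gf down_subset by (intro image_cong) auto
  finally show ?thesis by simp
qed

text \<open>A nonzero summand forces e to be dominated by d, through f, and d by e, through g. So
  the full sum, a diagonal entry of the identity, is concentrated on the class of d.\<close>

lemma trace_one:
  assumes a: "a \<in> S" and d: "d \<in> S" "f ` down a = down d"
  shows "(\<Sum>e\<in>cls d. \<theta>' (f (unit_fun a) e) * g (unit_fun e) a) = 1"
proof -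
  interpret fl: commuting_pair S E \<theta>' \<theta> g f by (rule flip)
  have zero: "\<theta>' (f (unit_fun a) e) * g (unit_fun e) a = 0" if e: "e \<in> S - cls d" for e
  proof (rule ccontr)
    assume nz: "\<theta>' (f (unit_fun a) e) * g (unit_fun e) a \<noteq> 0"
    have "f (unit_fun a) \<in> down d" using d(2) a dominated_refl by auto
    then have ed: "dominated S E e d" using nz by (auto simp: down_def supported_def)
    have "e \<in> S" using e by simp
    then obtain b where b: "b \<in> S" "g ` down e = down b" by (rule fl.f_down)
    have "g (unit_fun e) \<in> down b" using b e dominated_refl by auto
    then have "dominated S E a b" using nz by (auto simp: down_def supported_def)
    then have "down a \<subseteq> down b" by (rule down_mono)
    then have "f ` down a \<subseteq> f ` down b" by blast
    also have "f ` down b = down e" using fl.g_down[OF \<open>e \<in> S\<close> b(2)] .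
    finally have "dominated S E d e" using d down_mono_iff by simp
    then show False using ed e by (simp add: coherent_rel_iff)
  qed
  have sub: "cls d \<subseteq> S" using comps_subset cls_in[OF d(1)] by blast
  have "unit_fun a = g (f (unit_fun a))" using a gf by simp
  also have "\<dots> = (\<lambda>s. \<Sum>d\<in>S. \<theta>' (f (unit_fun a) d) * g (unit_fun d) s)"
    by (rule fl.f_expand) (use a f_closed in auto)
  finally have "(\<Sum>e\<in>S. \<theta>' (f (unit_fun a) e) * g (unit_fun e) a) = 1"
    by (metis unit_fun_simps(1))
  moreover have "(\<Sum>e\<in>cls d. \<theta>' (f (unit_fun a) e) * g (unit_fun e) a) =
      (\<Sum>e\<in>S. \<theta>' (f (unit_fun a) e) * g (unit_fun e) a)"
    using zero by (intro sum.mono_neutral_left sub finite_S) auto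
  ultimately show ?thesis by simp
qed

text \<open>Both cardinalities are the trace of \<open>g f\<close> on the subquotient belonging to the component.\<close>

lemma card_cls:
  assumes a: "a \<in> S" and d: "d \<in> S" "f ` down a = down d"
  shows "card (cls d) = card (cls a)"
proof -
  interpret fl: commuting_pair S E \<theta>' \<theta> g f by (rule flip)
  have a': "f ` down b = down d" "down b = down a" "cls b = cls a" "b \<in> S" if "b \<in> cls a" for b
  proof -
    show "b \<in> S" using comps_subset cls_in[OF a] that by blast
    show "cls b = cls a" using comps_eq_cls[OF cls_in[OF a] that] by simp
    then show "down b = down a" using a \<open>b \<in> S\<close> down_eq_iff by simp
    then show "f ` down b = down d" using d by simp
  qed
  have d': "g ` down e = down a" "e \<in> S" if "e \<in> cls d" for e
  proof -
    show "e \<in> S" using comps_subset cls_in[OF d(1)] that by blast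
    have "cls e = cls d" using comps_eq_cls[OF cls_in[OF d(1)] that] by simp
    then have "down e = down d" using d \<open>e \<in> S\<close> down_eq_iff by simp
    then show "g ` down e = down a" using g_down[OF a d(2)] by simp
  qed
  have "of_nat (card (cls a)) = (\<Sum>b\<in>cls a. (1::complex))" by simp
  also have "\<dots> = (\<Sum>b\<in>cls a. \<Sum>e\<in>cls d. \<theta>' (f (unit_fun b) e) * g (unit_fun e) b)"
    by (intro sum.cong refl trace_one[symmetric]) (use a' d in auto)
  \<comment> \<open>Applying \<theta> removes \<theta>' from the entries of f and puts \<theta> on
    those of g, which is the shape of \<open>trace_one\<close> for the inverse pair.\<close>
  finally have "\<theta> (of_nat (card (cls a))) =
      \<theta> (\<Sum>b\<in>cls a. \<Sum>e\<in>cls d. \<theta>' (f (unit_fun b) e) * g (unit_fun e) b)" by simp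
  then have "of_nat (card (cls a)) = (\<Sum>b\<in>cls a. \<Sum>e\<in>cls d. f (unit_fun b) e * \<theta> (g (unit_fun e) b))"
    by (simp add: theta_sum)
  also have "\<dots> = (\<Sum>e\<in>cls d. \<Sum>b\<in>cls a. \<theta> (g (unit_fun e) b) * f (unit_fun b) e)"
    by (subst sum.swap) (simp add: mult.commute)
  also have "\<dots> = (\<Sum>e\<in>cls d. 1)"
    by (intro sum.cong refl fl.trace_one) (use a d' in auto)
  also have "\<dots> = of_nat (card (cls d))" by simp
  finally show ?thesis using of_nat_eq_iff by metis
qed

text \<open>Without edges between the two classes, distinct members p and q are nonadjacent, so all
  of \<open>down p\<close> commutes with all of \<open>down q\<close>. The images of a and b would
  then commute, and pulling back by g contradicts the edge {a, b}.\<close>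

lemma edge_cls:
  assumes ab: "{a, b} \<in> E" and d: "d \<in> S" "f ` down a = down d" and e: "e \<in> S" "f ` down b = down e"
  shows "\<exists>p\<in>cls d. \<exists>q\<in>cls e. {p, q} \<in> E"
proof (rule ccontr)
  assume no: "\<not> ?thesis"
  have S: "a \<in> S" "b \<in> S" "a \<noteq> b" using edgeD ab by auto
  interpret fl: commuting_pair S E \<theta>' \<theta> g f by (rule flip)
  \<comment> \<open>This can fail only if both classes are one and the same singleton. But
    \<open>card_cls\<close> then makes the class of a a singleton as well, although it contains a
    and b.\<close>
  have "\<exists>p\<in>cls d. \<exists>q\<in>cls e. p \<noteq> q"
  proof (rule ccontr)
    assume "\<not> ?thesis"
    then have eq: "p = q" if "p \<in> cls d" "q \<in> cls e" for p q using that by blast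
    have "d = e" using eq self_cls d e by blast
    then have "cls d = {d}" using eq self_cls d by blast
    then have "card (cls a) = 1" using card_cls[OF S(1) d] by simp
    moreover have "down a = down b"
      using g_down[OF S(1) d(2)] g_down[OF S(2) e(2)] \<open>d = e\<close> by simp
    then have "cls a = cls b" using S down_eq_iff by simp
    then have "{a, b} \<subseteq> cls a" using S self_cls by blast
    ultimately show False using S(3) by (metis card_1_singletonE insert_subset singletonD)
  qed
  then obtain p q where pq: "p \<in> cls d" "q \<in> cls e" "p \<noteq> q" by blast
  then have "{p, q} \<notin> E" using no by blast
  moreover have "p \<in> S" "q \<in> S" using pq comps_subset cls_in[OF d(1)] cls_in[OF e(1)] by blast+
  moreover have "cls p = cls d" "cls q = cls e"
    using comps_eq_cls[OF cls_in[OF d(1)] pq(1)] comps_eq_cls[OF cls_in[OF e(1)] pq(2)] by simp_all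
  then have "down p = down d" "down q = down e" using calculation(2,3) d e down_eq_iff by simp_all
  moreover have "f (unit_fun a) \<in> down d" "f (unit_fun b) \<in> down e"
    using d(2) e(2) S dominated_refl by auto
  ultimately have "commuting E (f (unit_fun a)) (f (unit_fun b))"
    using pq(3) by (intro commuting_down[of p q]) auto
  then have "commuting E (g (f (unit_fun a))) (g (f (unit_fun b)))"
    using S f_closed by (intro g_commuting) auto
  then have "commuting E (unit_fun a) (unit_fun b :: 's \<Rightarrow> complex)" using S gf by simp
  then have "unit_fun a a * unit_fun b b = (unit_fun a b * unit_fun b a :: complex)"
    using ab unfolding commuting_def by blast
  then show False using S(3) by simp
qed

lemma comp_image:
  assumes "\<kappa> \<in> comps" shows "\<exists>\<mu>\<in>comps. f ` comp_down \<kappa> = comp_down \<mu>"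
proof -
  obtain a where a: "a \<in> \<kappa>" using comps_nonempty[OF assms] by blast
  then have "a \<in> S" using comps_subset[OF assms] by blast
  then obtain d where d: "d \<in> S" "f ` down a = down d" by (rule f_down)
  then have "f ` comp_down \<kappa> = comp_down (cls d)"
    using comp_down_eq[OF assms a] comp_down_eq[OF cls_in self_cls] by simp
  then show ?thesis using cls_in[OF d(1)] by blast
qed

lemma g_comp_image:
  assumes "\<kappa> \<in> comps" "f ` comp_down \<kappa> = comp_down \<mu>" shows "g ` comp_down \<mu> = comp_down \<kappa>"
proof -
  have "g ` comp_down \<mu> = (\<lambda>x. g (f x)) ` comp_down \<kappa>" using assms(2) by (metis image_image)
  also have "\<dots> = (\<lambda>x. x) ` comp_down \<kappa>"
    using gf comp_down_supported[OF assms(1)] by (intro image_cong) auto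
  finally show ?thesis by simp
qed

lemma quotient_edges_image:
  assumes \<phi>: "\<And>\<kappa>. \<kappa> \<in> comps \<Longrightarrow> \<phi> \<kappa> \<in> comps" "\<And>\<kappa>. \<kappa> \<in> comps \<Longrightarrow> f ` comp_down \<kappa> = comp_down (\<phi> \<kappa>)"
    and e: "e \<in> quotient_edges S E"
  shows "\<phi> ` e \<in> quotient_edges S E"
proof -
  obtain \<kappa> \<mu> a b where ab: "e = {\<kappa>, \<mu>}" "\<kappa> \<in> comps" "\<mu> \<in> comps" "a \<in> \<kappa>" "b \<in> \<mu>" "{a, b} \<in> E"
    using e unfolding quotient_edges_def by blast
  obtain d where d: "d \<in> \<phi> \<kappa>" using comps_nonempty \<phi>(1)[OF ab(2)] by blast
  obtain d' where d': "d' \<in> \<phi> \<mu>" using comps_nonempty \<phi>(1)[OF ab(3)] by blast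
  have S: "d \<in> S" "d' \<in> S"
    using d d' comps_subset[OF \<phi>(1)[OF ab(2)]] comps_subset[OF \<phi>(1)[OF ab(3)]] by auto
  have "f ` down a = down d" "f ` down b = down d'"
    using \<phi>(2)[OF ab(2)] \<phi>(2)[OF ab(3)] comp_down_eq ab d d' \<phi>(1) by metis+
  then obtain p q where pq: "p \<in> cls d" "q \<in> cls d'" "{p, q} \<in> E"
    using edge_cls[OF ab(6) S(1) _ S(2)] by blast
  moreover have "cls d = \<phi> \<kappa>" "cls d' = \<phi> \<mu>"
    using comps_eq_cls[OF \<phi>(1)[OF ab(2)] d] comps_eq_cls[OF \<phi>(1)[OF ab(3)] d'] by simp_all
  ultimately have "\<exists>p\<in>\<phi> \<kappa>. \<exists>q\<in>\<phi> \<mu>. {p, q} \<in> E" by metis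
  then have "{\<phi> \<kappa>, \<phi> \<mu>} \<in> quotient_edges S E"
    unfolding quotient_edges_def
    by (intro CollectI exI[of _ "\<phi> \<kappa>"] exI[of _ "\<phi> \<mu>"] conjI refl \<phi>(1) ab(2,3))
  then show ?thesis by (simp add: ab(1))
qed

theorem induced_automorphism:
  obtains \<phi> where "\<phi> \<in> carrier (aut_quotient S E)"
    "\<And>\<kappa>. \<kappa> \<in> comps \<Longrightarrow> f ` comp_down \<kappa> = comp_down (\<phi> \<kappa>)"
proof -
  interpret fl: commuting_pair S E \<theta>' \<theta> g f by (rule flip)
  \<comment> \<open>The identity off the components is what \<open>permutes\<close> asks
    for.\<close>
  define \<phi> where "\<phi> \<kappa> = (if \<kappa> \<in> comps then SOME \<mu>. \<mu> \<in> comps \<and> f ` comp_down \<kappa> = comp_down \<mu> else \<kappa>)" for \<kappa>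
  have \<phi>: "\<phi> \<kappa> \<in> comps" "f ` comp_down \<kappa> = comp_down (\<phi> \<kappa>)" if "\<kappa> \<in> comps" for \<kappa>
    using someI_ex[OF comp_image[OF that, unfolded Bex_def]] that by (simp_all add: \<phi>_def)
  have inj: "inj_on \<phi> comps"
    by (rule inj_onI) (metis \<phi> comp_down_inj g_comp_image)
  have "finite comps" using finite_S by (simp add: coherent_components_def equiv_type[OF equiv_coherent] finite_quotient)
  then have "\<phi> ` comps = comps" using inj \<phi>(1) by (intro endo_inj_surj) auto
  then have perm: "\<phi> permutes comps"
    using inj by (intro bij_imp_permutes) (auto simp: bij_betw_def \<phi>_def)
  have inv: "inv_into UNIV \<phi> \<kappa> \<in> comps" "g ` comp_down \<kappa> = comp_down (inv_into UNIV \<phi> \<kappa>)" if "\<kappa> \<in> comps" for \<kappa>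
  proof -
    show *: "inv_into UNIV \<phi> \<kappa> \<in> comps" using perm that by (simp add: permutes_inv permutes_in_image)
    show "g ` comp_down \<kappa> = comp_down (inv_into UNIV \<phi> \<kappa>)"
      using \<phi>(2)[OF *] permutes_inverses(1)[OF perm] by (intro g_comp_image[OF *]) simp
  qed
  have "e \<in> quotient_edges S E \<longleftrightarrow> \<phi> ` e \<in> quotient_edges S E" for e
  proof
    assume "\<phi> ` e \<in> quotient_edges S E"
    then have "inv_into UNIV \<phi> ` \<phi> ` e \<in> quotient_edges S E"
      by (rule fl.quotient_edges_image[where \<phi> = "inv_into UNIV \<phi>", rotated 2]) (rule inv, assumption)+
    then show "e \<in> quotient_edges S E" by (simp add: image_image permutes_inverses(2)[OF perm])
  qed (rule quotient_edges_image[where \<phi> = \<phi>, OF \<phi>])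
  moreover have "card (\<phi> \<kappa>) = card \<kappa>" if k: "\<kappa> \<in> comps" for \<kappa>
  proof -
    obtain a where a: "a \<in> \<kappa>" using comps_nonempty[OF k] by blast
    obtain d where d: "d \<in> \<phi> \<kappa>" using comps_nonempty[OF \<phi>(1)[OF k]] by blast
    have "f ` down a = down d"
      using \<phi>(2)[OF k] comp_down_eq[OF k a] comp_down_eq[OF \<phi>(1)[OF k] d] by simp
    then have "card (cls d) = card (cls a)"
      using card_cls[of a d] a d comps_subset[OF k] comps_subset[OF \<phi>(1)[OF k]] by blast
    then show ?thesis using comps_eq_cls[OF k a] comps_eq_cls[OF \<phi>(1)[OF k] d] by simp
  qed
  ultimately have "\<phi> \<in> carrier (aut_quotient S E)" using perm by (simp add: aut_quotient_def)
  then show ?thesis using that \<phi>(2) by blast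
qed

end

section \<open>Semilinear endomorphisms of the nilpotent Lie algebra of a graph\<close>

lemma permutes_eqI: "f permutes A \<Longrightarrow> g permutes A \<Longrightarrow> (\<And>x. x \<in> A \<Longrightarrow> f x = g x) \<Longrightarrow> f = g"
  by (metis ext permutes_not_in)

locale graph_nil = graph S E for S :: "'s set" and E +
  fixes c :: nat
  assumes c_gt_1: "c > 1"
begin

abbreviation N :: "(complex, ('s magma \<Rightarrow>\<^sub>0 complex) set set set) module" where
  "N \<equiv> nil_lie S E c"

abbreviation ver :: "'s \<Rightarrow> ('s magma \<Rightarrow>\<^sub>0 complex) set set set" where
  "ver \<equiv> vertex S E c"

abbreviation lower :: "nat \<Rightarrow> ('s magma \<Rightarrow>\<^sub>0 complex) set set set set" where
  "lower \<equiv> lower_central N"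

sublocale N: nilpotent_complex_lie N c
  by (intro nilpotent_complex_lie.intro complex_lie.intro nilpotent_complex_lie_axioms.intro
      nil_lie_lie nil_lie_nilpotent)

lemmas N_nonassoc = N.nonassoc_algebra_axioms

lemma N_vertex: "a \<in> S \<Longrightarrow> ver a \<in> carrier N" by (rule vertex_closed)

lemma semilinear_exists:
  assumes "field_hom \<theta>" "\<And>a. a \<in> S \<Longrightarrow> u a \<in> carrier N"
    and "\<And>a b. a \<in> S \<Longrightarrow> b \<in> S \<Longrightarrow> {a, b} \<notin> E \<Longrightarrow> u a \<otimes>\<^bsub>N\<^esub> u b = \<zero>\<^bsub>N\<^esub>"
  obtains F where "F \<in> alg_hom N (twist_scalars \<theta> N)" "\<And>a. a \<in> S \<Longrightarrow> F (ver a) = u a"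
proof (rule nil_lie_universal[OF N.twisted_lie[OF assms(1)], of S u E c])
  show "lower_central (twist_scalars \<theta> N) (c + 1) \<subseteq> {\<zero>\<^bsub>twist_scalars \<theta> N\<^esub>}"
    using lower_central_twist_scalars[OF N.lie_axioms assms(1), of "c + 1"] N.lower_top by auto
qed (use assms(2,3) that in auto)

lemma semilinear_eqI:
  assumes "field_hom \<theta>" "F \<in> alg_hom N (twist_scalars \<theta> N)" "G \<in> alg_hom N (twist_scalars \<theta> N)"
    and "\<And>a. a \<in> S \<Longrightarrow> F (ver a) = G (ver a)" "x \<in> carrier N"
  shows "F x = G x"
  by (rule nil_lie_hom_eqI[OF lie_nonassoc[OF N.twisted_lie[OF assms(1)]] assms(2,3,4,5)])

subsection \<open>Coordinates\<close>

text \<open>Taken from the universal property, as iterated cosets admit no usable formula; only the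
  two properties in the next lemma enter later.\<close>

definition model_map :: "('s magma \<Rightarrow>\<^sub>0 complex) set set set \<Rightarrow> ('s \<Rightarrow> complex) \<times> ('s \<times> 's \<Rightarrow> complex)" where
  "model_map = (SOME F. F \<in> alg_hom N (two_step E) \<and> (\<forall>a\<in>S. F (ver a) = (unit_fun a, \<lambda>_. 0)))"

lemma model_map: "model_map \<in> alg_hom N (two_step E)"
    "a \<in> S \<Longrightarrow> model_map (ver a) = (unit_fun a, \<lambda>_. 0)"
proof -
  have "edge_form E (unit_fun a) (unit_fun b) = (\<lambda>_. 0 :: complex)" if "{a, b} \<notin> E" for a b
  proof -
    have "{b, a} \<notin> E" using that by (simp add: insert_commute)
    then show ?thesis using that by (auto simp: edge_form_def unit_fun_def fun_eq_iff)
  qed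
  note rel = this
  have "\<exists>F. F \<in> alg_hom N (two_step E) \<and> (\<forall>a\<in>S. F (ver a) = (unit_fun a, \<lambda>_. 0))"
  proof (rule nil_lie_universal[OF two_step_lie _ _ two_step_nilpotent[OF c_gt_1],
        of S "\<lambda>a. (unit_fun a, \<lambda>_. 0)" E E])
    fix F assume "F \<in> alg_hom N (two_step E)" "\<And>a. a \<in> S \<Longrightarrow> F (ver a) = (unit_fun a, \<lambda>_. 0)"
    then show ?thesis by blast
  qed (simp_all add: rel)
  from someI_ex[OF this] show "model_map \<in> alg_hom N (two_step E)"
    "a \<in> S \<Longrightarrow> model_map (ver a) = (unit_fun a, \<lambda>_. 0)" by (auto simp: model_map_def)
qed

definition coord :: "('s magma \<Rightarrow>\<^sub>0 complex) set set set \<Rightarrow> 's \<Rightarrow> complex" where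
  "coord x = fst (model_map x)"

lemma coord_simps:
  "x \<in> carrier N \<Longrightarrow> y \<in> carrier N \<Longrightarrow> coord (x \<oplus>\<^bsub>N\<^esub> y) = (\<lambda>s. coord x s + coord y s)"
  "x \<in> carrier N \<Longrightarrow> coord (a \<odot>\<^bsub>N\<^esub> x) = (\<lambda>s. a * coord x s)"
  "x \<in> carrier N \<Longrightarrow> y \<in> carrier N \<Longrightarrow> coord (x \<otimes>\<^bsub>N\<^esub> y) = (\<lambda>_. 0)"
  "b \<in> S \<Longrightarrow> coord (ver b) = unit_fun b"
  by (simp_all add: coord_def alg_homD[OF model_map(1)] model_map(2))

lemma coord_zero: "coord \<zero>\<^bsub>N\<^esub> = (\<lambda>_. 0)"
  using coord_simps(3)[of "\<zero>\<^bsub>N\<^esub>" "\<zero>\<^bsub>N\<^esub>"] by simp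

text \<open>Here the two-step model certifies that brackets of adjacent vertices satisfy no
  unexpected relation; it is available because c > 1.\<close>

lemma mult_zero_commuting:
  assumes "x \<in> carrier N" "y \<in> carrier N" "x \<otimes>\<^bsub>N\<^esub> y = \<zero>\<^bsub>N\<^esub>" shows "commuting E (coord x) (coord y)"
proof -
  have "model_map \<zero>\<^bsub>N\<^esub> = (\<lambda>_. 0, \<lambda>_. 0)"
    using alg_hom_zero[OF N_nonassoc lie_nonassoc[OF two_step_lie] model_map(1)] by simp
  then have "edge_form E (coord x) (coord y) = (\<lambda>_. 0)"
    using assms(3) alg_homD(4)[OF model_map(1) assms(1,2)] by (simp add: coord_def)
  then show ?thesis by (simp add: edge_form_eq_0_iff)
qed

lemma coord_supported: "x \<in> carrier N \<Longrightarrow> coord x \<in> supported S"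
proof -
  assume x: "x \<in> carrier N"
  let ?U = "{x \<in> carrier N. coord x \<in> supported S}"
  have "subspace_of N ?U"
    by (rule subspace_ofI) (auto simp: coord_simps coord_zero supported_def, metis add_0)
  then have "x \<in> ?U"
    by (rule nil_lie_generated[OF _ _ _ x])
      (auto simp: coord_simps N_vertex, auto simp: supported_def)
  then show ?thesis by simp
qed

text \<open>A linear section of \<open>coord\<close>, with values in the span of the
  vertices.\<close>

definition lift :: "('s \<Rightarrow> complex) \<Rightarrow> ('s magma \<Rightarrow>\<^sub>0 complex) set set set" where
  "lift x = finsum N (\<lambda>a. x a \<odot>\<^bsub>N\<^esub> ver a) S"

lemma lift_closed [simp, intro]: "lift x \<in> carrier N"
  unfolding lift_def by (rule N.finsum_closed) (auto simp: N_vertex)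

lemma coord_finsum:
  assumes "finite A" "\<And>i. i \<in> A \<Longrightarrow> h i \<in> carrier N"
  shows "coord (finsum N h A) = (\<lambda>s. \<Sum>i\<in>A. coord (h i) s)"
  using assms by (induction A rule: finite_induct) (simp_all add: coord_zero coord_simps Pi_def)

lemma coord_lift: "x \<in> supported S \<Longrightarrow> coord (lift x) = x"
proof -
  assume x: "x \<in> supported S"
  have "coord (lift x) = (\<lambda>s. \<Sum>a\<in>S. coord (x a \<odot>\<^bsub>N\<^esub> ver a) s)"
    unfolding lift_def by (rule coord_finsum[OF finite_S]) (simp add: N_vertex)
  also have "\<dots> = (\<lambda>s. \<Sum>a\<in>S. x a * unit_fun a s)"
    by (intro ext sum.cong refl) (simp add: coord_simps N_vertex)
  also have "\<dots> = x"
    using x finite_S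
    by (auto simp: fun_eq_iff unit_fun_def sum.delta' supportedD if_distrib cong: if_cong)
  finally show ?thesis .
qed

lemma lift_add: "lift (\<lambda>s. x s + y s) = lift x \<oplus>\<^bsub>N\<^esub> lift y"
proof -
  have "lift (\<lambda>s. x s + y s) = finsum N (\<lambda>a. x a \<odot>\<^bsub>N\<^esub> ver a \<oplus>\<^bsub>N\<^esub> y a \<odot>\<^bsub>N\<^esub> ver a) S"
    unfolding lift_def by (rule N.finsum_eqI) (simp_all add: N_vertex N.smult_l_distr)
  also have "\<dots> = lift x \<oplus>\<^bsub>N\<^esub> lift y"
    unfolding lift_def by (rule N.finsum_addf) (auto simp: N_vertex)
  finally show ?thesis .
qed

lemma lift_scale: "lift (\<lambda>s. a * x s) = a \<odot>\<^bsub>N\<^esub> lift x"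
  unfolding lift_def
  by (subst N.finsum_smult) (auto simp: N_vertex N.smult_assoc finite_S intro!: N.finsum_eqI)

lemma lift_zero: "lift (\<lambda>_. 0) = \<zero>\<^bsub>N\<^esub>"
  using lift_scale[of 0 "\<lambda>_. 0"] by simp

lemma lift_unit: "b \<in> S \<Longrightarrow> lift (unit_fun b) = ver b"
proof -
  assume b: "b \<in> S"
  have "lift (unit_fun b) = finsum N (\<lambda>a. unit_fun b a \<odot>\<^bsub>N\<^esub> ver a) {b}"
    unfolding lift_def using b finite_S
    by (intro N.finsum_mono_neutral) (auto simp: N_vertex unit_fun_def)
  then show ?thesis using b by (simp add: N_vertex)
qed

lemma lower_2_coord: "x \<in> lower 2 \<Longrightarrow> coord x = (\<lambda>_. 0)"
proof -
  assume x: "x \<in> lower 2"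
  have "lower (Suc 1) \<subseteq> {x \<in> carrier N. coord x = (\<lambda>_. 0)}"
    by (rule N.lower_central_Suc_subset) (auto intro!: subspace_ofI simp: coord_simps coord_zero)
  then show ?thesis using x by (auto simp: numeral_2_eq_2)
qed

lemma mult_lower_2: "x \<in> carrier N \<Longrightarrow> y \<in> carrier N \<Longrightarrow> x \<otimes>\<^bsub>N\<^esub> y \<in> lower 2"
  using N.mult_lower_central[of 1 x y] by (simp add: numeral_2_eq_2)

lemma diff_lift_coord: "x \<in> carrier N \<Longrightarrow> x \<ominus>\<^bsub>N\<^esub> lift (coord x) \<in> lower 2"
proof -
  assume x: "x \<in> carrier N"
  let ?U = "{x \<in> carrier N. x \<ominus>\<^bsub>N\<^esub> lift (coord x) \<in> lower 2}"
  note s = subspace_ofD[OF N.lower_central_subspace[of 2]]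
  have "subspace_of N ?U"
  proof (rule subspace_ofI)
    fix x y a assume xy: "x \<in> ?U"
    have "a \<odot>\<^bsub>N\<^esub> x \<ominus>\<^bsub>N\<^esub> lift (coord (a \<odot>\<^bsub>N\<^esub> x)) = a \<odot>\<^bsub>N\<^esub> (x \<ominus>\<^bsub>N\<^esub> lift (coord x))"
      using xy by (simp add: coord_simps lift_scale N.minus_conv N.smult_r_distr N.smult_assoc)
    also have "\<dots> \<in> lower 2" using xy s by simp
    finally show "a \<odot>\<^bsub>N\<^esub> x \<in> ?U" using xy by simp
    assume y: "y \<in> ?U"
    have "x \<oplus>\<^bsub>N\<^esub> y \<ominus>\<^bsub>N\<^esub> lift (coord (x \<oplus>\<^bsub>N\<^esub> y)) =
        (x \<ominus>\<^bsub>N\<^esub> lift (coord x)) \<oplus>\<^bsub>N\<^esub> (y \<ominus>\<^bsub>N\<^esub> lift (coord y))"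
      using xy y by (simp add: coord_simps lift_add N.minus_conv N.smult_r_distr N.a_ac)
    also have "\<dots> \<in> lower 2" using xy y s by simp
    finally show "x \<oplus>\<^bsub>N\<^esub> y \<in> ?U" using xy y by simp
  qed (use s in \<open>auto simp: coord_zero lift_zero N.minus_conv\<close>)
  then have "x \<in> ?U"
    by (rule nil_lie_generated[OF _ _ _ x])
      (use s mult_lower_2 in \<open>auto simp: N_vertex lift_zero coord_simps lift_unit N.minus_conv
        N.smult_neg1 N.r_neg\<close>)
  then show ?thesis by simp
qed

lemma coord_decompose:
  assumes "x \<in> carrier N"
  obtains e where "e \<in> lower 2" "x = lift (coord x) \<oplus>\<^bsub>N\<^esub> e"
proof (rule that[OF diff_lift_coord[OF assms]])
  show "x = lift (coord x) \<oplus>\<^bsub>N\<^esub> (x \<ominus>\<^bsub>N\<^esub> lift (coord x))"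
    using assms by (simp add: N.minus_eq N.a_lcomm N.r_neg)
qed

lemma coord_zero_lower_2: "x \<in> carrier N \<Longrightarrow> coord x = (\<lambda>_. 0) \<Longrightarrow> x \<in> lower 2"
  using diff_lift_coord[of x] by (simp add: lift_zero N.minus_conv)

text \<open>Exchanging \<open>x\<close> and \<open>y\<close> leaves every summand of \<open>[lift x, lift y]\<close> fixed, so this bracket
  equals its own negative.\<close>

lemma commuting_lift:
  assumes "commuting E x y" shows "lift x \<otimes>\<^bsub>N\<^esub> lift y = \<zero>\<^bsub>N\<^esub>"
proof -
  let ?t = "\<lambda>x y a b. (x a * y b) \<odot>\<^bsub>N\<^esub> (ver a \<otimes>\<^bsub>N\<^esub> ver b)"
  have expand: "lift x \<otimes>\<^bsub>N\<^esub> lift y = finsum N (\<lambda>a. finsum N (\<lambda>b. ?t x y a b) S) S" for x y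
  proof -
    have "lift x \<otimes>\<^bsub>N\<^esub> lift y = finsum N (\<lambda>a. (x a \<odot>\<^bsub>N\<^esub> ver a) \<otimes>\<^bsub>N\<^esub> lift y) S"
      unfolding lift_def[of x] by (rule N.finsum_mult_right[OF finite_S]) (auto simp: N_vertex)
    also have "\<dots> = finsum N (\<lambda>a. finsum N (\<lambda>b. ?t x y a b) S) S"
    proof (rule N.finsum_eqI)
      fix a assume a: "a \<in> S"
      have "(x a \<odot>\<^bsub>N\<^esub> ver a) \<otimes>\<^bsub>N\<^esub> lift y = finsum N (\<lambda>b. (x a \<odot>\<^bsub>N\<^esub> ver a) \<otimes>\<^bsub>N\<^esub> (y b \<odot>\<^bsub>N\<^esub> ver b)) S"
        unfolding lift_def using a by (intro N.finsum_mult_left[OF finite_S]) (auto simp: N_vertex)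
      also have "\<dots> = finsum N (\<lambda>b. ?t x y a b) S"
        using a by (intro N.finsum_eqI)
          (simp_all add: N_vertex N.mult_smult_l N.mult_smult_r N.smult_assoc mult.commute)
      finally show "(x a \<odot>\<^bsub>N\<^esub> ver a) \<otimes>\<^bsub>N\<^esub> lift y = finsum N (\<lambda>b. ?t x y a b) S" .
    qed (auto simp: N_vertex intro!: N.finsum_closed)
    finally show ?thesis .
  qed
  have "?t x y a b = ?t y x a b" if ab: "a \<in> S" "b \<in> S" for a b
  proof (cases "{a, b} \<in> E")
    case True
    then have "x a * y b = x b * y a" using assms unfolding commuting_def by blast
    then show ?thesis by (simp add: mult.commute)
  next
    case False
    then show ?thesis by (simp add: vertex_mult_zero[OF ab])
  qed
  then have "lift x \<otimes>\<^bsub>N\<^esub> lift y = lift y \<otimes>\<^bsub>N\<^esub> lift x"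
    unfolding expand by (intro N.finsum_eqI) (auto simp: N_vertex intro!: N.finsum_closed)
  then have "lift x \<otimes>\<^bsub>N\<^esub> lift y = (- 1) \<odot>\<^bsub>N\<^esub> (lift x \<otimes>\<^bsub>N\<^esub> lift y)"
    using N.mult_anticomm[of "lift x" "lift y"] by simp
  then have "lift x \<otimes>\<^bsub>N\<^esub> lift y \<oplus>\<^bsub>N\<^esub> lift x \<otimes>\<^bsub>N\<^esub> lift y =
      (- 1) \<odot>\<^bsub>N\<^esub> (lift x \<otimes>\<^bsub>N\<^esub> lift y) \<oplus>\<^bsub>N\<^esub> lift x \<otimes>\<^bsub>N\<^esub> lift y" by metis
  also have "\<dots> = \<zero>\<^bsub>N\<^esub>" by (simp add: N.smult_neg1 N.l_neg)
  finally have "2 \<odot>\<^bsub>N\<^esub> (lift x \<otimes>\<^bsub>N\<^esub> lift y) = \<zero>\<^bsub>N\<^esub>"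
    using N.smult_l_distr[of "lift x \<otimes>\<^bsub>N\<^esub> lift y" 1 1] by simp
  then show ?thesis using N.smult_eq_zero[of "lift x \<otimes>\<^bsub>N\<^esub> lift y" 2] by simp
qed

subsection \<open>The induced automorphism of the quotient graph\<close>

text \<open>The map induced on V. By \<open>coord_semilinear\<close> it does not depend on the
  section \<open>lift\<close> when \<open>F\<close> is semilinear and multiplicative.\<close>

definition act :: "(('s magma \<Rightarrow>\<^sub>0 complex) set set set \<Rightarrow> ('s magma \<Rightarrow>\<^sub>0 complex) set set set) \<Rightarrow>
    ('s \<Rightarrow> complex) \<Rightarrow> 's \<Rightarrow> complex" where
  "act F x = coord (F (lift x))"

lemma coord_semilinear:
  assumes "field_hom \<theta>" "F \<in> alg_hom N (twist_scalars \<theta> N)" "x \<in> carrier N"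
  shows "coord (F x) = act F (coord x)"
proof -
  obtain e where e: "e \<in> lower 2" "x = lift (coord x) \<oplus>\<^bsub>N\<^esub> e" by (rule coord_decompose[OF assms(3)])
  have ec: "e \<in> carrier N" using e N.lower_central_closed by blast
  have "F x = F (lift (coord x)) \<oplus>\<^bsub>N\<^esub> F e"
    using e(2) ec N.semilinear_simps(1)[OF assms(2) lift_closed] by metis
  moreover have "coord (F e) = (\<lambda>_. 0)"
    using N.semilinear_lower[OF assms(1,2) _ e(1)] by (intro lower_2_coord) simp
  ultimately show ?thesis
    using N.semilinear_closed[OF assms(2)] ec by (simp add: coord_simps act_def)
qed

text \<open>Commuting coordinate vectors have lifts with bracket zero, homomorphisms preserve this,
  and the model reads it off again in coordinates.\<close>

lemma act_commuting_pair:
  assumes \<theta>: "field_aut \<theta> \<theta>'" and F: "F \<in> alg_hom N (twist_scalars \<theta> N)"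
    and G: "G \<in> alg_hom N (twist_scalars \<theta>' N)"
    and GF: "\<And>x. x \<in> carrier N \<Longrightarrow> G (F x) = x" and FG: "\<And>x. x \<in> carrier N \<Longrightarrow> F (G x) = x"
  shows "commuting_pair S E \<theta> \<theta>' (act F) (act G)"
proof -
  have h: "field_hom \<theta>" "field_hom \<theta>'" using \<theta> by (auto simp: field_aut_def)
  have cl: "act H x \<in> supported S"
    and ad: "act H (\<lambda>s. x s + y s) = (\<lambda>s. act H x s + act H y s)"
    and sc: "act H (\<lambda>s. a * x s) = (\<lambda>s. \<eta> a * act H x s)"
    and co: "commuting E x y \<Longrightarrow> commuting E (act H x) (act H y)"
    if H: "H \<in> alg_hom N (twist_scalars \<eta> N)" and \<eta>: "field_hom \<eta>" for H \<eta> x y a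
  proof -
    note c = N.semilinear_closed[OF H]
    show "act H x \<in> supported S" using c by (simp add: act_def coord_supported)
    show "act H (\<lambda>s. x s + y s) = (\<lambda>s. act H x s + act H y s)"
      using c by (simp add: act_def lift_add N.semilinear_simps[OF H] coord_simps)
    show "act H (\<lambda>s. a * x s) = (\<lambda>s. \<eta> a * act H x s)"
      using c by (simp add: act_def lift_scale N.semilinear_simps[OF H] coord_simps)
    assume "commuting E x y"
    then have "H (lift x \<otimes>\<^bsub>N\<^esub> lift y) = \<zero>\<^bsub>N\<^esub>" using commuting_lift N.semilinear_zero[OF \<eta> H] by simp
    then show "commuting E (act H x) (act H y)"
      using c by (simp add: act_def N.semilinear_simps[OF H] mult_zero_commuting)
  qed
  have inv: "act H' (act H x) = x" if "H \<in> alg_hom N (twist_scalars \<eta> N)" "field_hom \<eta>"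
    "H' \<in> alg_hom N (twist_scalars \<eta>' N)" "field_hom \<eta>'"
    "\<And>x. x \<in> carrier N \<Longrightarrow> H' (H x) = x" "x \<in> supported S" for H H' \<eta> \<eta>' x
  proof -
    have "act H' (act H x) = coord (H' (H (lift x)))"
      using coord_semilinear[OF that(4,3) N.semilinear_closed[OF that(1)]] by (simp add: act_def)
    then show ?thesis using that(5,6) coord_lift by simp
  qed
  show ?thesis
    by unfold_locales
      (use \<theta> cl[OF F h(1)] ad[OF F h(1)] sc[OF F h(1)] co[OF F h(1)]
        cl[OF G h(2)] ad[OF G h(2)] sc[OF G h(2)] co[OF G h(2)]
        inv[OF F h(1) G h(2) GF] inv[OF G h(2) F h(1) FG] in auto)
qed

text \<open>A relation instead of a function: existence, uniqueness and compatibility with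
  composition, proved below, make it a homomorphism to the automorphisms of the quotient
  graph.\<close>

definition induces :: "(('s magma \<Rightarrow>\<^sub>0 complex) set set set \<Rightarrow> ('s magma \<Rightarrow>\<^sub>0 complex) set set set) \<Rightarrow>
    ('s set \<Rightarrow> 's set) \<Rightarrow> bool" where
  "induces F \<phi> \<longleftrightarrow> \<phi> \<in> carrier (aut_quotient S E) \<and>
     (\<forall>\<kappa>\<in>comps. act F ` comp_down \<kappa> = comp_down (\<phi> \<kappa>))"

lemma aut_quotient_permutes: "\<phi> \<in> carrier (aut_quotient S E) \<Longrightarrow> \<phi> permutes comps"
  by (simp add: aut_quotient_def)

lemma aut_quotient_in: "\<phi> \<in> carrier (aut_quotient S E) \<Longrightarrow> \<kappa> \<in> comps \<Longrightarrow> \<phi> \<kappa> \<in> comps"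
  using aut_quotient_permutes permutes_in_image by metis

lemma induces_unique:
  assumes "induces F \<phi>" "induces F \<psi>" shows "\<phi> = \<psi>"
proof (rule permutes_eqI[of _ comps])
  fix \<kappa> assume k: "\<kappa> \<in> comps"
  have "comp_down (\<phi> \<kappa>) = comp_down (\<psi> \<kappa>)" using assms k by (auto simp: induces_def)
  moreover have "\<phi> \<in> carrier (aut_quotient S E)" "\<psi> \<in> carrier (aut_quotient S E)"
    using assms by (auto simp: induces_def)
  ultimately show "\<phi> \<kappa> = \<psi> \<kappa>"
    using k by (metis comp_down_inj aut_quotient_in)
qed (use assms aut_quotient_permutes in \<open>auto simp: induces_def\<close>)

lemma induces_exists:
  assumes "field_aut \<theta> \<theta>'" "F \<in> alg_hom N (twist_scalars \<theta> N)" "G \<in> alg_hom N (twist_scalars \<theta>' N)"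
    "\<And>x. x \<in> carrier N \<Longrightarrow> G (F x) = x" "\<And>x. x \<in> carrier N \<Longrightarrow> F (G x) = x"
  obtains \<phi> where "induces F \<phi>"
proof -
  interpret commuting_pair S E \<theta> \<theta>' "act F" "act G" by (rule act_commuting_pair[OF assms])
  show ?thesis
  proof (rule induced_automorphism)
    fix \<phi> assume "\<phi> \<in> carrier (aut_quotient S E)"
      "\<And>\<kappa>. \<kappa> \<in> comps \<Longrightarrow> act F ` comp_down \<kappa> = comp_down (\<phi> \<kappa>)"
    then have "induces F \<phi>" by (simp add: induces_def)
    then show ?thesis by (rule that)
  qed
qed

lemma aut_quotient_comp:
  assumes "\<phi> \<in> carrier (aut_quotient S E)" "\<psi> \<in> carrier (aut_quotient S E)"
  shows "\<phi> \<circ> \<psi> \<in> carrier (aut_quotient S E)"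
proof -
  have "\<phi> ` \<psi> ` e \<in> quotient_edges S E \<longleftrightarrow> e \<in> quotient_edges S E" if "e \<subseteq> comps" for e
  proof -
    have "\<psi> ` e \<subseteq> comps" using that aut_quotient_in[OF assms(2)] by blast
    then show ?thesis using assms that by (auto simp: aut_quotient_def)
  qed
  then have "\<forall>e. e \<subseteq> comps \<longrightarrow> (e \<in> quotient_edges S E \<longleftrightarrow> (\<phi> \<circ> \<psi>) ` e \<in> quotient_edges S E)"
    by (simp add: image_image)
  moreover have "card (\<phi> (\<psi> \<kappa>)) = card \<kappa>" if "\<kappa> \<in> comps" for \<kappa>
    using that assms aut_quotient_in[OF assms(2) that] by (simp add: aut_quotient_def)
  moreover have "\<phi> \<circ> \<psi> permutes comps"
    using assms by (intro permutes_compose aut_quotient_permutes)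
  ultimately show ?thesis by (simp add: aut_quotient_def)
qed

lemma induces_comp:
  assumes F: "induces F \<phi>" and G: "induces G \<psi>" "field_hom \<theta>'" "G \<in> alg_hom N (twist_scalars \<theta>' N)"
    and "F \<in> alg_hom N (twist_scalars \<theta> N)"
  shows "induces (\<lambda>x. G (F x)) (\<psi> \<circ> \<phi>)"
proof -
  have c: "\<phi> \<in> carrier (aut_quotient S E)" "\<psi> \<in> carrier (aut_quotient S E)"
    using F G by (auto simp: induces_def)
  have "act (\<lambda>x. G (F x)) x = act G (act F x)" for x
    using coord_semilinear[OF G(2,3) N.semilinear_closed[OF assms(5)]] by (simp add: act_def)
  then have "act (\<lambda>x. G (F x)) ` comp_down \<kappa> = act G ` act F ` comp_down \<kappa>" for \<kappa>
    by (simp add: image_image)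
  then show ?thesis
    using F G aut_quotient_comp[OF c(2,1)] aut_quotient_in[OF c(1)] by (auto simp: induces_def)
qed

end

section \<open>Lifting automorphisms of the quotient graph\<close>

context graph
begin

text \<open>Within or between components, adjacency of distinct vertices does not depend on the
  vertices chosen, by \<open>nonedge_dominated\<close>. For equal components this says that a loop
  marks a clique.\<close>

lemma quotient_edge_iff:
  assumes "\<kappa> \<in> comps" "\<mu> \<in> comps" "a \<in> \<kappa>" "b \<in> \<mu>" "a \<noteq> b"
  shows "{a, b} \<in> E \<longleftrightarrow> {\<kappa>, \<mu>} \<in> quotient_edges S E"
proof
  assume "{a, b} \<in> E"
  then show "{\<kappa>, \<mu>} \<in> quotient_edges S E" using assms unfolding quotient_edges_def by blast
next
  assume "{\<kappa>, \<mu>} \<in> quotient_edges S E"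
  then obtain \<kappa>' \<mu>' p q where "{\<kappa>, \<mu>} = {\<kappa>', \<mu>'}" "p \<in> \<kappa>'" "q \<in> \<mu>'" "{p, q} \<in> E"
    unfolding quotient_edges_def by blast
  then obtain p q where pq: "p \<in> \<kappa>" "q \<in> \<mu>" "{p, q} \<in> E"
    by (auto simp: doubleton_eq_iff insert_commute)
  have "dominated S E p a" "dominated S E q b"
    using pq comps_eq_cls[OF assms(1,3)] comps_eq_cls[OF assms(2,4)] by (auto simp: coherent_rel_iff)
  then show "{a, b} \<in> E" using nonedge_dominated[OF _ assms(5)] pq(3) by blast
qed

lemma aut_quotient_simps [simp]:
  "x \<otimes>\<^bsub>aut_quotient S E\<^esub> y = x \<circ> y" "\<one>\<^bsub>aut_quotient S E\<^esub> = id"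
  by (simp_all add: aut_quotient_def)

lemma aut_quotient_inverse:
  assumes "\<phi> \<in> carrier (aut_quotient S E)"
  obtains \<psi> where "\<psi> \<in> carrier (aut_quotient S E)" "\<psi> \<circ> \<phi> = id" "\<phi> \<circ> \<psi> = id"
proof -
  have p: "\<phi> permutes comps" using assms by (simp add: aut_quotient_def)
  let ?\<psi> = "inv_into UNIV \<phi>"
  have q: "?\<psi> permutes comps" using p by (rule permutes_inv)
  have in_comps: "?\<psi> \<kappa> \<in> comps" if "\<kappa> \<in> comps" for \<kappa> using permutes_in_image[OF q] that by simp
  have e: "e \<in> quotient_edges S E \<longleftrightarrow> ?\<psi> ` e \<in> quotient_edges S E" if "e \<subseteq> comps" for e
  proof -
    have "?\<psi> ` e \<subseteq> comps" using that in_comps by blast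
    then have "?\<psi> ` e \<in> quotient_edges S E \<longleftrightarrow> \<phi> ` ?\<psi> ` e \<in> quotient_edges S E"
      using assms by (simp add: aut_quotient_def)
    then show ?thesis by (simp add: image_image permutes_inverses(1)[OF p])
  qed
  have "card (?\<psi> \<kappa>) = card \<kappa>" if "\<kappa> \<in> comps" for \<kappa>
  proof -
    have "card (\<phi> (?\<psi> \<kappa>)) = card (?\<psi> \<kappa>)" using in_comps[OF that] assms by (simp add: aut_quotient_def)
    then show ?thesis by (simp add: permutes_inverses(1)[OF p])
  qed
  then have "?\<psi> \<in> carrier (aut_quotient S E)" using q e by (simp add: aut_quotient_def)
  then show ?thesis using that permutes_inv_o[OF p] by blast
qed

end

context graph_nil
begin

lemma aut_quotient_group: "group (aut_quotient S E)"
proof (rule groupI)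
  show "\<one>\<^bsub>aut_quotient S E\<^esub> \<in> carrier (aut_quotient S E)"
    by (simp add: aut_quotient_def permutes_id)
  fix x assume "x \<in> carrier (aut_quotient S E)"
  then show "\<exists>y\<in>carrier (aut_quotient S E). y \<otimes>\<^bsub>aut_quotient S E\<^esub> x = \<one>\<^bsub>aut_quotient S E\<^esub>"
    by (rule aut_quotient_inverse) auto
qed (auto intro: aut_quotient_comp)

end

locale graph_nil_ord = graph_nil S E c for S :: "'s set" and E and c +
  fixes enum :: "'s set \<Rightarrow> nat \<Rightarrow> 's"
  assumes ordering: "component_ordering S E enum"
begin

lemma enum_in: "\<kappa> \<in> comps \<Longrightarrow> j \<in> {1..card \<kappa>} \<Longrightarrow> enum \<kappa> j \<in> \<kappa>"
  using ordering bij_betwE unfolding component_ordering_def by blast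

lemma enum_S: "\<kappa> \<in> comps \<Longrightarrow> j \<in> {1..card \<kappa>} \<Longrightarrow> enum \<kappa> j \<in> S"
  using enum_in comps_subset by blast

lemma enum_cases:
  assumes "a \<in> S"
  obtains \<kappa> j where "\<kappa> \<in> comps" "j \<in> {1..card \<kappa>}" "a = enum \<kappa> j"
proof -
  have "enum (cls a) ` {1..card (cls a)} = cls a"
    using ordering cls_in[OF assms] by (auto simp: component_ordering_def bij_betw_def)
  then have "a \<in> enum (cls a) ` {1..card (cls a)}" using self_cls[OF assms] by simp
  then show ?thesis using that cls_in[OF assms] by blast
qed

lemma aut_card: "\<phi> \<in> carrier (aut_quotient S E) \<Longrightarrow> \<kappa> \<in> comps \<Longrightarrow> card (\<phi> \<kappa>) = card \<kappa>"
  by (simp add: aut_quotient_def)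

text \<open>The effect of i(\<phi>) on vertices: component by component, keeping the position in the
  chosen ordering.\<close>

definition vperm :: "('s set \<Rightarrow> 's set) \<Rightarrow> 's \<Rightarrow> 's" where
  "vperm \<phi> a = enum (\<phi> (cls a)) (inv_into {1..card (cls a)} (enum (cls a)) a)"

lemma vperm_enum:
  assumes "\<kappa> \<in> comps" "j \<in> {1..card \<kappa>}" shows "vperm \<phi> (enum \<kappa> j) = enum (\<phi> \<kappa>) j"
proof -
  have "cls (enum \<kappa> j) = \<kappa>" using comps_eq_cls[OF assms(1) enum_in[OF assms]] by simp
  moreover have "inj_on (enum \<kappa>) {1..card \<kappa>}"
    using ordering assms(1) by (auto simp: component_ordering_def bij_betw_def)
  ultimately show ?thesis using assms(2) by (simp add: vperm_def inv_into_f_f)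
qed

lemma vperm_S: "\<phi> \<in> carrier (aut_quotient S E) \<Longrightarrow> a \<in> S \<Longrightarrow> vperm \<phi> a \<in> S"
  by (erule enum_cases) (simp add: vperm_enum enum_S aut_quotient_in aut_card)

lemma vperm_comp:
  assumes "\<phi> \<in> carrier (aut_quotient S E)" "a \<in> S"
  shows "vperm \<psi> (vperm \<phi> a) = vperm (\<psi> \<circ> \<phi>) a"
  using assms(2) by (rule enum_cases)
    (use assms(1) in \<open>simp add: vperm_enum aut_quotient_in aut_card\<close>)

lemma vperm_id: "a \<in> S \<Longrightarrow> vperm id a = a"
  by (erule enum_cases) (simp add: vperm_enum)

text \<open>Adjacency is read off the quotient graph before and after \<phi>; two distinct images
  come from distinct vertices, so \<open>quotient_edge_iff\<close> applies on both sides.\<close>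

lemma vperm_nonedge:
  assumes \<phi>: "\<phi> \<in> carrier (aut_quotient S E)" and ab: "a \<in> S" "b \<in> S" "{a, b} \<notin> E"
  shows "{vperm \<phi> a, vperm \<phi> b} \<notin> E"
proof
  assume e: "{vperm \<phi> a, vperm \<phi> b} \<in> E"
  obtain \<kappa> j where a: "\<kappa> \<in> comps" "j \<in> {1..card \<kappa>}" "a = enum \<kappa> j" using ab(1) by (rule enum_cases)
  obtain \<mu> k where b: "\<mu> \<in> comps" "k \<in> {1..card \<mu>}" "b = enum \<mu> k" using ab(2) by (rule enum_cases)
  have ne: "vperm \<phi> a \<noteq> vperm \<phi> b" using edgeD(3)[OF e] .
  have c: "\<phi> \<kappa> \<in> comps" "\<phi> \<mu> \<in> comps" using a b aut_quotient_in[OF \<phi>] by auto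
  have "vperm \<phi> a \<in> \<phi> \<kappa>" "vperm \<phi> b \<in> \<phi> \<mu>"
    using a b c enum_in aut_card[OF \<phi>] by (simp_all add: vperm_enum)
  then have "{\<phi> \<kappa>, \<phi> \<mu>} \<in> quotient_edges S E" using quotient_edge_iff[OF c] ne e by blast
  then have "\<phi> ` {\<kappa>, \<mu>} \<in> quotient_edges S E" by simp
  then have "{\<kappa>, \<mu>} \<in> quotient_edges S E" using \<phi> a(1) b(1) unfolding aut_quotient_def by simp
  moreover have "a \<noteq> b" using ne by blast
  ultimately show False
    using quotient_edge_iff[OF a(1) b(1), of a b] ab(3) a b enum_in by simp
qed

lemma vperm_hom:
  assumes "\<phi> \<in> carrier (aut_quotient S E)"
  obtains F where "F \<in> alg_hom N N" "\<And>a. a \<in> S \<Longrightarrow> F (ver a) = ver (vperm \<phi> a)"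
proof (rule semilinear_exists[OF field_hom_simps(1), of "\<lambda>a. ver (vperm \<phi> a)"])
  fix a b assume "a \<in> S" "b \<in> S" "{a, b} \<notin> E"
  then show "ver (vperm \<phi> a) \<otimes>\<^bsub>N\<^esub> ver (vperm \<phi> b) = \<zero>\<^bsub>N\<^esub>"
    using assms by (intro vertex_mult_zero vperm_S vperm_nonedge)
qed (use assms that in \<open>auto intro: N_vertex vperm_S\<close>)

text \<open>Justifies the definite description in \<open>aut_lift\<close>: existence from the vertex
  permutations of \<phi> and its inverse, uniqueness because the orderings exhaust the generating
  vertices and the map is extensional.\<close>

lemma aut_lift_aux:
  assumes \<phi>: "\<phi> \<in> carrier (aut_quotient S E)"
  shows "aut_lift S E c enum \<phi> \<in> alg_iso N N \<and> aut_lift S E c enum \<phi> \<in> extensional (carrier N) \<and>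
    (\<forall>\<kappa>\<in>comps. \<forall>j\<in>{1..card \<kappa>}. aut_lift S E c enum \<phi> (ver (enum \<kappa> j)) = ver (enum (\<phi> \<kappa>) j))"
proof -
  obtain \<psi> where \<psi>: "\<psi> \<in> carrier (aut_quotient S E)" "\<psi> \<circ> \<phi> = id" "\<phi> \<circ> \<psi> = id"
    using aut_quotient_inverse[OF \<phi>] .
  obtain F where F: "F \<in> alg_hom N N" "\<And>a. a \<in> S \<Longrightarrow> F (ver a) = ver (vperm \<phi> a)"
    using vperm_hom[OF \<phi>] by blast
  obtain G where G: "G \<in> alg_hom N N" "\<And>a. a \<in> S \<Longrightarrow> G (ver a) = ver (vperm \<psi> a)"
    using vperm_hom[OF \<psi>(1)] by blast
  have id: "(\<lambda>x. x) \<in> alg_hom N N" by (auto simp: alg_hom_def)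
  have GF: "G (F x) = x" if "x \<in> carrier N" for x
    by (rule nil_lie_hom_eqI[OF N_nonassoc alg_hom_comp[OF F(1) G(1)] id _ that])
      (simp add: F(2) G(2) vperm_S \<phi> vperm_comp \<psi> vperm_id)
  have FG: "F (G x) = x" if "x \<in> carrier N" for x
    by (rule nil_lie_hom_eqI[OF N_nonassoc alg_hom_comp[OF G(1) F(1)] id _ that])
      (simp add: F(2) G(2) vperm_S vperm_comp \<psi> vperm_id)
  have "F \<in> alg_iso N N"
    by (rule alg_isoI[OF F(1) alg_homD(1)[OF G(1)] GF FG])
  then have "restrict F (carrier N) \<in> alg_iso N N"
    by (rule alg_iso_cong[OF _ N_nonassoc]) simp
  moreover have "restrict F (carrier N) (ver (enum \<kappa> j)) = ver (enum (\<phi> \<kappa>) j)"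
    if "\<kappa> \<in> comps" "j \<in> {1..card \<kappa>}" for \<kappa> j
    using F(2)[OF enum_S[OF that]] N_vertex[OF enum_S[OF that]] by (simp add: vperm_enum[OF that])
  ultimately have P: "restrict F (carrier N) \<in> alg_iso N N \<and>
    restrict F (carrier N) \<in> extensional (carrier N) \<and>
    (\<forall>\<kappa>\<in>comps. \<forall>j\<in>{1..card \<kappa>}. restrict F (carrier N) (ver (enum \<kappa> j)) = ver (enum (\<phi> \<kappa>) j))"
    by (simp only: restrict_extensional) blast
  have "\<exists>!f. f \<in> alg_iso N N \<and> f \<in> extensional (carrier N) \<and>
    (\<forall>\<kappa>\<in>comps. \<forall>j\<in>{1..card \<kappa>}. f (ver (enum \<kappa> j)) = ver (enum (\<phi> \<kappa>) j))"
  proof (rule ex1I[of _ "restrict F (carrier N)", rotated])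
    fix f assume f: "f \<in> alg_iso N N \<and> f \<in> extensional (carrier N) \<and>
      (\<forall>\<kappa>\<in>comps. \<forall>j\<in>{1..card \<kappa>}. f (ver (enum \<kappa> j)) = ver (enum (\<phi> \<kappa>) j))"
    show "f = restrict F (carrier N)"
    proof (rule extensionalityI[of _ "carrier N"])
      fix x assume x: "x \<in> carrier N"
      have "f x = F x"
      proof (rule nil_lie_hom_eqI[OF N_nonassoc _ F(1) _ x])
        fix a assume "a \<in> S"
        then obtain \<kappa> j where "\<kappa> \<in> comps" "j \<in> {1..card \<kappa>}" "a = enum \<kappa> j" by (rule enum_cases)
        then show "f (ver a) = F (ver a)" using f F(2) enum_S by (simp add: vperm_enum)
      qed (use f alg_iso_hom in blast)
      then show "f x = restrict F (carrier N) x" using x by simp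
    qed (use f in auto)
  qed (rule P)
  from theI'[OF this] show ?thesis unfolding aut_lift_def[symmetric] .
qed

lemma aut_lift:
  assumes \<phi>: "\<phi> \<in> carrier (aut_quotient S E)"
  shows "aut_lift S E c enum \<phi> \<in> alg_hom N N"
    "a \<in> S \<Longrightarrow> aut_lift S E c enum \<phi> (ver a) = ver (vperm \<phi> a)"
proof -
  show "aut_lift S E c enum \<phi> \<in> alg_hom N N" using aut_lift_aux[OF \<phi>] alg_iso_hom by blast
  assume "a \<in> S"
  then obtain \<kappa> j where "\<kappa> \<in> comps" "j \<in> {1..card \<kappa>}" "a = enum \<kappa> j" by (rule enum_cases)
  then show "aut_lift S E c enum \<phi> (ver a) = ver (vperm \<phi> a)"
    using aut_lift_aux[OF \<phi>] by (simp add: vperm_enum)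
qed

end

section \<open>Complex conjugation\<close>

context graph_nil
begin

abbreviation NR :: "(real, ('s magma \<Rightarrow>\<^sub>0 real) set set set) module" where
  "NR \<equiv> nil_lie S E c"

sublocale NR: lie NR by (rule nil_lie_lie)

lemma complexification_NR_lie: "lie (complexification NR)"
  by (rule complexification_lie[OF NR.lie_axioms])

text \<open>G comes from the complex universal property, F extends a map from the real one by (x, y)
  to F0 x + \<i> F0 y. They are mutually inverse by comparison on vertices.\<close>

lemma base_change_maps:
  obtains F G where "F \<in> alg_hom (complexification NR) N" "G \<in> alg_hom N (complexification NR)"
    "\<And>a. a \<in> S \<Longrightarrow> F (vertex S E c a, \<zero>\<^bsub>NR\<^esub>) = ver a" "\<And>a. a \<in> S \<Longrightarrow> G (ver a) = (vertex S E c a, \<zero>\<^bsub>NR\<^esub>)"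
    "\<And>x. x \<in> carrier (complexification NR) \<Longrightarrow> G (F x) = x" "\<And>x. x \<in> carrier N \<Longrightarrow> F (G x) = x"
proof -
  let ?C = "complexification NR"
  interpret C: lie ?C by (rule complexification_NR_lie)
  have lr: "lower_central (twist_scalars complex_of_real N) (c + 1) \<subseteq> {\<zero>\<^bsub>twist_scalars complex_of_real N\<^esub>}"
    using lower_central_twist_scalars[OF N.lie_axioms field_hom_simps(3), of "c + 1"] N.lower_top by auto
  have "\<exists>F0. F0 \<in> alg_hom NR (twist_scalars complex_of_real N) \<and> (\<forall>a\<in>S. F0 (vertex S E c a) = ver a)"
  proof (rule nil_lie_universal[OF N.twisted_lie[OF field_hom_simps(3)] _ _ lr, of S ver E])
    fix F assume "F \<in> alg_hom NR (twist_scalars complex_of_real N)" "\<And>a. a \<in> S \<Longrightarrow> F (vertex S E c a) = ver a"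
    then show ?thesis by blast
  qed (auto simp: N_vertex vertex_mult_zero)
  then obtain F0 where F0: "F0 \<in> alg_hom NR (twist_scalars complex_of_real N)"
    "\<And>a. a \<in> S \<Longrightarrow> F0 (vertex S E c a) = ver a" by blast
  have lc: "lower_central ?C (c + 1) \<subseteq> {\<zero>\<^bsub>?C\<^esub>}"
    using lower_central_complexification[OF NR.lie_axioms, of "c + 1"]
      nil_lie_nilpotent[of S E c, where ?'k = real] by auto
  have "\<exists>G. G \<in> alg_hom N ?C \<and> (\<forall>a\<in>S. G (ver a) = (vertex S E c a, \<zero>\<^bsub>NR\<^esub>))"
  proof (rule nil_lie_universal[OF complexification_NR_lie _ _ lc, of S "\<lambda>a. (vertex S E c a, \<zero>\<^bsub>NR\<^esub>)" E])
    fix F assume "F \<in> alg_hom N ?C" "\<And>a. a \<in> S \<Longrightarrow> F (ver a) = (vertex S E c a, \<zero>\<^bsub>NR\<^esub>)"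
    then show ?thesis by blast
  qed (simp_all add: vertex_closed vertex_mult_zero NR.minus_conv)
  then obtain G where G: "G \<in> alg_hom N ?C" "\<And>a. a \<in> S \<Longrightarrow> G (ver a) = (vertex S E c a, \<zero>\<^bsub>NR\<^esub>)" by blast
  note h = alg_homD[OF F0(1), simplified]
  define F where "F = (\<lambda>(x, y). F0 x \<oplus>\<^bsub>N\<^esub> \<i> \<odot>\<^bsub>N\<^esub> F0 y)"
  have F: "F \<in> alg_hom ?C N"
  proof (rule alg_homI)
    fix x y z assume x: "x \<in> carrier ?C"
    then show "F x \<in> carrier N" using h by (auto simp: F_def)
    show "F (z \<odot>\<^bsub>?C\<^esub> x) = z \<odot>\<^bsub>N\<^esub> F x"
    proof -
      have z: "z = complex_of_real (Re z) + \<i> * complex_of_real (Im z)" by (rule complex_eq)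
      obtain u v where [simp]: "x = (u, v)" by (cases x)
      have [simp]: "u \<in> carrier NR" "v \<in> carrier NR" using x by auto
      have "z \<odot>\<^bsub>N\<^esub> F x = (complex_of_real (Re z) + \<i> * complex_of_real (Im z)) \<odot>\<^bsub>N\<^esub> F x"
        using z by simp
      also have "\<dots> = F (z \<odot>\<^bsub>?C\<^esub> x)"
        by (simp add: F_def h NR.minus_conv N.smult_l_distr N.smult_r_distr N.smult_assoc N.a_ac
            mult.commute mult.left_commute distrib_left N.smult_diff)
      finally show ?thesis by simp
    qed
    assume y: "y \<in> carrier ?C"
    show "F (x \<oplus>\<^bsub>?C\<^esub> y) = F x \<oplus>\<^bsub>N\<^esub> F y"
      using x y h by (auto simp: F_def N.smult_r_distr N.a_ac)
    show "F (x \<otimes>\<^bsub>?C\<^esub> y) = F x \<otimes>\<^bsub>N\<^esub> F y"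
      using x y by (cases x; cases y) (simp add: F_def h NR.minus_conv N.smult_r_distr N.mult_l_distr
          N.mult_r_distr N.mult_smult_l N.mult_smult_r N.smult_assoc N.a_ac)
  qed
  have Fv: "F (vertex S E c a, \<zero>\<^bsub>NR\<^esub>) = ver a" if "a \<in> S" for a
  proof -
    have "F0 \<zero>\<^bsub>NR\<^esub> = \<zero>\<^bsub>N\<^esub>"
      using alg_hom_zero[OF NR.nonassoc_algebra_axioms lie_nonassoc[OF N.twisted_lie[OF field_hom_simps(3)]] F0(1)]
      by simp
    then show ?thesis using that by (simp add: F_def F0(2) N_vertex)
  qed
  have id: "(\<lambda>x. x) \<in> alg_hom N N" by (auto simp: alg_hom_def)
  have FG: "F (G x) = x" if "x \<in> carrier N" for x
    by (rule nil_lie_hom_eqI[OF N_nonassoc alg_hom_comp[OF G(1) F] id _ that])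
      (simp add: Fv G(2))
  \<comment> \<open>Vertices generate \<open>NR\<close> over the reals, so the composite is
    identified there first and then extended by linearity.\<close>
  have GF0: "G (F0 x) = (x, \<zero>\<^bsub>NR\<^esub>)" if "x \<in> carrier NR" for x
  proof -
    have l: "lie (twist_scalars complex_of_real ?C)"
      by (rule lie_twist_scalars[OF complexification_NR_lie field_hom_simps(3)])
    have 1: "(\<lambda>x. G (F0 x)) \<in> alg_hom NR (twist_scalars complex_of_real ?C)"
      by (rule alg_hom_comp[OF F0(1) alg_hom_twist[OF G(1)]])
    have 2: "(\<lambda>x. (x, \<zero>\<^bsub>NR\<^esub>)) \<in> alg_hom NR (twist_scalars complex_of_real ?C)"
      by (rule alg_homI) (simp_all add: NR.minus_conv)
    show ?thesis
      by (rule nil_lie_hom_eqI[OF lie_nonassoc[OF l] 1 2 _ that]) (simp add: F0(2) G(2))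
  qed
  have GF: "G (F x) = x" if x: "x \<in> carrier ?C" for x
  proof -
    obtain u v where [simp]: "x = (u, v)" by (cases x)
    have [simp]: "u \<in> carrier NR" "v \<in> carrier NR" using x by auto
    have "G (F x) = G (F0 u) \<oplus>\<^bsub>?C\<^esub> \<i> \<odot>\<^bsub>?C\<^esub> G (F0 v)"
      using h by (simp add: F_def alg_homD[OF G(1)] del: complexification_simps)
    then show ?thesis by (simp add: GF0 NR.minus_conv)
  qed
  show ?thesis using that[OF F G(1) Fv G(2) GF FG] .
qed

text \<open>Uniqueness is carried over from \<open>N\<close>, where the vertices generate, along the
  mutually inverse maps of \<open>base_change_maps\<close>.\<close>

lemma base_change_agree:
  assumes "F \<in> alg_hom (complexification NR) N" "F' \<in> alg_hom (complexification NR) N"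
    "\<And>a. a \<in> S \<Longrightarrow> F (vertex S E c a, \<zero>\<^bsub>NR\<^esub>) = F' (vertex S E c a, \<zero>\<^bsub>NR\<^esub>)"
    "x \<in> carrier (complexification NR)"
  shows "F x = F' x"
proof -
  obtain G H where G: "G \<in> alg_hom N (complexification NR)" "H \<in> alg_hom (complexification NR) N"
    "\<And>a. a \<in> S \<Longrightarrow> G (ver a) = (vertex S E c a, \<zero>\<^bsub>NR\<^esub>)"
    "\<And>x. x \<in> carrier (complexification NR) \<Longrightarrow> G (H x) = x"
    using base_change_maps by metis
  have "F (G y) = F' (G y)" if "y \<in> carrier N" for y
    by (rule nil_lie_hom_eqI[OF N_nonassoc alg_hom_comp[OF G(1) assms(1)] alg_hom_comp[OF G(1) assms(2)] _ that])
      (simp add: G(3) assms(3))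
  from this[of "H x"] show ?thesis using G(4)[OF assms(4)] alg_homD(1)[OF G(2) assms(4)] by simp
qed

text \<open>These two properties determine the conjugation; afterwards its definition by two choices
  is never opened again.\<close>

lemma nil_lie_conj:
  "nil_lie_conj S E c \<in> alg_hom N (twist_scalars cnj N)"
  "a \<in> S \<Longrightarrow> nil_lie_conj S E c (ver a) = ver a"
proof -
  let ?C = "complexification NR" and ?B = "nil_lie_base_change S E c"
  interpret C: lie ?C by (rule complexification_NR_lie)
  obtain F G where F: "F \<in> alg_hom ?C N" and G: "G \<in> alg_hom N ?C"
    and Fv: "\<And>a. a \<in> S \<Longrightarrow> F (vertex S E c a, \<zero>\<^bsub>NR\<^esub>) = ver a"
    and Gv: "\<And>a. a \<in> S \<Longrightarrow> G (ver a) = (vertex S E c a, \<zero>\<^bsub>NR\<^esub>)"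
    and GF: "\<And>x. x \<in> carrier ?C \<Longrightarrow> G (F x) = x" and FG: "\<And>x. x \<in> carrier N \<Longrightarrow> F (G x) = x"
    using base_change_maps by blast
  have "?B \<in> alg_iso ?C N \<and> ?B \<in> extensional (carrier ?C) \<and>
      (\<forall>a\<in>S. ?B (vertex S E c a, \<zero>\<^bsub>NR\<^esub>) = ver a)"
    unfolding nil_lie_base_change_def
  proof (rule theI'[OF ex1I[of _ "restrict F (carrier ?C)"]])
    have "F \<in> alg_iso ?C N" by (rule alg_isoI[OF F alg_homD(1)[OF G] GF FG])
    then have "restrict F (carrier ?C) \<in> alg_iso ?C N"
      by (rule alg_iso_cong[OF _ C.nonassoc_algebra_axioms]) simp
    then show "restrict F (carrier ?C) \<in> alg_iso ?C N \<and> restrict F (carrier ?C) \<in> extensional (carrier ?C) \<and>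
      (\<forall>a\<in>S. restrict F (carrier ?C) (vertex S E c a, \<zero>\<^bsub>NR\<^esub>) = ver a)"
      by (simp add: Fv vertex_closed)
    fix f assume f: "f \<in> alg_iso ?C N \<and> f \<in> extensional (carrier ?C) \<and>
      (\<forall>a\<in>S. f (vertex S E c a, \<zero>\<^bsub>NR\<^esub>) = ver a)"
    show "f = restrict F (carrier ?C)"
    proof (rule extensionalityI[of _ "carrier ?C"])
      fix x assume x: "x \<in> carrier ?C"
      have "f x = F x"
        using f Fv alg_iso_hom[of f] by (intro base_change_agree[OF _ F _ x]) auto
      then show "f x = restrict F (carrier ?C) x" using x by simp
    qed (use f in auto)
  qed
  then have B: "?B \<in> alg_iso ?C N" "\<And>a. a \<in> S \<Longrightarrow> ?B (vertex S E c a, \<zero>\<^bsub>NR\<^esub>) = ver a" by auto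
  have BF: "?B x = F x" if "x \<in> carrier ?C" for x
    using base_change_agree[OF alg_iso_hom[OF B(1)] F _ that] B(2) Fv by simp
  have "inv_into (carrier ?C) ?B x = G x" if "x \<in> carrier N" for x
  proof (rule inv_into_f_eq)
    show "inj_on ?B (carrier ?C)" using B(1) by (auto simp: alg_iso_def bij_betw_def)
    show "G x \<in> carrier ?C" using alg_homD(1)[OF G that] .
    then show "?B (G x) = x" using BF FG that by simp
  qed
  then have eq: "nil_lie_conj S E c x = F (complexification_conj NR (G x))" if "x \<in> carrier N" for x
    using that alg_homD(1)[OF complexification_conj_hom[OF NR.lie_axioms] alg_homD(1)[OF G that]]
    by (simp add: nil_lie_conj_def BF)
  have "(\<lambda>x. F (complexification_conj NR (G x))) \<in> alg_hom N (twist_scalars cnj N)"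
    by (rule alg_hom_comp[OF alg_hom_comp[OF G complexification_conj_hom[OF NR.lie_axioms]] alg_hom_twist[OF F]])
  then show "nil_lie_conj S E c \<in> alg_hom N (twist_scalars cnj N)"
    by (auto simp: alg_hom_def eq Pi_iff)
  show "nil_lie_conj S E c (ver a) = ver a" if "a \<in> S"
    using that by (simp add: eq N_vertex Gv complexification_conj_def NR.minus_smult Fv)
qed

end

section \<open>The degree derivation\<close>

context graph_nil
begin

text \<open>Vertices get degree one: over the dual numbers send a to a + t a. The first component of
  this homomorphism is the identity, and multiplicativity makes the second a derivation.\<close>

lemma grading_exists: obtains \<delta> where "N.grading \<delta>"
proof -
  let ?D = "pair_alg 0 N"
  interpret D: lie ?D by (rule N.pair_alg_lie)
  have ld: "lower_central ?D (c + 1) \<subseteq> {\<zero>\<^bsub>?D\<^esub>}"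
    using N.lower_central_pair_alg[of "c + 1" 0] N.lower_top by auto
  have "\<exists>F. F \<in> alg_hom N ?D \<and> (\<forall>a\<in>S. F (ver a) = (ver a, ver a))"
  proof (rule nil_lie_universal[OF N.pair_alg_lie _ _ ld, of S "\<lambda>a. (ver a, ver a)" E])
    fix F assume "F \<in> alg_hom N ?D" "\<And>a. a \<in> S \<Longrightarrow> F (ver a) = (ver a, ver a)"
    then show ?thesis by blast
  qed (simp_all add: N_vertex vertex_mult_zero)
  then obtain F where F: "F \<in> alg_hom N ?D" "\<And>a. a \<in> S \<Longrightarrow> F (ver a) = (ver a, ver a)" by blast
  have "fst \<in> alg_hom ?D N" by (rule alg_homI) auto
  then have "(\<lambda>x. fst (F x)) \<in> alg_hom N N" by (rule alg_hom_comp[OF F(1)])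
  moreover have "(\<lambda>x. x) \<in> alg_hom N N" by (auto simp: alg_hom_def)
  ultimately have fst: "fst (F x) = x" if "x \<in> carrier N" for x
    by (rule nil_lie_hom_eqI[OF N_nonassoc _ _ _ that]) (simp add: F(2))
  define \<delta> where "\<delta> x = snd (F x)" for x
  have Fx: "F x = (x, \<delta> x)" if "x \<in> carrier N" for x using fst[OF that] by (simp add: \<delta>_def prod_eq_iff)
  note h = alg_homD[OF F(1)]
  have cl: "\<delta> x \<in> carrier N" if "x \<in> carrier N" for x
    using h(1)[OF that] by (simp add: Fx that)
  have ad: "\<delta> (x \<oplus>\<^bsub>N\<^esub> y) = \<delta> x \<oplus>\<^bsub>N\<^esub> \<delta> y" if "x \<in> carrier N" "y \<in> carrier N" for x y
    using h(2)[OF that] that by (simp add: Fx)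
  have sm: "\<delta> (a \<odot>\<^bsub>N\<^esub> x) = a \<odot>\<^bsub>N\<^esub> \<delta> x" if "x \<in> carrier N" for x a
    using h(3)[OF that] that by (simp add: Fx)
  have lb: "\<delta> (x \<otimes>\<^bsub>N\<^esub> y) = \<delta> x \<otimes>\<^bsub>N\<^esub> y \<oplus>\<^bsub>N\<^esub> x \<otimes>\<^bsub>N\<^esub> \<delta> y" if "x \<in> carrier N" "y \<in> carrier N" for x y
    using h(4)[OF that] that by (simp add: Fx cl N.a_comm)
  have "\<delta> x \<ominus>\<^bsub>N\<^esub> x \<in> lower 2" if x: "x \<in> carrier N" for x
  proof -
    let ?U = "{x \<in> carrier N. \<delta> x \<ominus>\<^bsub>N\<^esub> x \<in> lower 2}"
    have z: "\<delta> \<zero>\<^bsub>N\<^esub> = \<zero>\<^bsub>N\<^esub>" using sm[of "\<zero>\<^bsub>N\<^esub>" 0] cl by simp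
    have "subspace_of N ?U"
    proof (rule subspace_ofI)
      fix x y a assume x: "x \<in> ?U"
      have "\<delta> (a \<odot>\<^bsub>N\<^esub> x) \<ominus>\<^bsub>N\<^esub> a \<odot>\<^bsub>N\<^esub> x = a \<odot>\<^bsub>N\<^esub> (\<delta> x \<ominus>\<^bsub>N\<^esub> x)"
        using x by (simp add: sm cl N.minus_conv N.smult_r_distr N.smult_assoc)
      then show "a \<odot>\<^bsub>N\<^esub> x \<in> ?U" using x N.lower_closed by simp
      assume y: "y \<in> ?U"
      have "\<delta> (x \<oplus>\<^bsub>N\<^esub> y) \<ominus>\<^bsub>N\<^esub> (x \<oplus>\<^bsub>N\<^esub> y) = (\<delta> x \<ominus>\<^bsub>N\<^esub> x) \<oplus>\<^bsub>N\<^esub> (\<delta> y \<ominus>\<^bsub>N\<^esub> y)"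
        using x y by (simp add: ad cl N.minus_conv N.smult_r_distr N.a_ac)
      then show "x \<oplus>\<^bsub>N\<^esub> y \<in> ?U" using x y N.lower_closed by simp
    qed (use N.lower_closed z in \<open>auto simp: N.minus_conv\<close>)
    then have "x \<in> ?U"
    proof (rule nil_lie_generated[OF _ _ _ x])
      fix x y assume "x \<in> ?U" "y \<in> ?U"
      then show "x \<otimes>\<^bsub>N\<^esub> y \<in> ?U"
        using cl by (simp add: lb mult_lower_2 N.lower_closed N.lower_diff)
    next
      fix a assume a: "a \<in> S"
      have "\<delta> (ver a) = ver a" using F(2)[OF a] by (simp add: \<delta>_def)
      then show "ver a \<in> ?U" using a N.lower_closed by (simp add: N_vertex N.minus_conv N.smult_neg1 N.r_neg)
    qed
    then show ?thesis by simp
  qed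
  then have "N.grading \<delta>" using cl ad sm lb by (simp add: N.grading_def)
  then show ?thesis by (rule that)
qed

lemma coord_diff: "x \<in> carrier N \<Longrightarrow> y \<in> carrier N \<Longrightarrow> coord (x \<ominus>\<^bsub>N\<^esub> y) = (\<lambda>s. coord x s - coord y s)"
  by (simp add: N.minus_conv coord_simps)

text \<open>The bracket of two vectors of degree one has degree two, so it vanishes as soon as it lies
  in the third term of the lower central series.\<close>

lemma degree_one_commuting:
  assumes \<delta>: "N.grading \<delta>" and u: "u \<in> carrier N" "\<delta> u = u" and v: "v \<in> carrier N" "\<delta> v = v"
    and uv: "commuting E (coord u) (coord v)"
  shows "u \<otimes>\<^bsub>N\<^esub> v = \<zero>\<^bsub>N\<^esub>"
proof -
  obtain e where e: "e \<in> lower 2" "u = lift (coord u) \<oplus>\<^bsub>N\<^esub> e" by (rule coord_decompose[OF u(1)])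
  obtain e' where e': "e' \<in> lower 2" "v = lift (coord v) \<oplus>\<^bsub>N\<^esub> e'" by (rule coord_decompose[OF v(1)])
  have c: "e \<in> carrier N" "e' \<in> carrier N" using e e' N.lower_in_carrier by auto
  have "u \<otimes>\<^bsub>N\<^esub> v = (lift (coord u) \<oplus>\<^bsub>N\<^esub> e) \<otimes>\<^bsub>N\<^esub> (lift (coord v) \<oplus>\<^bsub>N\<^esub> e')"
    using e(2) e'(2) by simp
  also have "\<dots> = lift (coord u) \<otimes>\<^bsub>N\<^esub> e' \<oplus>\<^bsub>N\<^esub> e \<otimes>\<^bsub>N\<^esub> (lift (coord v) \<oplus>\<^bsub>N\<^esub> e')"
    using c commuting_lift[OF uv] by (simp add: N.mult_l_distr N.mult_r_distr N.a_lcomm)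
  also have "\<dots> \<in> lower 3"
  proof (rule N.lower_closed(2))
    show "lift (coord u) \<otimes>\<^bsub>N\<^esub> e' \<in> lower 3"
      using N.mult_lower_central[of 2 "lift (coord u)" e'] e'(1) by (simp add: numeral_3_eq_3 numeral_2_eq_2)
    show "e \<otimes>\<^bsub>N\<^esub> (lift (coord v) \<oplus>\<^bsub>N\<^esub> e') \<in> lower 3"
      using N.mult_lower_central_2[of 1 e "lift (coord v) \<oplus>\<^bsub>N\<^esub> e'"] e(1) c
      by (simp add: numeral_3_eq_3)
  qed
  finally have "u \<otimes>\<^bsub>N\<^esub> v \<in> lower 3" .
  moreover have "\<delta> (u \<otimes>\<^bsub>N\<^esub> v) = of_nat 2 \<odot>\<^bsub>N\<^esub> (u \<otimes>\<^bsub>N\<^esub> v)"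
    using u v N.smult_l_distr[of "u \<otimes>\<^bsub>N\<^esub> v" 1 1] by (simp add: N.gradingD(4)[OF \<delta>])
  ultimately show ?thesis by (intro N.grading_eigen_zero[OF \<delta>, of _ 3 2]) auto
qed

text \<open>Distinct nonadjacent vertices have images that commute on V by
  \<open>commuting_down\<close>, and degree one makes their bracket vanish exactly. The case a = b
  is separate since domination says nothing about it.\<close>

lemma triangular_hom:
  assumes \<delta>: "N.grading \<delta>" and u: "\<And>a. a \<in> S \<Longrightarrow> u a \<in> carrier N" "\<And>a. a \<in> S \<Longrightarrow> \<delta> (u a) = u a"
    "\<And>a. a \<in> S \<Longrightarrow> coord (u a) \<in> down a"
  obtains g where "g \<in> alg_hom N N" "\<And>a. a \<in> S \<Longrightarrow> g (ver a) = u a"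
proof (rule semilinear_exists[OF field_hom_simps(1), of u])
  fix a b assume ab: "a \<in> S" "b \<in> S" "{a, b} \<notin> E"
  show "u a \<otimes>\<^bsub>N\<^esub> u b = \<zero>\<^bsub>N\<^esub>"
  proof (cases "a = b")
    case True
    then show ?thesis using N.mult_self u(1) ab by simp
  next
    case False
    then show ?thesis using ab u
      by (intro degree_one_commuting[OF \<delta>] commuting_down[of a b]) auto
  qed
qed (use u that in auto)

end

section \<open>Semilinear involutions\<close>

context graph_nil
begin

lemma induces_cong:
  assumes "induces F \<phi>" "\<And>x. x \<in> carrier N \<Longrightarrow> F x = G x" shows "induces G \<phi>"
proof -
  have "act F = act G" by (intro ext) (simp add: act_def assms(2))
  then show ?thesis using assms(1) by (simp add: induces_def)
qed

lemma induces_id: "induces (\<lambda>x. x) id"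
proof -
  have "act (\<lambda>x. x) ` comp_down \<kappa> = comp_down \<kappa>" if "\<kappa> \<in> comps" for \<kappa>
  proof -
    have "act (\<lambda>x. x) ` comp_down \<kappa> = (\<lambda>x. x) ` comp_down \<kappa>"
      using comp_down_supported[OF that] by (intro image_cong) (auto simp: act_def coord_lift)
    then show ?thesis by simp
  qed
  then show ?thesis using group.is_monoid[OF aut_quotient_group] monoid.one_closed
    by (fastforce simp: induces_def)
qed

lemma comp_down_unit_subset:
  assumes "\<kappa> \<in> comps" "\<mu> \<in> comps" "a \<in> \<kappa>" "unit_fun a \<in> comp_down \<mu>"
  shows "comp_down \<kappa> \<subseteq> comp_down \<mu>"
proof -
  obtain d where d: "d \<in> \<mu>" using comps_nonempty[OF assms(2)] by blast
  have "dominated S E a d" using assms(4) comp_down_eq[OF assms(2) d] by simp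
  then show ?thesis using down_mono comp_down_eq[OF assms(2) d] comp_down_eq[OF assms(1,3)] by simp
qed

lemma unit_comp_down: "\<kappa> \<in> comps \<Longrightarrow> a \<in> \<kappa> \<Longrightarrow> unit_fun a \<in> comp_down \<kappa>"
  using comps_subset[of \<kappa>] by (simp add: comp_down_eq dominated_refl subset_iff)

lemma act_vertex: "a \<in> S \<Longrightarrow> F (ver a) = ver b \<Longrightarrow> b \<in> S \<Longrightarrow> act F (unit_fun a) = unit_fun b"
  by (simp add: act_def lift_unit coord_simps)

end

context graph_nil_ord
begin

text \<open>The image of a component subspace is again one, and it contains a vertex of \<phi>
  \<kappa>, which gives one inclusion. The same reasoning for the inverse gives the other.\<close>

lemma induces_vperm:
  assumes \<phi>: "\<phi> \<in> carrier (aut_quotient S E)" and \<theta>: "field_aut \<theta> \<theta>'"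
    and F: "F \<in> alg_hom N (twist_scalars \<theta> N)" and G: "G \<in> alg_hom N (twist_scalars \<theta>' N)"
    and GF: "\<And>x. x \<in> carrier N \<Longrightarrow> G (F x) = x" and FG: "\<And>x. x \<in> carrier N \<Longrightarrow> F (G x) = x"
    and Fv: "\<And>a. a \<in> S \<Longrightarrow> F (ver a) = ver (vperm \<phi> a)"
  shows "induces F \<phi>"
proof -
  interpret P: commuting_pair S E \<theta> \<theta>' "act F" "act G" by (rule act_commuting_pair[OF \<theta> F G GF FG])
  interpret Q: commuting_pair S E \<theta>' \<theta> "act G" "act F" by (rule P.flip)
  have "act F ` comp_down \<kappa> = comp_down (\<phi> \<kappa>)" if k: "\<kappa> \<in> comps" for \<kappa>
  proof -
    have pk: "\<phi> \<kappa> \<in> comps" using aut_quotient_in[OF \<phi> k] .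
    obtain a where a: "a \<in> \<kappa>" using comps_nonempty[OF k] by blast
    have aS: "a \<in> S" using a comps_subset[OF k] by blast
    have vS: "vperm \<phi> a \<in> S" using vperm_S[OF \<phi> aS] .
    have va: "vperm \<phi> a \<in> \<phi> \<kappa>"
    proof -
      obtain \<mu> j where m: "\<mu> \<in> comps" "j \<in> {1..card \<mu>}" "a = enum \<mu> j" using aS by (rule enum_cases)
      then have "\<mu> = \<kappa>" using comps_eq_cls[OF k a] comps_eq_cls[OF m(1)] enum_in by metis
      then show ?thesis using m pk enum_in aut_card[OF \<phi> k] by (simp add: vperm_enum)
    qed
    have u: "act F (unit_fun a) = unit_fun (vperm \<phi> a)" using act_vertex[of a F] aS Fv vS by simp
    obtain \<mu> where mu: "\<mu> \<in> comps" "act F ` comp_down \<kappa> = comp_down \<mu>" using P.comp_image[OF k] by blast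
    obtain \<nu> where nu: "\<nu> \<in> comps" "act G ` comp_down (\<phi> \<kappa>) = comp_down \<nu>" using Q.comp_image[OF pk] by blast
    have "unit_fun (vperm \<phi> a) \<in> comp_down \<mu>"
      using mu(2) u unit_comp_down[OF k a] by (metis imageI)
    then have 1: "comp_down (\<phi> \<kappa>) \<subseteq> comp_down \<mu>" using comp_down_unit_subset[OF pk mu(1) va] by simp
    have "act G (unit_fun (vperm \<phi> a)) = unit_fun a" using P.gf[of "unit_fun a"] aS u by simp
    then have "unit_fun a \<in> comp_down \<nu>" using nu(2) unit_comp_down[OF pk va] by (metis imageI)
    then have "comp_down \<kappa> \<subseteq> comp_down \<nu>" using comp_down_unit_subset[OF k nu(1) a] by simp
    then have "comp_down \<mu> \<subseteq> comp_down (\<phi> \<kappa>)"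
      using mu(2) Q.g_comp_image[OF pk nu(2)] by (metis image_mono)
    then show ?thesis using 1 mu(2) by simp
  qed
  then show ?thesis using \<phi> by (simp add: induces_def)
qed

definition std_conj :: "('s set \<Rightarrow> 's set) \<Rightarrow>
    ('s magma \<Rightarrow>\<^sub>0 complex) set set set \<Rightarrow> ('s magma \<Rightarrow>\<^sub>0 complex) set set set" where
  "std_conj \<phi> x = aut_lift S E c enum \<phi> (nil_lie_conj S E c x)"

context
  fixes \<phi> assumes \<phi>: "\<phi> \<in> carrier (aut_quotient S E)"
begin

lemma std_conj_hom: "std_conj \<phi> \<in> alg_hom N (twist_scalars cnj N)"
  unfolding std_conj_def[abs_def]
  by (rule alg_hom_comp[OF nil_lie_conj(1) alg_hom_twist[OF aut_lift(1)[OF \<phi>]]])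

lemma std_conj_vertex: "a \<in> S \<Longrightarrow> std_conj \<phi> (ver a) = ver (vperm \<phi> a)"
  by (simp add: std_conj_def nil_lie_conj(2) aut_lift(2)[OF \<phi>])

lemma std_conj_involution:
  assumes "\<phi> \<circ> \<phi> = id" "x \<in> carrier N" shows "std_conj \<phi> (std_conj \<phi> x) = x"
proof (rule nil_lie_hom_eqI[OF N_nonassoc _ _ _ assms(2)])
  show "(\<lambda>x. std_conj \<phi> (std_conj \<phi> x)) \<in> alg_hom N N"
    using alg_hom_twist_comp[OF std_conj_hom std_conj_hom] by simp
  show "(\<lambda>x. x) \<in> alg_hom N N" by (auto simp: alg_hom_def)
qed (simp add: std_conj_vertex vperm_S[OF \<phi>] vperm_comp[OF \<phi>] assms(1) vperm_id)

lemma induces_std_conj: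
  assumes "\<phi> \<circ> \<phi> = id" shows "induces (std_conj \<phi>) \<phi>"
  by (rule induces_vperm[OF \<phi> field_aut_simps(2) std_conj_hom std_conj_hom
      std_conj_involution[OF assms] std_conj_involution[OF assms] std_conj_vertex])

end

lemma coord_linear_eq:
  assumes h: "h \<in> alg_hom N N" and T: "T (\<lambda>_. 0) = (\<lambda>_. 0)"
    "\<And>x y. x \<in> supported S \<Longrightarrow> y \<in> supported S \<Longrightarrow> T (\<lambda>s. x s + y s) = (\<lambda>s. T x s + T y s)"
    "\<And>a x. x \<in> supported S \<Longrightarrow> T (\<lambda>s. a * x s) = (\<lambda>s. a * T x s)"
    and v: "\<And>a. a \<in> S \<Longrightarrow> coord (h (ver a)) = T (unit_fun a)" and x: "x \<in> carrier N"
  shows "coord (h x) = T (coord x)"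
proof -
  note H = alg_homD[OF h]
  let ?U = "{x \<in> carrier N. coord (h x) = T (coord x)}"
  have "subspace_of N ?U"
    using alg_hom_zero[OF N_nonassoc N_nonassoc h]
    by (intro subspace_ofI) (auto simp: H coord_simps coord_zero T coord_supported)
  then have "x \<in> ?U"
    by (rule nil_lie_generated[OF _ _ _ x]) (auto simp: H coord_simps v T N_vertex)
  then show ?thesis by simp
qed

text \<open>With \<open>h = \<sigma> \<circ> std_conj \<phi>\<close> the map \<open>T = z + cnj z h\<close> intertwines \<open>std_conj \<phi>\<close> with \<open>\<sigma>\<close>
  (Hilbert 90), and for suitable \<open>z\<close> it is invertible modulo the commutator. Pushing the images of
  the vertices under \<open>T\<close> into the degree one part of a \<open>\<sigma>\<close>-invariant grading turns \<open>T\<close> into an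
  automorphism.\<close>

theorem semilinear_involution_standard:
  assumes \<sigma>: "\<sigma> \<in> alg_hom N (twist_scalars cnj N)" and inv: "\<And>x. x \<in> carrier N \<Longrightarrow> \<sigma> (\<sigma> x) = x"
  obtains \<phi> g where "\<phi> \<in> carrier (aut_quotient S E)" "\<phi> \<circ> \<phi> = id" "g \<in> alg_iso N N"
    "\<And>x. x \<in> carrier N \<Longrightarrow> \<sigma> (g x) = g (std_conj \<phi> x)"
proof -
  note sc = N.semilinear_closed[OF \<sigma>] and ss = N.semilinear_simps[OF \<sigma>]
  obtain \<phi> where ind: "induces \<sigma> \<phi>" using induces_exists[OF field_aut_simps(2) \<sigma> \<sigma> inv inv] .
  then have \<phi>: "\<phi> \<in> carrier (aut_quotient S E)" by (simp add: induces_def)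
  have "induces (\<lambda>x. \<sigma> (\<sigma> x)) (\<phi> \<circ> \<phi>)" by (rule induces_comp[OF ind ind field_hom_simps(2) \<sigma> \<sigma>])
  then have "induces (\<lambda>x. x) (\<phi> \<circ> \<phi>)" by (rule induces_cong) (rule inv)
  then have \<phi>2: "\<phi> \<circ> \<phi> = id" using induces_id by (rule induces_unique)
  let ?s = "std_conj \<phi>"
  note std = std_conj_hom[OF \<phi>] and stdv = std_conj_vertex[OF \<phi>]
  have std_c: "?s x \<in> carrier N" if "x \<in> carrier N" for x using N.semilinear_closed[OF std that] .
  define h where "h x = \<sigma> (?s x)" for x
  have h: "h \<in> alg_hom N N" using alg_hom_twist_comp[OF std \<sigma>] by (simp add: h_def[abs_def])
  have hi: "h \<in> alg_hom N (twist_scalars (\<lambda>a. a) N)" using h by simp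
  note H = alg_homD[OF h]
  \<comment> \<open>Both factors of h induce \<phi>, so h induces the identity and stabilises each
    \<open>down a\<close>.\<close>
  have "induces h (\<phi> \<circ> \<phi>)" unfolding h_def[abs_def]
    by (rule induces_comp[OF induces_std_conj[OF \<phi> \<phi>2] ind field_hom_simps(2) \<sigma> std])
  then have hk: "act h ` comp_down \<kappa> = comp_down \<kappa>" if "\<kappa> \<in> comps" for \<kappa>
    using that by (simp add: induces_def \<phi>2)
  have hd: "act h y \<in> down a" if "a \<in> S" "y \<in> down a" for a y
    using hk[OF cls_in[OF that(1)]] comp_down_eq[OF cls_in[OF that(1)] self_cls[OF that(1)]] that(2) by blast
  interpret L: supported_linear S "act h"
    by unfold_locales
      (auto simp: finite_S act_def H coord_supported lift_add lift_scale coord_simps)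
  obtain z r where z: "z \<noteq> 0"
    and r: "\<And>x s. x \<in> supported S \<Longrightarrow> L.poly_apply r (\<lambda>s. z * x s + cnj z * act h x s) s = x s"
    using L.generic_inverse by blast
  define T where "T x = (\<lambda>s. z * x s + cnj z * act h x s)" for x
  define R where "R = L.poly_apply r"
  have RT: "R (T x) = x" if "x \<in> supported S" for x
    unfolding R_def T_def by (rule ext) (rule r[OF that])
  have Tc: "T x \<in> supported S" if "x \<in> supported S" for x
  proof -
    have "T x s = 0" if "s \<notin> S" for s
      using supportedD(2)[OF \<open>x \<in> supported S\<close> that] supportedD(2)[OF L.closed[OF \<open>x \<in> supported S\<close>] that]
      by (simp add: T_def)
    then show ?thesis unfolding supported_def by blast
  qed
  have Rc: "R x \<in> supported S" if "x \<in> supported S" for x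
    unfolding R_def using L.poly_apply_closed[OF that] .
  have TR: "T (R x) = x" if x: "x \<in> supported S" for x
  proof -
    \<comment> \<open>Both are polynomials in \<open>act h\<close> and hence commute, which makes
      the left inverse two-sided.\<close>
    have "T (R x) = R (T x)"
      unfolding T_def R_def L.f_poly_apply[OF x]
      by (rule ext) (rule L.poly_apply_lin[OF x L.closed[OF x], symmetric])
    then show ?thesis using RT[OF x] by simp
  qed
  have Td: "T (unit_fun a) \<in> down a" if a: "a \<in> S" for a
  proof -
    have "unit_fun a \<in> down a" "act h (unit_fun a) \<in> down a" using a hd dominated_refl by simp_all
    then have "unit_fun a s = (0::complex)" "act h (unit_fun a) s = 0" if "\<not> dominated S E s a" for s
      using that unfolding down_def supported_def by blast+
    then have "T (unit_fun a) s = 0" if "\<not> dominated S E s a" for s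
      using that unfolding T_def by simp
    then show ?thesis unfolding down_def supported_def by blast
  qed
  have Rd: "R (unit_fun a) \<in> down a" if a: "a \<in> S" for a
    using L.poly_apply_stable[of "{b. dominated S E b a}" "unit_fun a" r] hd[OF a] dominated_refl[OF a]
    by (simp add: R_def down_def)
  obtain \<delta> where \<delta>: "N.grading \<delta>" "\<And>x. x \<in> carrier N \<Longrightarrow> \<sigma> (\<delta> x) = \<delta> (\<sigma> x)"
    using grading_exists N.grading_average[OF _ \<sigma> inv] by metis
  \<comment> \<open>Projection to degree one. Such a representative is unique, so \<open>P\<close>
    commutes with \<sigma> because \<delta> does.\<close>
  define P where "P x = (SOME u. u \<in> carrier N \<and> \<delta> u = u \<and> u \<ominus>\<^bsub>N\<^esub> x \<in> lower 2)" for x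
  have P: "P x \<in> carrier N" "\<delta> (P x) = P x" "coord (P x) = coord x" if "x \<in> carrier N" for x
  proof -
    have *: "P x \<in> carrier N" "\<delta> (P x) = P x" "P x \<ominus>\<^bsub>N\<^esub> x \<in> lower 2"
      using someI_ex[OF N.degree_one_exists[OF \<delta>(1) that, unfolded Bex_def]] by (simp_all add: P_def)
    then show "P x \<in> carrier N" "\<delta> (P x) = P x" by auto
    show "coord (P x) = coord x"
      using lower_2_coord[OF *(3)] * that by (simp add: coord_diff fun_eq_iff)
  qed
  have P\<sigma>: "\<sigma> (P x) = P (\<sigma> x)" if x: "x \<in> carrier N" for x
  proof (rule N.degree_one_unique[OF \<delta>(1)])
    show "\<delta> (\<sigma> (P x)) = \<sigma> (P x)" using \<delta>(2)[OF P(1)[OF x]] P(2)[OF x] by simp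
    have "coord (\<sigma> (P x)) = coord (\<sigma> x)"
      using coord_semilinear[OF field_hom_simps(2) \<sigma>] P(1,3)[OF x] x by simp
    then show "\<sigma> (P x) \<ominus>\<^bsub>N\<^esub> P (\<sigma> x) \<in> lower 2"
      using x sc P by (intro coord_zero_lower_2) (simp_all add: coord_diff)
  qed (use x sc P in auto)
  define t where "t a = z \<odot>\<^bsub>N\<^esub> ver a \<oplus>\<^bsub>N\<^esub> cnj z \<odot>\<^bsub>N\<^esub> h (ver a)" for a
  have t: "t a \<in> carrier N" "coord (t a) = T (unit_fun a)" if "a \<in> S" for a
    using that N_vertex H coord_semilinear[OF field_hom_simps(1) hi]
    by (simp_all add: t_def T_def coord_simps)
  \<comment> \<open>Antilinearity exchanges z and cnj z. Since \<sigma> squares to the identity,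
    \<sigma> h is the standard conjugation, so \<sigma> swaps the two summands while permuting the
    vertices.\<close>
  have \<sigma>t: "\<sigma> (t a) = t (vperm \<phi> a)" if a: "a \<in> S" for a
  proof -
    have v: "vperm \<phi> a \<in> S" using vperm_S[OF \<phi> a] .
    have "?s (ver (vperm \<phi> a)) = ver a"
      using std_conj_involution[OF \<phi> \<phi>2 N_vertex[OF a]] stdv[OF a] by simp
    then show ?thesis
      using a v N_vertex H sc std_c by (simp add: t_def ss h_def inv stdv N.a_comm)
  qed
  obtain g where g: "g \<in> alg_hom N N" "\<And>a. a \<in> S \<Longrightarrow> g (ver a) = P (t a)"
    by (rule triangular_hom[OF \<delta>(1), of "\<lambda>a. P (t a)"]) (use P t Td in auto)
  \<comment> \<open>Built from the inverse \<open>R\<close> in the same way, \<open>f\<close>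
    inverts \<open>g\<close> only modulo commutators; unipotency of both composites supplies
    bijectivity of \<open>g\<close>.\<close>
  obtain f where f: "f \<in> alg_hom N N" "\<And>a. a \<in> S \<Longrightarrow> f (ver a) = P (lift (R (unit_fun a)))"
    by (rule triangular_hom[OF \<delta>(1), of "\<lambda>a. P (lift (R (unit_fun a)))"])
      (use P Rd Rc coord_lift in auto)
  have gT: "coord (g x) = T (coord x)" if "x \<in> carrier N" for x
  proof (rule coord_linear_eq[OF g(1) _ _ _ _ that])
    show "T (\<lambda>_. 0) = (\<lambda>_. 0)" using L.scale[of "\<lambda>_. 0" 0] by (simp add: T_def supported_def)
  qed (auto simp: T_def L.add L.scale algebra_simps g P t)
  have fR: "coord (f x) = R (coord x)" if "x \<in> carrier N" for x
  proof (rule coord_linear_eq[OF f(1) _ _ _ _ that])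
    show "R (\<lambda>_. 0) = (\<lambda>_. 0)"
      using L.poly_apply_lin[of "\<lambda>_. 0" "\<lambda>_. 0" r 0 0] by (auto simp: R_def supported_def fun_eq_iff)
    fix x y :: "'s \<Rightarrow> complex" and a assume x: "x \<in> supported S"
    show "R (\<lambda>s. a * x s) = (\<lambda>s. a * R x s)"
      using L.poly_apply_lin[OF x x, of r a 0] by (auto simp: R_def fun_eq_iff)
    assume y: "y \<in> supported S"
    show "R (\<lambda>s. x s + y s) = (\<lambda>s. R x s + R y s)"
      using L.poly_apply_lin[OF x y, of r 1 1] by (auto simp: R_def fun_eq_iff)
  qed (simp add: f P coord_lift Rc)
  note gc = alg_homD(1)[OF g(1)] and fc = alg_homD(1)[OF f(1)]
  have "f (g x) \<ominus>\<^bsub>N\<^esub> x \<in> lower 2" "g (f x) \<ominus>\<^bsub>N\<^esub> x \<in> lower 2" if "x \<in> carrier N" for x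
    using that gc fc gT fR RT TR coord_supported
    by (auto intro!: coord_zero_lower_2 simp: coord_diff)
  then have fg: "inj_on (\<lambda>x. f (g x)) (carrier N)" "(\<lambda>x. g (f x)) ` carrier N = carrier N"
    using N.unipotent_bij[OF alg_hom_comp[OF g(1) f(1)]] N.unipotent_bij[OF alg_hom_comp[OF f(1) g(1)]] by auto
  have "inj_on g (carrier N)" using fg(1) unfolding inj_on_def by metis
  moreover have "g ` carrier N = carrier N" using fg(2) gc fc by blast
  ultimately have giso: "g \<in> alg_iso N N" using g(1) by (simp add: alg_iso_def bij_betw_def)
  have "\<sigma> (g x) = g (?s x)" if "x \<in> carrier N" for x
  proof (rule semilinear_eqI[OF field_hom_simps(2) _ _ _ that])
    show "(\<lambda>x. \<sigma> (g x)) \<in> alg_hom N (twist_scalars cnj N)" by (rule alg_hom_comp[OF g(1) \<sigma>])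
    show "(\<lambda>x. g (?s x)) \<in> alg_hom N (twist_scalars cnj N)"
      by (rule alg_hom_comp[OF std alg_hom_twist[OF g(1)]])
    show "\<sigma> (g (ver a)) = g (?s (ver a))" if "a \<in> S" for a
      using that t by (simp add: g stdv vperm_S[OF \<phi>] P\<sigma> \<sigma>t)
  qed
  with \<phi> \<phi>2 giso show ?thesis using that by blast
qed

end

section \<open>The classification\<close>

context graph_nil_ord
begin

lemma twisted_form_fixed_alg: "twisted_form S E c enum \<phi> = N.fixed_alg (std_conj \<phi>)"
  by (simp add: twisted_form_def N.fixed_alg_def std_conj_def)

lemma involution_iff:
  "involution (aut_quotient S E) \<phi> \<longleftrightarrow> \<phi> \<in> carrier (aut_quotient S E) \<and> \<phi> \<circ> \<phi> = id"
  by (simp add: involution_def)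

lemma real_form_twisted:
  fixes M :: "(real, 'm) module"
  assumes "real_form M N"
  shows "\<exists>\<phi>. involution (aut_quotient S E) \<phi> \<and> alg_isomorphic M (twisted_form S E c enum \<phi>)"
proof -
  have M: "lie M" using assms by (simp add: real_form_def lie_algebra_iff)
  obtain F where F: "F \<in> alg_iso (complexification M) N"
    using assms by (auto simp: real_form_def alg_isomorphic_def)
  obtain \<sigma> where \<sigma>: "\<sigma> \<in> alg_hom N (twist_scalars cnj N)" "\<And>x. x \<in> carrier N \<Longrightarrow> \<sigma> (\<sigma> x) = x"
    "(\<lambda>m. F (m, \<zero>\<^bsub>M\<^esub>)) \<in> alg_iso M (N.fixed_alg \<sigma>)" using N.real_form_fixed_alg[OF M F] by blast
  obtain \<phi> g where g: "\<phi> \<in> carrier (aut_quotient S E)" "\<phi> \<circ> \<phi> = id" "g \<in> alg_iso N N"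
    "\<And>x. x \<in> carrier N \<Longrightarrow> \<sigma> (g x) = g (std_conj \<phi> x)"
    using semilinear_involution_standard[OF \<sigma>(1,2)] by blast
  obtain f where "f \<in> alg_iso (N.fixed_alg \<sigma>) (N.fixed_alg (std_conj \<phi>))"
    using N.fixed_alg_iso(1)[OF g(3), of \<sigma> "std_conj \<phi>"] g(4) N.semilinear_closed[OF std_conj_hom[OF g(1)]]
    by blast
  then have "(\<lambda>m. f (F (m, \<zero>\<^bsub>M\<^esub>))) \<in> alg_iso M (N.fixed_alg (std_conj \<phi>))" by (rule alg_iso_comp[OF \<sigma>(3)])
  then have "alg_isomorphic M (twisted_form S E c enum \<phi>)"
    unfolding alg_isomorphic_def twisted_form_fixed_alg by blast
  then show ?thesis using g(1,2) involution_iff by blast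
qed

text \<open>The isomorphism extends to a complex automorphism g that intertwines the two
  conjugations. Passing to the quotient graph turns this equation into conjugacy by the automorphism
  which g induces.\<close>

lemma twisted_form_iso_conjugate:
  assumes "involution (aut_quotient S E) \<phi>" "involution (aut_quotient S E) \<psi>"
    and "alg_isomorphic (twisted_form S E c enum \<phi>) (twisted_form S E c enum \<psi>)"
  shows "conjugate_in (aut_quotient S E) \<phi> \<psi>"
proof -
  let ?A = "aut_quotient S E"
  interpret A: group ?A by (rule aut_quotient_group)
  have \<phi>: "\<phi> \<in> carrier ?A" "\<phi> \<circ> \<phi> = id" and \<psi>: "\<psi> \<in> carrier ?A" "\<psi> \<circ> \<psi> = id"
    using assms(1,2) involution_iff by auto
  obtain h where h: "h \<in> alg_iso (N.fixed_alg (std_conj \<phi>)) (N.fixed_alg (std_conj \<psi>))"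
    using assms(3) unfolding alg_isomorphic_def twisted_form_fixed_alg by blast
  let ?F = "N.fixed_alg (std_conj \<phi>)" and ?F' = "N.fixed_alg (std_conj \<psi>)"
  note \<sigma> = std_conj_hom[OF \<phi>(1)] std_conj_involution[OF \<phi>]
  note \<sigma>' = std_conj_hom[OF \<psi>(1)] std_conj_involution[OF \<psi>]
  obtain h' where h': "h' \<in> alg_hom ?F' ?F"
    "\<And>x. x \<in> carrier ?F \<Longrightarrow> h' (h x) = x" "\<And>x. x \<in> carrier ?F' \<Longrightarrow> h (h' x) = x"
  proof (rule alg_iso_inverse[OF h])
    fix x y a assume "x \<in> carrier ?F"
    then show "a \<odot>\<^bsub>?F\<^esub> x \<in> carrier ?F" by (simp add: N.semilinear_simps[OF \<sigma>(1)])
    assume "y \<in> carrier ?F"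
    with \<open>x \<in> carrier ?F\<close> show "x \<oplus>\<^bsub>?F\<^esub> y \<in> carrier ?F" "x \<otimes>\<^bsub>?F\<^esub> y \<in> carrier ?F"
      by (simp_all add: N.semilinear_simps[OF \<sigma>(1)])
  qed blast
  obtain g g' where g: "g \<in> alg_hom N N" "g' \<in> alg_hom N N"
    "\<And>x. x \<in> carrier N \<Longrightarrow> std_conj \<psi> (g x) = g (std_conj \<phi> x)"
    "\<And>x. x \<in> carrier N \<Longrightarrow> g' (g x) = x" "\<And>x. x \<in> carrier N \<Longrightarrow> g (g' x) = x"
    using N.extend_fixed_iso[OF \<sigma> \<sigma>' alg_iso_hom[OF h] h'] by blast
  have gi: "g \<in> alg_hom N (twist_scalars (\<lambda>a. a) N)" "g' \<in> alg_hom N (twist_scalars (\<lambda>a. a) N)"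
    using g by simp_all
  obtain \<chi> where \<chi>: "induces g \<chi>" using induces_exists[OF field_aut_simps(1) gi g(4,5)] by blast
  have c\<chi>: "\<chi> \<in> carrier ?A" using \<chi> by (simp add: induces_def)
  have "induces (\<lambda>x. g (std_conj \<phi> x)) (\<chi> \<circ> \<phi>)"
    by (rule induces_comp[OF induces_std_conj[OF \<phi>] \<chi> field_hom_simps(1) gi(1) \<sigma>(1)])
  moreover have "induces (\<lambda>x. std_conj \<psi> (g x)) (\<psi> \<circ> \<chi>)"
    by (rule induces_comp[OF \<chi> induces_std_conj[OF \<psi>] field_hom_simps(2) \<sigma>'(1) gi(1)])
  then have "induces (\<lambda>x. g (std_conj \<phi> x)) (\<psi> \<circ> \<chi>)" by (rule induces_cong) (rule g(3))
  ultimately have eq: "\<chi> \<circ> \<phi> = \<psi> \<circ> \<chi>" by (rule induces_unique)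
  have "\<psi> = (\<chi> \<otimes>\<^bsub>?A\<^esub> \<phi>) \<otimes>\<^bsub>?A\<^esub> inv\<^bsub>?A\<^esub> \<chi>"
    using A.inv_solve_right[of \<psi> "\<chi> \<otimes>\<^bsub>?A\<^esub> \<phi>" \<chi>] A.m_closed[of \<chi> \<phi>] eq c\<chi> \<phi>(1) \<psi>(1) by simp
  then show ?thesis using c\<chi> by (auto simp: conjugate_in_def)
qed

text \<open>The lift of the conjugating automorphism intertwines the standard conjugations: both
  composites are antilinear and send vertices to vertices, where \<chi> \<phi> = \<psi> \<chi>
  decides.\<close>

lemma conjugate_twisted_form_iso:
  assumes "involution (aut_quotient S E) \<phi>" "involution (aut_quotient S E) \<psi>"
    and "conjugate_in (aut_quotient S E) \<phi> \<psi>"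
  shows "alg_isomorphic (twisted_form S E c enum \<phi>) (twisted_form S E c enum \<psi>)"
proof -
  let ?A = "aut_quotient S E"
  interpret A: group ?A by (rule aut_quotient_group)
  have \<phi>: "\<phi> \<in> carrier ?A" "\<phi> \<circ> \<phi> = id" and \<psi>: "\<psi> \<in> carrier ?A" "\<psi> \<circ> \<psi> = id"
    using assms(1,2) involution_iff by auto
  obtain \<chi> where \<chi>: "\<chi> \<in> carrier ?A" "\<psi> = \<chi> \<otimes>\<^bsub>?A\<^esub> \<phi> \<otimes>\<^bsub>?A\<^esub> inv\<^bsub>?A\<^esub> \<chi>"
    using assms(3) by (auto simp: conjugate_in_def)
  then have eq: "\<chi> \<circ> \<phi> = \<psi> \<circ> \<chi>"
    using A.inv_solve_right[of \<psi> "\<chi> \<otimes>\<^bsub>?A\<^esub> \<phi>" \<chi>] A.m_closed[of \<chi> \<phi>] \<phi>(1) \<psi>(1) by simp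
  let ?g = "aut_lift S E c enum \<chi>"
  have g: "?g \<in> alg_hom N N" "?g \<in> alg_iso N N" using aut_lift_aux[OF \<chi>(1)] alg_iso_hom by blast+
  have "std_conj \<psi> (?g x) = ?g (std_conj \<phi> x)" if "x \<in> carrier N" for x
  proof (rule semilinear_eqI[OF field_hom_simps(2) _ _ _ that])
    show "(\<lambda>x. std_conj \<psi> (?g x)) \<in> alg_hom N (twist_scalars cnj N)"
      by (rule alg_hom_comp[OF g(1) std_conj_hom[OF \<psi>(1)]])
    show "(\<lambda>x. ?g (std_conj \<phi> x)) \<in> alg_hom N (twist_scalars cnj N)"
      by (rule alg_hom_comp[OF std_conj_hom[OF \<phi>(1)] alg_hom_twist[OF g(1)]])
    show "std_conj \<psi> (?g (ver a)) = ?g (std_conj \<phi> (ver a))" if "a \<in> S" for a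
      using that eq by (simp add: aut_lift(2)[OF \<chi>(1)] std_conj_vertex \<phi>(1) \<psi>(1) vperm_S \<chi>(1) vperm_comp)
  qed
  then have "?g \<in> alg_iso (N.fixed_alg (std_conj \<phi>)) (N.fixed_alg (std_conj \<psi>))"
    using N.semilinear_closed[OF std_conj_hom[OF \<phi>(1)]] by (intro N.fixed_alg_iso(2)[OF g(2)]) auto
  then show ?thesis unfolding alg_isomorphic_def twisted_form_fixed_alg by blast
qed

end

theorem theorem1p2:
  fixes S :: "'s set" and E :: "'s set set" and c :: nat
    and enum :: "'s set \<Rightarrow> nat \<Rightarrow> 's"
  assumes "simple_graph S E" and "c > 1" and "component_ordering S E enum"
  shows "(\<forall>M :: (real, 'm) module.
            real_form M (nil_lie S E c :: (complex, ('s magma \<Rightarrow>\<^sub>0 complex) set set set) module) \<longrightarrow>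
            (\<exists>\<phi>. involution (aut_quotient S E) \<phi> \<and>
                 alg_isomorphic M (twisted_form S E c enum \<phi>))) \<and>
         (\<forall>\<phi> \<psi>. involution (aut_quotient S E) \<phi> \<longrightarrow> involution (aut_quotient S E) \<psi> \<longrightarrow>
            (alg_isomorphic (twisted_form S E c enum \<phi>) (twisted_form S E c enum \<psi>) \<longleftrightarrow>
             conjugate_in (aut_quotient S E) \<phi> \<psi>))"
proof -
  interpret graph_nil_ord S E c enum by unfold_locales (fact assms)+
  show ?thesis
    using real_form_twisted twisted_form_iso_conjugate conjugate_twisted_form_iso by blast
qed

end
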